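(* Let $A,B\in M_d(\mathbb{R})$, $C\in\mathbb{S}_d^{++}$ and let $L$ be a $d$-dimensional Lévy process. Then the stochastic differential equation $$dY_t=(BY_{t-}+Y_{t-}B^* )\,dt+A(C+Y_{t-})^{1/2}\,d[L,L]_t^{\mathfrak{d}}\,(C+Y_{t-})^{1/2}A^*$$ with initial value $Y_0\in\mathbb{S}_d^+$ has a unique positive semidefinite solution $(Y_t)_{t\in\mathbb{R}^+}$. The solution $(Y_t)_{t\in\mathbb{R}^+}$ is locally bounded and of finite variation. Moreover, it satisfies $Y_t\ge e^{Bt}Y_0e^{B^*t}$ for all $t\in\mathbb{R}^+$.
   Context: $M_d(\mathbb{R})$: real $d\times d$ matrices; $\mathbb{S}_d$: symmetric ones; $\mathbb{S}_d^+$ (resp. $\mathbb{S}_d^{++}$): positive semidefinite (resp. positive definite) ones; $X\le Z$ means $Z-X\in\mathbb{S}_d^+$; $X^*$ is the transpose; $X^{1/2}$ is the positive semidefinite square root of $X\in\mathbb{S}_d^+$; $\mathbb{R}^+=[0,\infty)$. All processes live on a filtered probability space satisfying the usual conditions; $L$ is a càdlàg $\mathbb{R}^d$-valued Lévy process with respect to this filtration, $L_0=0$, and $Y_0$ is an $\mathcal{F}_0$-measurable $\mathbb{S}_d^+$-valued random variable. $[L,L]^{\mathfrak{d}}_t=\sum_{0\le s\le t}(\Delta L_s)(\Delta L_s)^*$ is the discontinuous part of the quadratic variation of $L$ (an $\mathbb{S}_d^+$-valued process). For matrix processes, $\int_0^t X_{s-}\,dZ_s\,W_{s-}$ is the matrix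 with $(i,j)$ entry $\sum_{k,l}\int_0^t X_{ik,s-}W_{lj,s-}\,dZ_{kl,s}$. Solutions are càdlàg adapted and uniqueness is up to indistinguishability. A process $Y$ is locally bounded if there are stopping times $T_n\uparrow\infty$ a.s. and constants $k_n$ with $\|Y_t\|\le k_n$ for all $0\le t<T_n$. *)

theory Defs
  imports "HOL-Probability.Probability"
begin

section \<open>Matrices\<close>

text \<open>Note that \<open>*\<close> and \<open>^\<close> act componentwise on \<open>real ^ 'd ^ 'd\<close>; matrix products are written
  \<open>**\<close> throughout.\<close>

definition symmetric_matrix :: "real ^ 'd ^ 'd \<Rightarrow> bool" where
  "symmetric_matrix X \<longleftrightarrow> transpose X = X"

definition psd :: "real ^ 'd ^ 'd \<Rightarrow> bool" where
  "psd X \<longleftrightarrow> symmetric_matrix X \<and> (\<forall>v. 0 \<le> v \<bullet> (X *v v))"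

definition pos_def :: "real ^ 'd ^ 'd \<Rightarrow> bool" where
  "pos_def X \<longleftrightarrow> symmetric_matrix X \<and> (\<forall>v. v \<noteq> 0 \<longrightarrow> 0 < v \<bullet> (X *v v))"

definition loewner_le :: "real ^ 'd ^ 'd \<Rightarrow> real ^ 'd ^ 'd \<Rightarrow> bool" where
  "loewner_le X Z \<longleftrightarrow> psd (Z - X)"

definition psd_sqrt :: "real ^ 'd ^ 'd \<Rightarrow> real ^ 'd ^ 'd" where
  "psd_sqrt X = (THE S. psd S \<and> S ** S = X)"

text \<open>The library's \<open>exp\<close> is not available on \<open>real ^ 'd ^ 'd\<close>, since its
  multiplication is the componentwise one.\<close>

definition matrix_exp :: "real ^ 'd ^ 'd \<Rightarrow> real ^ 'd ^ 'd" where
  "matrix_exp X = (\<Sum>n. (1 / fact n) *\<^sub>R (((**) X ^^ n) (mat 1)))"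


section \<open>Paths\<close>

text \<open>Time is modelled by \<open>real\<close>, but only the values of a path on \<open>[0, \<infinity>)\<close> are ever used.
  At time \<open>0\<close> we use the convention \<open>f\<^sub>0\<^sub>- = f\<^sub>0\<close>, so there is no jump at \<open>0\<close>.\<close>

definition left_limit :: "(real \<Rightarrow> 'b::t2_space) \<Rightarrow> real \<Rightarrow> 'b" where
  "left_limit f t = (if t \<le> 0 then f 0 else Lim (at_left t) f)"

definition jump :: "(real \<Rightarrow> 'b::real_normed_vector) \<Rightarrow> real \<Rightarrow> 'b" where
  "jump f t = f t - left_limit f t"

definition cadlag :: "(real \<Rightarrow> 'b::t2_space) \<Rightarrow> bool" where
  "cadlag f \<longleftrightarrow> (\<forall>t\<ge>0. continuous (at_right t) f) \<and> (\<forall>t>0. \<exists>l. (f \<longlongrightarrow> l) (at_left t))"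

definition finite_variation_path :: "(real \<Rightarrow> 'b::real_normed_vector) \<Rightarrow> bool" where
  "finite_variation_path f \<longleftrightarrow>
     (\<forall>t\<ge>0. \<exists>K. \<forall>n (\<tau> :: nat \<Rightarrow> real). mono \<tau> \<and> range \<tau> \<subseteq> {0..t} \<longrightarrow>
        (\<Sum>i<n. norm (f (\<tau> (Suc i)) - f (\<tau> i))) \<le> K)"

text \<open>\<open>[L, L]\<^sup>d\<^sub>t\<close>, the sum of \<open>(\<Delta>L\<^sub>s) (\<Delta>L\<^sub>s)\<^sup>*\<close> over \<open>0 \<le> s \<le> t\<close>, for a single path \<open>l\<close>
  of \<open>L\<close>; it is an unordered sum with at most countably many nonzero terms.\<close>

definition disc_quad_var :: "(real \<Rightarrow> real ^ 'd) \<Rightarrow> real \<Rightarrow> real ^ 'd ^ 'd" where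
  "disc_quad_var l t =
     (\<Sum>\<^sub>\<infinity>s\<in>{0..t}. (columnvector (jump l s) :: real ^ 1 ^ 'd) ** transpose (columnvector (jump l s)))"


section \<open>Lebesgue--Stieltjes integrals\<close>

text \<open>All stochastic integrals needed here have integrators of finite variation and left-continuous,
  locally bounded integrands, so they are pathwise Lebesgue--Stieltjes integrals. The integral of
  \<open>f\<close> over \<open>(0, t]\<close> with respect to a right-continuous \<open>g\<close> of locally finite variation is defined
  by writing \<open>g\<close> as a difference of nondecreasing right-continuous functions; it does not depend on
  the decomposition. The total version below takes an arbitrary value if the integral does not exist.\<close>

definition has_stieltjes_integral ::
    "(real \<Rightarrow> real) \<Rightarrow> (real \<Rightarrow> real) \<Rightarrow> real \<Rightarrow> real \<Rightarrow> bool" where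
  "has_stieltjes_integral f g t I \<longleftrightarrow>
     (\<exists>P N. mono P \<and> mono N \<and> (\<forall>s. continuous (at_right s) P) \<and> (\<forall>s. continuous (at_right s) N) \<and>
        (\<forall>s\<in>{0..t}. g s = P s - N s) \<and>
        set_integrable (interval_measure P) {0<..t} f \<and>
        set_integrable (interval_measure N) {0<..t} f \<and>
        I = set_lebesgue_integral (interval_measure P) {0<..t} f
          - set_lebesgue_integral (interval_measure N) {0<..t} f)"

definition stieltjes_integral :: "(real \<Rightarrow> real) \<Rightarrow> (real \<Rightarrow> real) \<Rightarrow> real \<Rightarrow> real" where
  "stieltjes_integral f g t = (THE I. has_stieltjes_integral f g t I)"

text \<open>The integral of \<open>X\<^sub>s dZ\<^sub>s W\<^sub>s\<close> over \<open>(0, t]\<close>.\<close>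

definition matrix_stieltjes_integral ::
    "(real \<Rightarrow> real ^ 'd ^ 'd) \<Rightarrow> (real \<Rightarrow> real ^ 'd ^ 'd) \<Rightarrow> (real \<Rightarrow> real ^ 'd ^ 'd)
      \<Rightarrow> real \<Rightarrow> real ^ 'd ^ 'd" where
  "matrix_stieltjes_integral X Z W t =
     (\<chi> i j. \<Sum>k\<in>UNIV. \<Sum>l\<in>UNIV.
        stieltjes_integral (\<lambda>s. X s $ i $ k * W s $ l $ j) (\<lambda>s. Z s $ k $ l) t)"


section \<open>Processes\<close>

text \<open>The library's filtrations are indexed by all of \<open>real\<close>. The \<open>\<sigma>\<close>-algebras at negative times are
  irrelevant; any filtration on \<open>[0, \<infinity>)\<close> extends, for instance by \<open>F 0\<close>.\<close>

locale usual_filtered_prob_space =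
  prob_space M + complete_measure M + filtration "space M" F
  for M :: "'a measure" and F :: "real \<Rightarrow> 'a measure" +
  assumes subalgebra_F: "0 \<le> t \<Longrightarrow> subalgebra M (F t)"
    and null_sets_F: "null_sets M \<subseteq> sets (F 0)"
    and right_continuous_F: "0 \<le> t \<Longrightarrow> sets (F t) = (\<Inter>u\<in>{t<..}. sets (F u))"

definition adapted :: "(real \<Rightarrow> 'a measure) \<Rightarrow> (real \<Rightarrow> 'a \<Rightarrow> 'b::topological_space) \<Rightarrow> bool" where
  "adapted F X \<longleftrightarrow> (\<forall>t\<ge>0. X t \<in> borel_measurable (F t))"

definition cadlag_process ::
    "'a measure \<Rightarrow> (real \<Rightarrow> 'a measure) \<Rightarrow> (real \<Rightarrow> 'a \<Rightarrow> 'b::t2_space) \<Rightarrow> bool" where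
  "cadlag_process M F X \<longleftrightarrow> adapted F X \<and> (AE \<omega> in M. cadlag (\<lambda>t. X t \<omega>))"

definition indistinguishable ::
    "'a measure \<Rightarrow> (real \<Rightarrow> 'a \<Rightarrow> 'b) \<Rightarrow> (real \<Rightarrow> 'a \<Rightarrow> 'b) \<Rightarrow> bool" where
  "indistinguishable M X X' \<longleftrightarrow> (AE \<omega> in M. \<forall>t\<ge>0. X t \<omega> = X' t \<omega>)"

definition levy_process ::
    "'a measure \<Rightarrow> (real \<Rightarrow> 'a measure) \<Rightarrow> (real \<Rightarrow> 'a \<Rightarrow> real ^ 'd) \<Rightarrow> bool" where
  "levy_process M F L \<longleftrightarrow>
     cadlag_process M F L \<and>
     (AE \<omega> in M. L 0 \<omega> = 0) \<and>
     (\<forall>s\<ge>0. \<forall>t\<ge>s. prob_space.indep_set M (sets (F s))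
        (sets (vimage_algebra (space M) (\<lambda>\<omega>. L t \<omega> - L s \<omega>) borel))) \<and>
     (\<forall>s\<ge>0. \<forall>t\<ge>s. distr M borel (\<lambda>\<omega>. L t \<omega> - L s \<omega>) = distr M borel (L (t - s))) \<and>
     (\<forall>t\<ge>0. \<forall>e>0. ((\<lambda>s. measure M {\<omega>\<in>space M. e < norm (L s \<omega> - L t \<omega>)}) \<longlongrightarrow> 0)
        (at t within {0..}))"

text \<open>The localizing stopping times are taken to be finite, as in the library's \<open>stopping_time\<close>; this
  is no loss, since \<open>T n\<close> may be replaced by its minimum with \<open>n\<close>.\<close>

definition locally_bounded ::
    "'a measure \<Rightarrow> (real \<Rightarrow> 'a measure) \<Rightarrow> (real \<Rightarrow> 'a \<Rightarrow> 'b::real_normed_vector) \<Rightarrow> bool" where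
  "locally_bounded M F Y \<longleftrightarrow>
     (\<exists>(T :: nat \<Rightarrow> 'a \<Rightarrow> real) (k :: nat \<Rightarrow> real).
        (\<forall>n. stopping_time F (T n) \<and> (\<forall>\<omega>\<in>space M. 0 \<le> T n \<omega>)) \<and>
        (AE \<omega> in M. incseq (\<lambda>n. T n \<omega>) \<and> filterlim (\<lambda>n. T n \<omega>) at_top sequentially) \<and>
        (AE \<omega> in M. \<forall>n t. 0 \<le> t \<and> t < T n \<omega> \<longrightarrow> norm (Y t \<omega>) \<le> k n))"

definition finite_variation ::
    "'a measure \<Rightarrow> (real \<Rightarrow> 'a \<Rightarrow> 'b::real_normed_vector) \<Rightarrow> bool" where
  "finite_variation M Y \<longleftrightarrow> (AE \<omega> in M. finite_variation_path (\<lambda>t. Y t \<omega>))"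

text \<open>Positive semidefinite solutions of
  \<open>dY\<^sub>t = (B Y\<^sub>t\<^sub>- + Y\<^sub>t\<^sub>- B\<^sup>*) dt + A (C + Y\<^sub>t\<^sub>-)\<^sup>1\<^sup>/\<^sup>2 d[L,L]\<^sup>d\<^sub>t (C + Y\<^sub>t\<^sub>-)\<^sup>1\<^sup>/\<^sup>2 A\<^sup>*\<close>
  with initial value \<open>Y0\<close>, understood as an integral equation up to indistinguishability.\<close>

definition psd_solution ::
    "'a measure \<Rightarrow> (real \<Rightarrow> 'a measure) \<Rightarrow> real ^ 'd ^ 'd \<Rightarrow> real ^ 'd ^ 'd \<Rightarrow> real ^ 'd ^ 'd
      \<Rightarrow> (real \<Rightarrow> 'a \<Rightarrow> real ^ 'd) \<Rightarrow> ('a \<Rightarrow> real ^ 'd ^ 'd) \<Rightarrow> (real \<Rightarrow> 'a \<Rightarrow> real ^ 'd ^ 'd) \<Rightarrow> bool" where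
  "psd_solution M F A B C L Y0 Y \<longleftrightarrow>
     cadlag_process M F Y \<and>
     (AE \<omega> in M. \<forall>t\<ge>0. psd (Y t \<omega>)) \<and>
     (AE \<omega> in M. \<forall>t\<ge>0.
        let Y_left = left_limit (\<lambda>s. Y s \<omega>) in
        Y t \<omega> = Y0 \<omega>
          + (LBINT s:{0..t}. B ** Y_left s + Y_left s ** transpose B)
          + matrix_stieltjes_integral
              (\<lambda>s. A ** psd_sqrt (C + Y_left s))
              (disc_quad_var (\<lambda>s. L s \<omega>))
              (\<lambda>s. psd_sqrt (C + Y_left s) ** transpose A) t)"

end

theory Submission
  imports Defs
begin

text \<open>
  The substitution \<open>Z\<^sub>t = exp (-Bt) Y\<^sub>t exp (-B\<^sup>*t)\<close> removes the drift. What remains is an equation driven by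
  the jumps of \<open>L\<close> alone, \<open>Z\<^sub>t = Y\<^sub>0 + \<Sum>\<^sub>s\<^sub>\<le>\<^sub>t h\<^sub>s (Z\<^sub>s\<^sub>-, \<Delta>L\<^sub>s)\<close> with positive semidefinite summands, so \<open>Z\<^sub>t \<ge> Y\<^sub>0\<close>;
  this is the lower bound. Since \<open>C + Y \<ge> C > 0\<close>, the square root is Lipschitz where it is evaluated, and \<open>h\<close>
  is locally Lipschitz and of linear growth in \<open>Z\<close> and quadratic in the jump. On every path with square
  summable jumps, linear growth bounds all Picard iterates at once, and they contract in a supremum norm
  with an exponential weight in the accumulated squared jumps. The limit is adapted because sums over jumps
  are limits of Riemann sums over grids.

  That the jumps are square summable is seen coordinatewise: if \<open>\<phi>\<^sub>t\<close> is the characteristic function of a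
  coordinate of \<open>L\<^sub>t\<close>, then \<open>\<phi>\<^bsub>t/n\<^esub>\<close> is an \<open>n\<close>-th root of \<open>\<phi>\<^sub>t\<close>, so that \<open>n (1 - Re \<phi>\<^bsub>t/n\<^esub>(r))\<close>, the expected sum of
  \<open>1 - cos (r \<Delta>)\<close> over the \<open>n\<close> increments \<open>\<Delta>\<close> of a grid, is bounded for small \<open>r\<close>. By Fatou's lemma the sum of
  \<open>1 - cos (r \<Delta>L\<^sub>s)\<close> over the jumps is almost surely finite, and \<open>1 - cos (r x)\<close> is comparable to \<open>x\<^sup>2\<close> near \<open>0\<close>.
\<close>

text \<open>Nothing is integrated stochastically: \<open>[L,L]^d\<close> has finite variation, so
  the equation is solved on each path, and probability enters only through the square summability of
  the jumps and through adaptedness. The drift is removed because every summand of what remains is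
  psd; iterating on the equation with drift would not visibly preserve the cone, as
  \<open>B X + X B^T\<close> need not be psd. The coefficient is not globally Lipschitz. Its linear
  growth rests on \<open>(norm (psd_sqrt X))^2 = tr X\<close> and confines all iterates to one ball
  before any Lipschitz constant is chosen; that constant comes from \<open>C >= c I\<close> and the
  radius of the ball. Uniqueness is proved for the original equation, so one direction of the
  substitution suffices. The paths of \<open>L\<close> are good outside a null set, which by the
  usual conditions lies in \<open>F 0\<close>; replacing \<open>L\<close> by zero there keeps it
  adapted and makes every path good. Local boundedness comes from first passage times of an adapted
  process with cadlag paths. A continuous part of \<open>L\<close> is never split off: along grids
  it only meets nonnegative or cut off terms.\<close>

no_notation Infinite_Set_Sum.abs_summable_on (infix "abs'_summable'_on" 50)

subsection \<open>Cadlag paths and their jumps\<close>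

lemma tendsto_left_limit:
  assumes "cadlag f" "0 < t"
  shows "(f \<longlongrightarrow> left_limit f t) (at_left t)"
proof -
  obtain l where l: "(f \<longlongrightarrow> l) (at_left t)"
    using assms by (auto simp: cadlag_def)
  then have "Lim (at_left t) f = l"
    by (intro tendsto_Lim) auto
  with l assms show ?thesis by (simp add: left_limit_def)
qed

lemma left_limit_eqI:
  assumes "(f \<longlongrightarrow> l) (at_left t)" "0 < t"
  shows "left_limit f t = l"
  using assms by (auto simp: left_limit_def intro!: tendsto_Lim)

lemma left_limit_0 [simp]: "left_limit f 0 = f 0"
  by (simp add: left_limit_def)

lemma jump_0 [simp]: "jump f 0 = 0"
  by (simp add: jump_def)

lemma tendsto_right_cadlag:
  assumes "cadlag f" "0 \<le> t"
  shows "(f \<longlongrightarrow> f t) (at_right t)"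
  using assms by (auto simp: cadlag_def continuous_within)

text \<open>\<open>g\<close> is asked to be continuous only on a closed \<open>S\<close>, as
  \<open>psd_sqrt (C + Y)\<close> is on the cone. Closedness keeps the left limits in
  \<open>S\<close>, so that \<open>g\<close> passes through them.\<close>

lemma cadlag_continuous_map:
  assumes f: "cadlag f" and S: "closed S" "\<And>t. 0 \<le> t \<Longrightarrow> f t \<in> S" and g: "continuous_on S g"
  shows "cadlag (\<lambda>t. g (f t))"
    and "0 \<le> t \<Longrightarrow> left_limit (\<lambda>t. g (f t)) t = g (left_limit f t)"
    and "0 \<le> t \<Longrightarrow> left_limit f t \<in> S"
proof -
  have right: "((\<lambda>t. g (f t)) \<longlongrightarrow> g (f t)) (at_right t)" if "0 \<le> t" for t
    by (rule continuous_on_tendsto_compose[OF g tendsto_right_cadlag[OF f that]])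
       (use that S in \<open>auto simp: eventually_at_right_less eventually_at_filter\<close>)
  have ev: "\<forall>\<^sub>F s in at_left t. f s \<in> S" if "0 < t" for t
    by (rule eventually_mono[OF eventually_at_left_real[OF that]]) (use S in auto)
  have S': "left_limit f t \<in> S" if "0 < t" for t
    by (rule Lim_in_closed_set[OF S(1) ev[OF that] _ tendsto_left_limit[OF f that]]) simp
  then show "0 \<le> t \<Longrightarrow> left_limit f t \<in> S"
    using S(2)[of 0] by (cases "t = 0") auto
  have left: "((\<lambda>t. g (f t)) \<longlongrightarrow> g (left_limit f t)) (at_left t)" if "0 < t" for t
    by (rule continuous_on_tendsto_compose[OF g tendsto_left_limit[OF f that] S'[OF that] ev[OF that]])
  show "cadlag (\<lambda>t. g (f t))"
    unfolding cadlag_def continuous_within using right left by auto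
  show "0 \<le> t \<Longrightarrow> left_limit (\<lambda>t. g (f t)) t = g (left_limit f t)"
    using left_limit_eqI[OF left] by (cases "t = 0") auto
qed

text \<open>Two one-sided neighbourhoods with separate centres, merged into one radius; this is the
  local input of the compactness arguments for cadlag paths.\<close>

lemma cadlag_near:
  fixes f :: "real \<Rightarrow> 'b::real_normed_vector"
  assumes f: "cadlag f" and t: "0 \<le> t" and e: "0 < e"
  obtains r where "0 < r"
    "\<And>s. 0 \<le> s \<Longrightarrow> t - r < s \<Longrightarrow> s < t \<Longrightarrow> norm (f s - left_limit f t) < e"
    "\<And>s. t \<le> s \<Longrightarrow> s < t + r \<Longrightarrow> norm (f s - f t) < e"
proof -
  have "\<forall>\<^sub>F s in at_right t. dist (f s) (f t) < e"
    using tendstoD[OF tendsto_right_cadlag[OF f t] e] .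
  then obtain b where b: "t < b" "\<And>s. t < s \<Longrightarrow> s < b \<Longrightarrow> dist (f s) (f t) < e"
    by (auto simp: eventually_at_right_field)
  obtain a where a: "a < t" "\<And>s. 0 \<le> s \<Longrightarrow> a < s \<Longrightarrow> s < t \<Longrightarrow> dist (f s) (left_limit f t) < e"
  proof (cases "t = 0")
    \<comment> \<open>At \<open>t = 0\<close> the condition on \<open>s < t\<close> is
      vacuous.\<close>
    case True
    then show ?thesis by (intro that[of "-1"]) auto
  next
    case False
    then have "\<forall>\<^sub>F s in at_left t. dist (f s) (left_limit f t) < e"
      using tendstoD[OF tendsto_left_limit[OF f] e] t by auto
    then show ?thesis using that by (auto simp: eventually_at_left_field)
  qed
  show ?thesis
  proof (rule that[of "min (b - t) (t - a)"])
    show "0 < min (b - t) (t - a)" using a b by simp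
    show "norm (f s - left_limit f t) < e" if "0 \<le> s" "t - min (b - t) (t - a) < s" "s < t" for s
      using a(2)[of s] that by (auto simp: dist_norm)
    show "norm (f s - f t) < e" if "t \<le> s" "s < t + min (b - t) (t - a)" for s
      using b(2)[of s] that e by (cases "s = t") (auto simp: dist_norm)
  qed
qed

lemma cadlag_bounded:
  fixes f :: "real \<Rightarrow> 'b::real_normed_vector"
  assumes f: "cadlag f"
  obtains K where "\<And>s. s \<in> {0..t} \<Longrightarrow> norm (f s) \<le> K"
proof -
  have "\<exists>r K. 0 < r \<and> (\<forall>s\<ge>0. \<bar>s - c\<bar> < r \<longrightarrow> norm (f s) \<le> K)" if c: "c \<in> {0..t}" for c
  proof -
    obtain r where r: "0 < r"
      "\<And>s. 0 \<le> s \<Longrightarrow> c - r < s \<Longrightarrow> s < c \<Longrightarrow> norm (f s - left_limit f c) < 1"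
      "\<And>s. c \<le> s \<Longrightarrow> s < c + r \<Longrightarrow> norm (f s - f c) < 1"
      using cadlag_near[OF f, of c 1] c by auto
    have "norm (f s) \<le> norm (f c) + norm (left_limit f c) + 1" if "0 \<le> s" "\<bar>s - c\<bar> < r" for s
    proof (cases "s < c")
      case True
      then have "norm (f s - left_limit f c) < 1" using r(2)[of s] that by auto
      then show ?thesis using norm_triangle_sub[of "f s" "left_limit f c"] norm_ge_zero[of "f c"] by linarith
    next
      case False
      then have "norm (f s - f c) < 1" using r(3)[of s] that by auto
      then show ?thesis
        using norm_triangle_sub[of "f s" "f c"] norm_ge_zero[of "left_limit f c"] by linarith
    qed
    with r(1) show ?thesis by blast
  qed
  then obtain r K where rK: "\<And>c. c \<in> {0..t} \<Longrightarrow> 0 < r c"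
    "\<And>c s. c \<in> {0..t} \<Longrightarrow> 0 \<le> s \<Longrightarrow> \<bar>s - c\<bar> < r c \<Longrightarrow> norm (f s) \<le> K c"
    by metis
  have cover: "{0..t} \<subseteq> (\<Union>c\<in>{0..t}. ball c (r c))"
  proof
    fix c assume "c \<in> {0..t}"
    then show "c \<in> (\<Union>c\<in>{0..t}. ball c (r c))" using rK(1)[of c] by (intro UN_I[of c]) auto
  qed
  obtain D where D: "D \<subseteq> {0..t}" "finite D" "{0..t} \<subseteq> (\<Union>c\<in>D. ball c (r c))"
    by (rule compactE_image[OF compact_Icc[of 0 t] _ cover]) auto
  show ?thesis
  proof (rule that[of "Max (insert 0 (K ` D))"])
    fix s assume s: "s \<in> {0..t}"
    then obtain c where c: "c \<in> D" "dist c s < r c" using D(3) by auto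
    then have "norm (f s) \<le> K c"
      using rK(2)[of c s] D s by (auto simp: dist_real_def abs_minus_commute)
    then show "norm (f s) \<le> Max (insert 0 (K ` D))" using D(2) c(1) Max_ge_iff[of "insert 0 (K ` D)"] by auto
  qed
qed

lemma left_limit_norm_le:
  fixes f :: "real \<Rightarrow> 'b::real_normed_vector"
  assumes f: "cadlag f" and K: "\<And>s. s \<in> {0..t} \<Longrightarrow> norm (f s) \<le> K" and s: "s \<in> {0..t}"
  shows "norm (left_limit f s) \<le> K"
proof (cases "s = 0")
  case False
  with s have s: "0 < s" "s \<le> t" by auto
  show ?thesis
    by (rule tendsto_upperbound[OF tendsto_norm[OF tendsto_left_limit[OF f s(1)]]])
       (auto intro!: eventually_mono[OF eventually_at_left_real[OF s(1)]] K intro: less_imp_le order_trans[OF less_imp_le s(2)])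
qed (use assms in auto)

text \<open>Near a fixed \<open>c\<close> an interval on one side of \<open>c\<close> sees only a
  small oscillation, and one across \<open>c\<close> sees the jump at \<open>c\<close> besides. A
  Lebesgue number makes the local radius uniform. Large increments on a fine grid can then be
  charged to large jumps.\<close>

lemma cadlag_no_large_jump:
  fixes f :: "real \<Rightarrow> 'b::real_normed_vector"
  assumes f: "cadlag f" and e: "0 < e"
  obtains \<delta> where "0 < \<delta>"
    "\<And>a b. 0 \<le> a \<Longrightarrow> a < b \<Longrightarrow> b \<le> t \<Longrightarrow> b - a < \<delta> \<Longrightarrow> (\<And>s. a < s \<Longrightarrow> s \<le> b \<Longrightarrow> norm (jump f s) < e) \<Longrightarrow>
      norm (f b - f a) < e"
proof -
  define Q where "Q a b \<longleftrightarrow> ((\<forall>s. a < s \<and> s \<le> b \<longrightarrow> norm (jump f s) < e) \<longrightarrow> norm (f b - f a) < e)" for a b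
  have "\<exists>r>0. \<forall>a b. 0 \<le> a \<longrightarrow> a < b \<longrightarrow> \<bar>a - c\<bar> < r \<longrightarrow> \<bar>b - c\<bar> < r \<longrightarrow> Q a b" if c: "c \<in> {0..t}" for c
  proof -
    \<comment> \<open>\<open>h\<close> is the slack between the jump at \<open>c\<close> and
      \<open>e\<close>. When that jump is too large, intervals across \<open>c\<close> are excluded
      by the premise in \<open>Q\<close>, and \<open>h = e\<close> is enough for the one-sided
      ones.\<close>
    define h where "h = (if norm (jump f c) < e then e - norm (jump f c) else e)"
    have h: "0 < h" "h \<le> e" using e by (auto simp: h_def)
    obtain r where r: "0 < r"
      "\<And>s. 0 \<le> s \<Longrightarrow> c - r < s \<Longrightarrow> s < c \<Longrightarrow> norm (f s - left_limit f c) < h / 2"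
      "\<And>s. c \<le> s \<Longrightarrow> s < c + r \<Longrightarrow> norm (f s - f c) < h / 2"
      using cadlag_near[OF f, of c "h / 2"] c h by auto
    have "Q a b" if ab: "0 \<le> a" "a < b" "\<bar>a - c\<bar> < r" "\<bar>b - c\<bar> < r" for a b
    proof -
      have tri: "norm (x - y) < h" if "norm (x - z) < h / 2" "norm (y - z) < h / 2" for x y z :: 'b
        using norm_triangle_ineq4[of "x - z" "y - z"] that by simp
      consider "b < c" | "c \<le> a" | "a < c" "c \<le> b" by linarith
      then show ?thesis
      proof cases
        case 1
        then have "norm (f b - f a) < h" using ab by (intro tri[of _ "left_limit f c"] r(2)) auto
        then show ?thesis using h by (auto simp: Q_def)
      next
        case 2
        then have "norm (f b - f a) < h" using ab by (intro tri[of _ "f c"] r(3)) auto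
        then show ?thesis using h by (auto simp: Q_def)
      next
        case 3
        show ?thesis unfolding Q_def
        proof
          assume "\<forall>s. a < s \<and> s \<le> b \<longrightarrow> norm (jump f s) < e"
          then have j: "norm (jump f c) < e" using 3 by auto
          have "norm (f b - f c) < h / 2" "norm (f a - left_limit f c) < h / 2"
            using ab 3 r(2)[of a] r(3)[of b] by auto
          moreover have "norm (f b - f a) = norm ((f b - f c) + (jump f c - (f a - left_limit f c)))"
            by (simp add: jump_def)
          ultimately have "norm (f b - f a) < h / 2 + (norm (jump f c) + h / 2)"
            using norm_triangle_ineq[of "f b - f c" "jump f c - (f a - left_limit f c)"]
              norm_triangle_ineq4[of "jump f c" "f a - left_limit f c"] by linarith
          then show "norm (f b - f a) < e" using j by (simp add: h_def)
        qed
      qed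
    qed
    then show ?thesis using r(1) by blast
  qed
  then obtain r where r: "\<And>c. c \<in> {0..t} \<Longrightarrow> 0 < r c"
    "\<And>c a b. c \<in> {0..t} \<Longrightarrow> 0 \<le> a \<Longrightarrow> a < b \<Longrightarrow> \<bar>a - c\<bar> < r c \<Longrightarrow> \<bar>b - c\<bar> < r c \<Longrightarrow> Q a b"
    by metis
  have cover: "{0..t} \<subseteq> \<Union> ((\<lambda>c. ball c (r c)) ` {0..t})"
  proof
    fix c assume "c \<in> {0..t}"
    then show "c \<in> \<Union> ((\<lambda>c. ball c (r c)) ` {0..t})" using r(1)[of c] by (intro UN_I[of c]) auto
  qed
  \<comment> \<open>\<open>\<delta>\<close> is a Lebesgue number of the cover: the ball around the
    left end point, hence the whole interval, fits into a single local neighbourhood.\<close>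
  obtain \<delta> where \<delta>: "0 < \<delta>" "\<And>x. x \<in> {0..t} \<Longrightarrow> \<exists>G\<in>(\<lambda>c. ball c (r c)) ` {0..t}. ball x \<delta> \<subseteq> G"
    using Heine_Borel_lemma[OF compact_Icc[of 0 t] cover] by auto
  show ?thesis
  proof (rule that[OF \<delta>(1)])
    fix a b assume ab: "0 \<le> a" "a < b" "b \<le> t" "b - a < \<delta>" and j: "\<And>s. a < s \<Longrightarrow> s \<le> b \<Longrightarrow> norm (jump f s) < e"
    obtain c where c: "c \<in> {0..t}" "ball a \<delta> \<subseteq> ball c (r c)" using \<delta>(2)[of a] ab by auto
    have "a \<in> ball c (r c)" "b \<in> ball c (r c)"
      using c(2) ab \<delta>(1) by (auto simp: dist_real_def subset_iff)
    then have "Q a b" using r(2)[of c a b] c ab by (auto simp: dist_real_def abs_minus_commute)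
    with j show "norm (f b - f a) < e" by (auto simp: Q_def)
  qed
qed

section \<open>Uniform grids on \<open>(0, t]\<close> and sums over their cells\<close>

definition grid_index :: "real \<Rightarrow> nat \<Rightarrow> real \<Rightarrow> nat" where
  "grid_index t n s = nat \<lceil>real n * s / t\<rceil> - 1"

definition grid_left :: "real \<Rightarrow> nat \<Rightarrow> nat \<Rightarrow> real" where
  "grid_left t n i = t * real i / real n"

text \<open>Ceiling minus one numbers the left-open cells \<open>(t i / n, t (i + 1) / n]\<close>.
  Thus the left end point is strictly below \<open>s\<close> even if \<open>s\<close> is a grid
  point, and the increment over the cell contains the jump at \<open>s\<close>.\<close>

lemma grid_index:
  assumes "0 < s" "s \<le> t" "0 < n"
  shows "grid_left t n (grid_index t n s) < s" "s \<le> grid_left t n (Suc (grid_index t n s))"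
    "grid_index t n s < n"
proof -
  have t: "0 < t" using assms by simp
  define x where "x = real n * s / t"
  have x: "0 < x" "x \<le> real n" using assms t by (auto simp: x_def field_simps)
  have c: "1 \<le> \<lceil>x\<rceil>" "\<lceil>x\<rceil> \<le> int n" using x by (simp_all add: ceiling_le_iff)
  then have "int (grid_index t n s) = \<lceil>x\<rceil> - 1"
    unfolding grid_index_def x_def[symmetric] by linarith
  then have i: "real (grid_index t n s) = real_of_int \<lceil>x\<rceil> - 1" by linarith
  have 1: "real (grid_index t n s) < x" using i ceiling_correct[of x] by linarith
  have 2: "x \<le> real (Suc (grid_index t n s))" using i ceiling_correct[of x] by simp
  show "grid_left t n (grid_index t n s) < s" "s \<le> grid_left t n (Suc (grid_index t n s))"
    using 1 2 assms t by (auto simp: grid_left_def x_def field_simps)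
  show "grid_index t n s < n" using 1 x by linarith
qed

lemma grid_index_unique:
  assumes "0 < t" "0 < n" "grid_left t n i < s" "s \<le> grid_left t n (Suc i)"
  shows "grid_index t n s = i"
proof -
  have "\<lceil>real n * s / t\<rceil> = int (Suc i)"
    using assms by (intro ceiling_unique) (auto simp: grid_left_def field_simps)
  then show ?thesis by (simp add: grid_index_def)
qed

lemma grid_left_Suc: "0 < n \<Longrightarrow> grid_left t n (Suc i) = grid_left t n i + t / real n"
  by (simp add: grid_left_def field_simps)

lemma grid_left_nonneg [simp]: "0 \<le> t \<Longrightarrow> 0 \<le> grid_left t n i"
  by (simp add: grid_left_def)

lemma grid_left_le: "0 \<le> t \<Longrightarrow> i \<le> n \<Longrightarrow> grid_left t n i \<le> t"
  by (cases "n = 0") (auto simp: grid_left_def field_simps mult_left_mono)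

text \<open>The strict inequality at the left end yields convergence in \<open>at_left s\<close> and
  not just to \<open>s\<close>, so left limits can be read off along grids.\<close>

lemma filterlim_grid_left:
  assumes "0 < s" "s \<le> t"
  shows "filterlim (\<lambda>n. grid_left t n (grid_index t n s)) (at_left s) sequentially"
proof -
  have ev: "\<forall>\<^sub>F n in sequentially. 0 < n" by (rule eventually_gt_at_top)
  have "(\<lambda>n. grid_left t n (grid_index t n s)) \<longlonglongrightarrow> s"
  proof (rule tendsto_sandwich)
    show "(\<lambda>n. s - t / real n) \<longlonglongrightarrow> s"
      using tendsto_diff[OF tendsto_const lim_const_over_n[of t], of s] by simp
    show "\<forall>\<^sub>F n in sequentially. s - t / real n \<le> grid_left t n (grid_index t n s)"
      by (rule eventually_mono[OF ev]) (use grid_index(2)[OF assms] grid_left_Suc in \<open>force simp: algebra_simps\<close>)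
    show "\<forall>\<^sub>F n in sequentially. grid_left t n (grid_index t n s) \<le> s"
      by (rule eventually_mono[OF ev]) (use grid_index(1)[OF assms] in \<open>auto intro: less_imp_le\<close>)
  qed (rule tendsto_const)
  then show ?thesis
    unfolding filterlim_at
    by (auto intro!: eventually_mono[OF ev] dest: grid_index(1)[OF assms])
qed

text \<open>The right end point of the cell may be \<open>s\<close> itself, so the filter
  \<open>at_right s\<close> does not apply directly; that case is split off, the value there being
  \<open>f s\<close>.\<close>

lemma tendsto_grid_right:
  fixes f :: "real \<Rightarrow> 'b::metric_space"
  assumes "0 < s" "s \<le> t" and f: "(f \<longlongrightarrow> f s) (at_right s)"
  shows "(\<lambda>n. f (grid_left t n (Suc (grid_index t n s)))) \<longlonglongrightarrow> f s"
proof -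
  have ev: "\<forall>\<^sub>F n in sequentially. 0 < n" by (rule eventually_gt_at_top)
  have "(\<lambda>n. grid_left t n (grid_index t n s)) \<longlonglongrightarrow> s"
    using filterlim_grid_left[OF assms(1,2)] by (simp add: filterlim_at)
  then have lim: "(\<lambda>n. grid_left t n (grid_index t n s) + t / real n) \<longlonglongrightarrow> s"
    using tendsto_add[OF _ lim_const_over_n[of t]] by force
  have r: "(\<lambda>n. grid_left t n (Suc (grid_index t n s))) \<longlonglongrightarrow> s"
    by (rule Lim_transform_eventually[OF lim eventually_mono[OF ev]]) (simp add: grid_left_Suc)
  show ?thesis
  proof (rule tendstoI)
    fix e :: real assume e: "0 < e"
    obtain b where b: "s < b" "\<And>u. s < u \<Longrightarrow> u < b \<Longrightarrow> dist (f u) (f s) < e"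
      using tendstoD[OF f e] by (auto simp: eventually_at_right_field)
    from ev order_tendstoD(2)[OF r b(1)]
    show "\<forall>\<^sub>F n in sequentially. dist (f (grid_left t n (Suc (grid_index t n s)))) (f s) < e"
    proof eventually_elim
      case (elim n)
      then show ?case
        using grid_index(2)[OF assms(1,2), of n] b(2)[of "grid_left t n (Suc (grid_index t n s))"] e
        by (cases "grid_left t n (Suc (grid_index t n s)) = s") auto
    qed
  qed
qed

text \<open>The left end points of the cells of a later time eventually exceed the earlier time,
  which separates the two. A sum over jump times can then be reindexed as a sum over cells.\<close>

lemma eventually_inj_on_grid_index:
  assumes S: "finite S" "S \<subseteq> {0<..t}"
  shows "\<forall>\<^sub>F n in sequentially. inj_on (grid_index t n) S"
proof -
  have "\<forall>\<^sub>F n in sequentially. grid_index t n x = grid_index t n y \<longrightarrow> x = y"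
    if "x \<in> S" "y \<in> S" for x y
  proof (cases "x < y")
    case True
    have "\<forall>\<^sub>F n in sequentially. grid_left t n (grid_index t n y) > x"
      using filterlim_grid_left[of y t] that S True
      by (intro order_tendstoD(1)[of _ y]) (auto simp: filterlim_at)
    moreover have "\<forall>\<^sub>F n in sequentially. grid_left t n (grid_index t n x) < x"
      using S that by (auto intro!: eventually_mono[OF eventually_gt_at_top[of 0]] grid_index)
    ultimately show ?thesis by eventually_elim auto
  next
    case False
    show ?thesis
    proof (cases "x = y")
      case False
      with \<open>\<not> x < y\<close> have "y < x" by simp
      have "\<forall>\<^sub>F n in sequentially. grid_left t n (grid_index t n x) > y"
        using filterlim_grid_left[of x t] that S \<open>y < x\<close>
        by (intro order_tendstoD(1)[of _ x]) (auto simp: filterlim_at)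
      moreover have "\<forall>\<^sub>F n in sequentially. grid_left t n (grid_index t n y) < y"
        using S that by (auto intro!: eventually_mono[OF eventually_gt_at_top[of 0]] grid_index)
      ultimately show ?thesis by eventually_elim auto
    qed simp
  qed
  then have "\<forall>\<^sub>F n in sequentially. \<forall>x\<in>S. \<forall>y\<in>S. grid_index t n x = grid_index t n y \<longrightarrow> x = y"
    using S(1) by (simp add: eventually_ball_finite_distrib)
  then show ?thesis by (simp add: inj_on_def)
qed

abbreviation grid_increment :: "(real \<Rightarrow> 'b::real_normed_vector) \<Rightarrow> real \<Rightarrow> nat \<Rightarrow> nat \<Rightarrow> 'b" where
  "grid_increment f t n i \<equiv> f (grid_left t n (Suc i)) - f (grid_left t n i)"

lemma tendsto_grid_increment:
  assumes "cadlag f" "0 < s" "s \<le> t"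
  shows "(\<lambda>n. grid_increment f t n (grid_index t n s)) \<longlonglongrightarrow> jump f s"
  unfolding jump_def
  by (intro tendsto_diff tendsto_grid_right tendsto_right_cadlag filterlim_compose[OF tendsto_left_limit filterlim_grid_left] assms)
     (use assms in auto)

lemma tendsto_grid_sum:
  fixes \<psi> :: "real \<Rightarrow> 'c::real_normed_vector"
  assumes S: "finite S" "S \<subseteq> {0<..t}"
    and lim: "\<And>s. s \<in> S \<Longrightarrow> (\<lambda>n. u n (grid_index t n s)) \<longlonglongrightarrow> \<psi> s"
  shows "(\<lambda>n. \<Sum>i\<in>grid_index t n ` S. u n i) \<longlonglongrightarrow> (\<Sum>s\<in>S. \<psi> s)"
proof (rule Lim_transform_eventually)
  show "(\<lambda>n. \<Sum>s\<in>S. u n (grid_index t n s)) \<longlonglongrightarrow> (\<Sum>s\<in>S. \<psi> s)"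
    by (intro tendsto_sum lim)
  show "\<forall>\<^sub>F n in sequentially. (\<Sum>s\<in>S. u n (grid_index t n s)) = (\<Sum>i\<in>grid_index t n ` S. u n i)"
    using eventually_inj_on_grid_index[OF S] by eventually_elim (simp add: sum.reindex)
qed

text \<open>On a fine grid every increment of size at least \<open>e\<close> contains a jump of size at least \<open>e\<close>, so only
  finitely many terms survive in the limit.\<close>

lemma tendsto_grid_sum_large:
  fixes f :: "real \<Rightarrow> 'b::real_normed_vector" and \<psi> :: "real \<Rightarrow> 'c::real_normed_vector"
  assumes f: "cadlag f" and e: "0 < e" and t: "0 < t"
    and fin: "finite {s\<in>{0<..t}. e \<le> norm (jump f s)}"
    and u: "\<And>n i. norm (grid_increment f t n i) < e \<Longrightarrow> u n i = 0"
    and lim: "\<And>s. s \<in> {0<..t} \<Longrightarrow> e \<le> norm (jump f s) \<Longrightarrow> (\<lambda>n. u n (grid_index t n s)) \<longlonglongrightarrow> \<psi> s"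
  shows "(\<lambda>n. \<Sum>i<n. u n i) \<longlonglongrightarrow> (\<Sum>s\<in>{s\<in>{0<..t}. e \<le> norm (jump f s)}. \<psi> s)"
proof (rule Lim_transform_eventually)
  let ?S = "{s\<in>{0<..t}. e \<le> norm (jump f s)}"
  show "(\<lambda>n. \<Sum>i\<in>grid_index t n ` ?S. u n i) \<longlonglongrightarrow> (\<Sum>s\<in>?S. \<psi> s)"
    by (rule tendsto_grid_sum) (use fin lim in auto)
  obtain \<delta> where \<delta>: "0 < \<delta>"
    "\<And>a b. 0 \<le> a \<Longrightarrow> a < b \<Longrightarrow> b \<le> t \<Longrightarrow> b - a < \<delta> \<Longrightarrow> (\<And>s. a < s \<Longrightarrow> s \<le> b \<Longrightarrow> norm (jump f s) < e) \<Longrightarrow>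
      norm (f b - f a) < e"
    using cadlag_no_large_jump[OF f e, of t] by metis
  have "\<forall>\<^sub>F n in sequentially. t / real n < \<delta>"
    by (rule order_tendstoD(2)[OF lim_const_over_n \<delta>(1)])
  with eventually_gt_at_top[of 0]
  show "\<forall>\<^sub>F n in sequentially. (\<Sum>i\<in>grid_index t n ` ?S. u n i) = (\<Sum>i<n. u n i)"
  proof eventually_elim
    case (elim n)
    show ?case
    proof (rule sum.mono_neutral_left)
      show "grid_index t n ` ?S \<subseteq> {..<n}" using grid_index(3)[of _ t n] elim(1) by auto
      show "\<forall>i\<in>{..<n} - grid_index t n ` ?S. u n i = 0"
      proof
        fix i assume i: "i \<in> {..<n} - grid_index t n ` ?S"
        have "norm (grid_increment f t n i) < e"
        proof (rule \<delta>(2))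
          show "0 \<le> grid_left t n i" using t by simp
          show "grid_left t n i < grid_left t n (Suc i)" "grid_left t n (Suc i) - grid_left t n i < \<delta>"
            using elim t by (auto simp: grid_left_Suc)
          show le: "grid_left t n (Suc i) \<le> t" using i t by (intro grid_left_le) auto
          fix s assume s: "grid_left t n i < s" "s \<le> grid_left t n (Suc i)"
          have "grid_index t n s = i" by (rule grid_index_unique[OF t elim(1) s])
          moreover have "0 \<le> grid_left t n i" using t by simp
          moreover have "s \<in> {0<..t}" using s le \<open>0 \<le> grid_left t n i\<close> by auto
          ultimately show "norm (jump f s) < e" using i by (fastforce simp: image_iff not_le[symmetric])
        qed
        then show "u n i = 0" by (rule u)
      qed
    qed simp
  qed
qed

subsection \<open>Pure jump paths\<close>

text \<open>Jump times may be dense, so limits in time are taken after setting a finite set aside: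
  close to a given time the finitely many terms of \<open>S\<close> are avoided, and all others
  together contribute less than \<open>e\<close>.\<close>

lemma infsum_tail_small:
  fixes g :: "'s \<Rightarrow> real"
  assumes g: "g summable_on A" "\<And>s. s \<in> A \<Longrightarrow> 0 \<le> g s" and e: "0 < e"
  obtains S where "finite S" "S \<subseteq> A" "\<And>B. B \<subseteq> A - S \<Longrightarrow> infsum g B < e"
proof -
  obtain S where S: "finite S" "S \<subseteq> A" "dist (sum g S) (infsum g A) \<le> e / 2"
    using infsum_finite_approximation[OF g(1), of "e / 2"] e by auto
  show ?thesis
  proof (rule that[OF S(1,2)])
    fix B assume B: "B \<subseteq> A - S"
    have sB: "g summable_on B" "g summable_on (A - S)" using g(1) B by (auto intro: summable_on_subset_banach)
    have "infsum g B \<le> infsum g (A - S)"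
      by (rule infsum_mono2[OF sB]) (use B g in auto)
    also have "\<dots> = infsum g A - sum g S"
      using infsum_Un_disjoint[OF summable_on_finite[OF S(1)] sB(2)] S by (simp add: Un_absorb1)
    also have "\<dots> < e" using S(3) e unfolding dist_real_def abs_le_iff by linarith
    finally show "infsum g B < e" .
  qed
qed

lemma abs_summable_subset:
  fixes \<zeta> :: "'s \<Rightarrow> 'b::banach"
  assumes "\<zeta> abs_summable_on A" "B \<subseteq> A"
  shows "\<zeta> abs_summable_on B" "\<zeta> summable_on B" "norm (infsum \<zeta> B) \<le> infsum (\<lambda>s. norm (\<zeta> s)) B"
proof -
  show 1: "\<zeta> abs_summable_on B" using assms by (rule summable_on_subset_banach)
  then show "\<zeta> summable_on B" by (rule abs_summable_summable)
  show "norm (infsum \<zeta> B) \<le> infsum (\<lambda>s. norm (\<zeta> s)) B" using 1 by (rule norm_infsum_bound)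
qed

lemma infsum_atLeastAtMost_diff:
  fixes \<zeta> :: "real \<Rightarrow> 'b::banach"
  assumes "\<zeta> abs_summable_on {0..v}" "0 \<le> u" "u \<le> v"
  shows "infsum \<zeta> {0..v} - infsum \<zeta> {0..u} = infsum \<zeta> {u<..v}"
proof -
  have "infsum \<zeta> ({0..u} \<union> {u<..v}) = infsum \<zeta> {0..u} + infsum \<zeta> {u<..v}"
    by (rule infsum_Un_disjoint) (use assms in \<open>auto intro!: abs_summable_subset(2)[OF assms(1)]\<close>)
  moreover have "{0..u} \<union> {u<..v} = {0..v}" using assms by auto
  ultimately show ?thesis by simp
qed

lemma tendsto_infsum_at_right:
  fixes \<zeta> :: "real \<Rightarrow> 'b::banach"
  assumes \<zeta>: "\<And>t. \<zeta> abs_summable_on {0..t}" and t: "0 \<le> t"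
  shows "((\<lambda>t. infsum \<zeta> {0..t}) \<longlongrightarrow> infsum \<zeta> {0..t}) (at_right t)"
proof (rule tendstoI)
  fix e :: real assume e: "0 < e"
  obtain S where S: "finite S" "S \<subseteq> {0..t + 1}" "\<And>B. B \<subseteq> {0..t + 1} - S \<Longrightarrow> infsum (\<lambda>s. norm (\<zeta> s)) B < e"
    using infsum_tail_small[OF \<zeta>[of "t + 1"] norm_ge_zero e] by metis
  have "\<forall>\<^sub>F u in at_right t. \<forall>s\<in>S. \<not> (t < s \<and> s \<le> u)"
  proof (rule eventually_ball_finite[OF S(1)], rule)
    fix s
    show "\<forall>\<^sub>F u in at_right t. \<not> (t < s \<and> s \<le> u)"
      by (cases "t < s") (auto simp: eventually_at_right_less not_le intro!: eventually_at_rightI[of t s])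
  qed
  then show "\<forall>\<^sub>F u in at_right t. dist (infsum \<zeta> {0..u}) (infsum \<zeta> {0..t}) < e"
    using eventually_at_right_less[of t] eventually_at_right_real[of t "t + 1", simplified]
  proof eventually_elim
    case (elim u)
    have "norm (infsum \<zeta> {t<..u}) \<le> infsum (\<lambda>s. norm (\<zeta> s)) {t<..u}"
      by (rule abs_summable_subset(3)[OF \<zeta>[of u]]) (use t in auto)
    also have "\<dots> < e" by (rule S(3)) (use elim t in auto)
    finally show ?case using infsum_atLeastAtMost_diff[OF \<zeta> t, of u] elim by (simp add: dist_norm)
  qed
qed

text \<open>Both \<open>{0..u}\<close> and \<open>{0..<u}\<close> differ from \<open>{0..<t}\<close>
  by a part of \<open>{u..<t}\<close>, so one estimate serves both claims. The first gives the left
  limits of the solution, the second the left continuity of the Picard iterates.\<close>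

lemma tendsto_infsum_at_left:
  fixes \<zeta> :: "real \<Rightarrow> 'b::banach"
  assumes \<zeta>: "\<And>t. \<zeta> abs_summable_on {0..t}" and t: "0 < t"
  shows "((\<lambda>t. infsum \<zeta> {0..t}) \<longlongrightarrow> infsum \<zeta> {0..<t}) (at_left t)"
    and "((\<lambda>t. infsum \<zeta> {0..<t}) \<longlongrightarrow> infsum \<zeta> {0..<t}) (at_left t)"
proof -
  have *: "\<forall>\<^sub>F u in at_left t. infsum (\<lambda>s. norm (\<zeta> s)) {u..<t} < e" if e: "0 < e" for e
  proof -
    obtain S where S: "finite S" "S \<subseteq> {0..t}" "\<And>B. B \<subseteq> {0..t} - S \<Longrightarrow> infsum (\<lambda>s. norm (\<zeta> s)) B < e"
      using infsum_tail_small[OF \<zeta>[of t] norm_ge_zero e] by metis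
    have "\<forall>\<^sub>F u in at_left t. \<forall>s\<in>S. \<not> (u \<le> s \<and> s < t)"
    proof (rule eventually_ball_finite[OF S(1)], rule)
      fix s
      show "\<forall>\<^sub>F u in at_left t. \<not> (u \<le> s \<and> s < t)"
        by (cases "s < t") (auto simp: not_le intro!: eventually_at_leftI[of s t])
    qed
    then show ?thesis using eventually_at_left_real[OF t]
    proof eventually_elim
      case (elim u)
      show ?case by (rule S(3)) (use elim in auto)
    qed
  qed
  have lim: "((\<lambda>u. infsum \<zeta> (A u)) \<longlongrightarrow> infsum \<zeta> {0..<t}) (at_left t)"
    if A: "\<And>u. 0 < u \<Longrightarrow> u < t \<Longrightarrow> A u \<union> B u = {0..<t} \<and> A u \<inter> B u = {} \<and> B u \<subseteq> {u..<t}" for A B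
  proof (rule tendstoI)
    fix e :: real assume "0 < e"
    from *[OF this] eventually_at_left_real[OF t]
    show "\<forall>\<^sub>F u in at_left t. dist (infsum \<zeta> (A u)) (infsum \<zeta> {0..<t}) < e"
    proof eventually_elim
      case (elim u)
      then have u: "A u \<union> B u = {0..<t}" "A u \<inter> B u = {}" "B u \<subseteq> {u..<t}" "0 < u" using A[of u] by auto
      have "A u \<subseteq> {0..<t}" "B u \<subseteq> {0..<t}" using u(1) by blast+
      moreover have "{0..<t} \<subseteq> {0..t}" by auto
      ultimately have sub: "A u \<subseteq> {0..t}" "B u \<subseteq> {0..t}" "{u..<t} \<subseteq> {0..t}" using u(4) by auto
      have "infsum \<zeta> {0..<t} - infsum \<zeta> (A u) = infsum \<zeta> (B u)"
        using infsum_Un_disjoint[OF abs_summable_subset(2)[OF \<zeta> sub(1)] abs_summable_subset(2)[OF \<zeta> sub(2)] u(2)] u(1)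
        by simp
      moreover have "norm (infsum \<zeta> (B u)) \<le> infsum (\<lambda>s. norm (\<zeta> s)) {u..<t}"
        by (rule order_trans[OF abs_summable_subset(3)[OF \<zeta> sub(2)]
              infsum_mono2[OF abs_summable_subset(1)[OF \<zeta> sub(2)] abs_summable_subset(1)[OF \<zeta> sub(3)] u(3)]]) simp
      ultimately have "norm (infsum \<zeta> {0..<t} - infsum \<zeta> (A u)) < e" using elim by simp
      then show ?case by (subst dist_commute) (simp only: dist_norm)
    qed
  qed
  show "((\<lambda>t. infsum \<zeta> {0..t}) \<longlongrightarrow> infsum \<zeta> {0..<t}) (at_left t)"
    by (rule lim[of _ "\<lambda>u. {u<..<t}"]) auto
  show "((\<lambda>t. infsum \<zeta> {0..<t}) \<longlongrightarrow> infsum \<zeta> {0..<t}) (at_left t)"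
    by (rule lim[of _ "\<lambda>u. {u..<t}"]) auto
qed

text \<open>The increments are dominated by those of the running sum of norms, which is monotone, so
  the bound telescopes.\<close>

lemma finite_variation_infsum:
  fixes \<zeta> :: "real \<Rightarrow> 'b::banach"
  assumes \<zeta>: "\<And>t. \<zeta> abs_summable_on {0..t}"
  shows "finite_variation_path (\<lambda>t. infsum \<zeta> {0..t})"
  unfolding finite_variation_path_def
proof (intro allI impI exI, elim conjE)
  fix t :: real and n and \<tau> :: "nat \<Rightarrow> real"
  assume t: "0 \<le> t" and \<tau>: "mono \<tau>" "range \<tau> \<subseteq> {0..t}"
  let ?N = "\<lambda>t. infsum (\<lambda>s. norm (\<zeta> s)) {0..t}"
  have \<tau>': "0 \<le> \<tau> i" "\<tau> i \<le> t" "\<tau> i \<le> \<tau> (Suc i)" for i using \<tau> by (auto simp: mono_def subset_iff)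
  have *: "(\<lambda>s. norm (\<zeta> s)) abs_summable_on {0..t}" for t using \<zeta> by simp
  have "norm (infsum \<zeta> {0..\<tau> (Suc i)} - infsum \<zeta> {0..\<tau> i}) \<le> ?N (\<tau> (Suc i)) - ?N (\<tau> i)" for i
    unfolding infsum_atLeastAtMost_diff[OF \<zeta> \<tau>'(1,3)] infsum_atLeastAtMost_diff[OF * \<tau>'(1,3)]
    by (rule abs_summable_subset(3)[OF \<zeta>[of t]]) (use \<tau>'(1)[of i] \<tau>'(2)[of "Suc i"] in auto)
  then have "(\<Sum>i<n. norm (infsum \<zeta> {0..\<tau> (Suc i)} - infsum \<zeta> {0..\<tau> i})) \<le> (\<Sum>i<n. ?N (\<tau> (Suc i)) - ?N (\<tau> i))"
    by (rule sum_mono)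
  also have "\<dots> = ?N (\<tau> n) - ?N (\<tau> 0)" by (rule sum_lessThan_telescope)
  also have "\<dots> \<le> ?N t"
    using infsum_mono2[OF \<zeta>[of "\<tau> n"] \<zeta>[of t]] \<tau>'(2)[of n] infsum_nonneg[of "{0..\<tau> 0}" "\<lambda>s. norm (\<zeta> s)"] by auto
  finally show "(\<Sum>i<n. norm (infsum \<zeta> {0..\<tau> (Suc i)} - infsum \<zeta> {0..\<tau> i})) \<le> ?N t" .
qed

subsection \<open>Pure jump equations\<close>

lemma infsum_diff:
  fixes f g :: "'s \<Rightarrow> 'b::real_normed_vector"
  assumes "f summable_on A" "g summable_on A"
  shows "infsum (\<lambda>x. f x - g x) A = infsum f A - infsum g A"
  using infsum_add[OF assms(1) summable_on_uminus[THEN iffD2, OF assms(2)]] by (simp add: infsum_uminus)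

lemma finite_large_terms:
  fixes g :: "'s \<Rightarrow> real"
  assumes "g summable_on A" "\<And>s. s \<in> A \<Longrightarrow> 0 \<le> g s" "0 < e"
  shows "finite {s\<in>A. e \<le> g s}"
proof -
  obtain S where S: "finite S" "\<And>B. B \<subseteq> A - S \<Longrightarrow> infsum g B < e"
    using infsum_tail_small[OF assms] by metis
  have "{s\<in>A. e \<le> g s} \<subseteq> S"
  proof
    fix s assume s: "s \<in> {s\<in>A. e \<le> g s}"
    show "s \<in> S"
    proof (rule ccontr)
      assume "s \<notin> S"
      then have "infsum g {s} < e" using s by (intro S(2)) auto
      with s show False by simp
    qed
  qed
  then show ?thesis using S(1) finite_subset by blast
qed

text \<open>The rate is kept explicit because it makes the convergence of the Picard iterates
  uniform in time.\<close>

lemma geometric_increments: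
  fixes a :: "nat \<Rightarrow> 'b::banach"
  assumes a: "\<And>n. norm (a (Suc n) - a n) \<le> c / 2 ^ n"
  shows "a \<longlonglongrightarrow> lim a" "norm (lim a - a n) \<le> 2 * c / 2 ^ n"
proof -
  have c: "0 \<le> c" using order_trans[OF norm_ge_zero a[of 0]] by simp
  have bound: "norm (a (n + k) - a n) \<le> 2 * c / 2 ^ n * (1 - 1 / 2 ^ k)" for n k
  proof (induction k)
    case (Suc k)
    have "norm (a (n + Suc k) - a n) \<le> norm (a (Suc (n + k)) - a (n + k)) + norm (a (n + k) - a n)"
      using norm_triangle_ineq[of "a (Suc (n + k)) - a (n + k)" "a (n + k) - a n"] by simp
    also have "\<dots> \<le> c / 2 ^ (n + k) + 2 * c / 2 ^ n * (1 - 1 / 2 ^ k)"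
      by (intro add_mono a Suc)
    also have "\<dots> = 2 * c / 2 ^ n * (1 - 1 / 2 ^ Suc k)"
      by (simp add: power_add field_simps)
    finally show ?case .
  qed simp
  have bound': "norm (a (n + k) - a n) \<le> 2 * c / 2 ^ n" for n k
    by (rule order_trans[OF bound]) (use c in \<open>auto intro!: divide_right_mono mult_left_le\<close>)
  have "Cauchy a"
  proof (rule CauchyI)
    fix e :: real assume e: "0 < e"
    have "(\<lambda>n. 2 * c * (1 / 2) ^ n) \<longlonglongrightarrow> 2 * c * 0"
      by (intro tendsto_mult tendsto_const LIMSEQ_power_zero) simp
    then have "\<forall>\<^sub>F n in sequentially. 2 * c * (1 / 2) ^ n < e / 2"
      using e by (intro order_tendstoD(2)[of _ "2 * c * 0"]) auto
    then obtain N where N: "2 * c / 2 ^ N < e / 2" by (auto simp: eventually_sequentially power_divide)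
    have "norm (a m - a n) < e" if "N \<le> m" "N \<le> n" for m n
    proof -
      have "norm (a m - a N) \<le> 2 * c / 2 ^ N" "norm (a n - a N) \<le> 2 * c / 2 ^ N"
        using bound'[of N "m - N"] bound'[of N "n - N"] that by auto
      then show ?thesis using N norm_triangle_ineq4[of "a m - a N" "a n - a N"] by simp
    qed
    then show "\<exists>N. \<forall>m\<ge>N. \<forall>n\<ge>N. norm (a m - a n) < e" by blast
  qed
  then have "convergent a" by (rule Cauchy_convergent)
  then show lim: "a \<longlonglongrightarrow> lim a" by (simp add: convergent_LIMSEQ_iff)
  show "norm (lim a - a n) \<le> 2 * c / 2 ^ n"
  proof (rule tendsto_upperbound[OF tendsto_norm[OF tendsto_diff[OF lim tendsto_const]]])
    show "\<forall>\<^sub>F m in sequentially. norm (a m - a n) \<le> 2 * c / 2 ^ n"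
    proof (rule eventually_sequentiallyI[of n])
      fix m assume "n \<le> m"
      then show "norm (a m - a n) \<le> 2 * c / 2 ^ n" using bound'[of n "m - n"] by simp
    qed
  qed simp
qed

text \<open>The weight \<open>w\<close> grows fast enough that summing \<open>w\<close> against \<open>K \<delta>\<close> returns at most half of
  \<open>w\<close>; this turns the Picard iteration into a contraction by \<open>1/2\<close>.\<close>

definition exp_weight :: "(real \<Rightarrow> real) \<Rightarrow> real \<Rightarrow> real \<Rightarrow> real" where
  "exp_weight \<delta> K s = exp (2 * K * infsum \<delta> {0..<s})"

context
  fixes \<delta> :: "real \<Rightarrow> real" and K :: real
  assumes \<delta>: "\<And>t. \<delta> summable_on {0..t}" "\<And>t. 0 \<le> \<delta> t" and K: "0 \<le> K"
begin

lemma \<delta>_summable: "A \<subseteq> {0..t} \<Longrightarrow> \<delta> summable_on A"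
  using \<delta>(1) by (rule summable_on_subset_banach)

lemma exp_weight_ge_1: "1 \<le> exp_weight \<delta> K s"
  unfolding exp_weight_def one_le_exp_iff by (intro mult_nonneg_nonneg infsum_nonneg) (use \<delta> K in auto)

lemma exp_weight_mono: "s \<le> t \<Longrightarrow> exp_weight \<delta> K s \<le> exp_weight \<delta> K t"
  unfolding exp_weight_def exp_le_cancel_iff
  by (intro mult_left_mono infsum_mono2 \<delta>_summable[where t = t]) (use \<delta> K in auto)

text \<open>A discrete Gronwall inequality. The latest time \<open>m\<close> is removed; the earlier
  terms sum to at most the weight at \<open>m\<close>, and the factor
  \<open>1 + 2 K \<delta> m\<close> gained at \<open>m\<close> is absorbed by
  \<open>1 + x <= exp x\<close>, since the weight at \<open>b > m\<close> counts
  \<open>\<delta> m\<close>.\<close>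

lemma exp_weight_finite_sum:
  assumes "finite S" "S \<subseteq> {0..<b}"
  shows "(\<Sum>s\<in>S. 2 * (K * \<delta> s * exp_weight \<delta> K s)) \<le> exp_weight \<delta> K b"
  using assms
proof (induction S arbitrary: b rule: finite_linorder_max_induct)
  case empty
  then show ?case by (simp add: exp_weight_def)
next
  case (insert m S)
  let ?w = "exp_weight \<delta> K"
  have m: "0 \<le> m" "m < b" and "m \<notin> S" using insert by auto
  then have "(\<Sum>s\<in>insert m S. 2 * (K * \<delta> s * ?w s)) = 2 * (K * \<delta> m * ?w m) + (\<Sum>s\<in>S. 2 * (K * \<delta> s * ?w s))"
    using insert.hyps by simp
  also have "\<dots> \<le> 2 * (K * \<delta> m * ?w m) + ?w m"
    by (intro add_left_mono insert.IH) (use insert.prems insert.hyps in auto)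
  also have "\<dots> = ?w m * (1 + 2 * K * \<delta> m)" by (simp add: algebra_simps)
  also have "\<dots> \<le> ?w m * exp (2 * K * \<delta> m)"
    by (intro mult_left_mono exp_ge_add_one_self) (simp add: exp_weight_def)
  also have "\<dots> = exp (2 * K * (infsum \<delta> {0..<m} + \<delta> m))"
    by (simp add: exp_weight_def exp_add[symmetric] algebra_simps)
  also have "infsum \<delta> {0..<m} + \<delta> m = infsum \<delta> (insert m {0..<m})"
    by (subst infsum_insert) (auto intro!: \<delta>_summable[where t = m])
  also have "insert m {0..<m} = {0..m}" using m by auto
  also have "exp (2 * K * infsum \<delta> {0..m}) \<le> ?w b"
    unfolding exp_weight_def exp_le_cancel_iff
    by (intro mult_left_mono infsum_mono2 \<delta>_summable[where t = b]) (use \<delta> K m in auto)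
  finally show ?case .
qed

text \<open>The bound on all finite sums yields summability and the estimate together. The factor
  \<open>1/2\<close> is the contraction constant of the Picard iteration and also closes its growth
  estimate.\<close>

lemma exp_weight_bound:
  fixes g :: "real \<Rightarrow> 'b::banach"
  assumes c: "0 \<le> c" and g: "\<And>s. 0 \<le> s \<Longrightarrow> s < b \<Longrightarrow> norm (g s) \<le> c * (K * \<delta> s * exp_weight \<delta> K s)"
  shows "g abs_summable_on {0..<b}" "norm (infsum g {0..<b}) \<le> c * exp_weight \<delta> K b / 2"
proof -
  let ?h = "\<lambda>s. K * \<delta> s * exp_weight \<delta> K s"
  have nn: "0 \<le> ?h s" for s using K \<delta> by (simp add: exp_weight_def)
  have fin: "sum ?h S \<le> exp_weight \<delta> K b / 2" if "finite S" "S \<subseteq> {0..<b}" for S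
    using exp_weight_finite_sum[OF that] by (simp add: sum_distrib_left[symmetric])
  have h: "?h summable_on {0..<b}"
    by (rule nonneg_bdd_above_summable_on) (use fin nn in \<open>auto intro!: bdd_aboveI[of _ "exp_weight \<delta> K b / 2"]\<close>)
  then have ch: "(\<lambda>s. c * ?h s) summable_on {0..<b}" by (rule summable_on_cmult_right)
  show 1: "g abs_summable_on {0..<b}"
    by (rule summable_on_comparison_test[OF ch]) (use g in auto)
  have "norm (infsum g {0..<b}) \<le> infsum (\<lambda>s. norm (g s)) {0..<b}" by (rule norm_infsum_bound[OF 1])
  also have "\<dots> \<le> infsum (\<lambda>s. c * ?h s) {0..<b}" by (rule infsum_mono[OF 1 ch]) (use g in auto)
  also have "\<dots> = c * infsum ?h {0..<b}" using h by (simp add: infsum_cmult_right)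
  also have "\<dots> \<le> c * (exp_weight \<delta> K b / 2)"
    by (intro mult_left_mono infsum_le_finite_sums h fin c)
  finally show "norm (infsum g {0..<b}) \<le> c * exp_weight \<delta> K b / 2" by simp
qed

end

definition square_summable_jumps :: "(real \<Rightarrow> 'v::real_normed_vector) \<Rightarrow> bool" where
  "square_summable_jumps l \<longleftrightarrow> (\<forall>t. (\<lambda>s. (norm (jump l s))\<^sup>2) summable_on {0..t})"

text \<open>The equation after removal of the drift, with \<open>P\<close> in the role of the psd
  cone. The growth constant is uniform over \<open>P\<close>, whereas the Lipschitz constant may
  depend on the radius \<open>R\<close>. The factor \<open>(norm x)^2\<close> matches the square
  summable jumps, and joint continuity serves the measurability arguments.\<close>

locale jump_equation =
  fixes P :: "'m::euclidean_space set" and h :: "real \<Rightarrow> 'm \<Rightarrow> 'v::euclidean_space \<Rightarrow> 'm"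
  assumes closed_P: "closed P" and P_0: "0 \<in> P" and P_add: "\<And>x y. x \<in> P \<Longrightarrow> y \<in> P \<Longrightarrow> x + y \<in> P"
    and h_P: "\<And>s z x. 0 \<le> s \<Longrightarrow> z \<in> P \<Longrightarrow> h s z x \<in> P"
    and h_growth: "\<And>T. \<exists>K\<ge>0. \<forall>s\<in>{0..T}. \<forall>z\<in>P. \<forall>x. norm (h s z x) \<le> K * (1 + norm z) * (norm x)\<^sup>2"
    and h_lipschitz: "\<And>T R. \<exists>K\<ge>0. \<forall>s\<in>{0..T}. \<forall>z\<in>P. \<forall>z'\<in>P. norm z \<le> R \<longrightarrow> norm z' \<le> R \<longrightarrow>
      (\<forall>x. norm (h s z x - h s z' x) \<le> K * norm (z - z') * (norm x)\<^sup>2)"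
    and h_continuous: "continuous_on ({0..} \<times> P \<times> UNIV) (\<lambda>(s, z, x). h s z x)"
begin

text \<open>A family that is not summable has sum \<open>0\<close> by convention, and
  \<open>0\<close> lies in \<open>P\<close>. Hence the iterates are known to lie in \<open>P\<close>
  before any convergence is established.\<close>

lemma infsum_in_P:
  assumes "\<And>s. s \<in> A \<Longrightarrow> f s \<in> P"
  shows "infsum f A \<in> P"
proof (cases "f summable_on A")
  case True
  have "sum f S \<in> P" if "finite S" "S \<subseteq> A" for S
    using that by (induction S) (auto intro!: P_0 P_add assms)
  then show ?thesis
    by (intro Lim_in_closed_set[OF closed_P _ _ infsum_tendsto[OF True]])
       (auto intro!: eventually_finite_subsets_at_top_weakI)
qed (simp add: infsum_not_exists P_0)

lemma h_0: "0 \<le> s \<Longrightarrow> z \<in> P \<Longrightarrow> h s z 0 = 0"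
proof -
  assume *: "0 \<le> s" "z \<in> P"
  obtain K where "\<And>z x. z \<in> P \<Longrightarrow> norm (h s z x) \<le> K * (1 + norm z) * (norm x)\<^sup>2"
    using h_growth[of s] * by (metis atLeastAtMost_iff order_refl)
  from this[of z 0] * show ?thesis by simp
qed

text \<open>The iteration runs on the left limits of the solution, so that no left limit has to be taken in it.\<close>

fun picard :: "(real \<Rightarrow> 'v) \<Rightarrow> 'm \<Rightarrow> nat \<Rightarrow> real \<Rightarrow> 'm" where
  "picard l y 0 s = y"
| "picard l y (Suc n) s = y + infsum (\<lambda>r. h r (picard l y n r) (jump l r)) {0..<s}"

definition left_solution :: "(real \<Rightarrow> 'v) \<Rightarrow> 'm \<Rightarrow> real \<Rightarrow> 'm" where
  "left_solution l y s = lim (\<lambda>n. picard l y n s)"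

definition solution :: "(real \<Rightarrow> 'v) \<Rightarrow> 'm \<Rightarrow> real \<Rightarrow> 'm" where
  "solution l y t = y + infsum (\<lambda>r. h r (left_solution l y r) (jump l r)) {0..t}"

lemma picard_in_P: "y \<in> P \<Longrightarrow> picard l y n s \<in> P"
proof (induction n arbitrary: s)
  case (Suc n)
  then show ?case by (auto intro!: P_add infsum_in_P h_P)
qed simp

context
  fixes l :: "real \<Rightarrow> 'v"
  assumes l: "square_summable_jumps l"
begin

abbreviation "dl \<equiv> \<lambda>s. (norm (jump l s))\<^sup>2"

lemma dl: "dl summable_on {0..t}" "0 \<le> dl t"
  using l by (auto simp: square_summable_jumps_def)

lemma h_abs_summable:
  assumes v: "\<And>s. s \<in> {0..t} \<Longrightarrow> v s \<in> P" "\<And>s. s \<in> {0..t} \<Longrightarrow> norm (v s) \<le> R"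
  shows "(\<lambda>s. h s (v s) (jump l s)) abs_summable_on {0..t}"
proof -
  obtain K where K: "0 \<le> K" "\<And>s z x. s \<in> {0..t} \<Longrightarrow> z \<in> P \<Longrightarrow> norm (h s z x) \<le> K * (1 + norm z) * (norm x)\<^sup>2"
    using h_growth[of t] by blast
  show ?thesis
  proof (rule summable_on_comparison_test)
    show "(\<lambda>s. K * (1 + R) * dl s) summable_on {0..t}" by (intro summable_on_cmult_right dl)
    show "norm (h s (v s) (jump l s)) \<le> K * (1 + R) * dl s" if "s \<in> {0..t}" for s
      by (rule order_trans[OF K(2)[OF that v(1)[OF that]]])
         (intro mult_right_mono mult_left_mono add_left_mono v that K, simp)
  qed simp
qed

text \<open>The induction closes because the sum returns half of the weighted bound and the initial
  value takes the other half: \<open>1 + norm y\<close> is at most half of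
  \<open>2 (1 + norm y) w\<close> for a weight \<open>w >= 1\<close>. The bound does not depend on
  \<open>n\<close>.\<close>

lemma picard_growth:
  assumes y: "y \<in> P" and K: "0 \<le> K" "\<And>s z x. s \<in> {0..T} \<Longrightarrow> z \<in> P \<Longrightarrow> norm (h s z x) \<le> K * (1 + norm z) * (norm x)\<^sup>2"
    and s: "s \<in> {0..T}"
  shows "1 + norm (picard l y n s) \<le> 2 * (1 + norm y) * exp_weight dl K s"
  using s
proof (induction n arbitrary: s)
  case 0
  have "1 + norm y \<le> 2 * (1 + norm y) * 1" by simp
  also have "\<dots> \<le> 2 * (1 + norm y) * exp_weight dl K s"
    by (intro mult_left_mono exp_weight_ge_1 dl K) simp
  finally show ?case by simp
next
  case (Suc n)
  let ?D = "2 * (1 + norm y)"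
  have "norm (infsum (\<lambda>r. h r (picard l y n r) (jump l r)) {0..<s}) \<le> ?D * exp_weight dl K s / 2"
  proof (rule exp_weight_bound(2)[OF dl K(1)])
    fix r assume r: "0 \<le> r" "r < s"
    then have "norm (h r (picard l y n r) (jump l r)) \<le> K * (1 + norm (picard l y n r)) * dl r"
      using Suc.prems by (intro K picard_in_P y) auto
    also have "\<dots> \<le> K * (?D * exp_weight dl K r) * dl r"
      by (intro mult_right_mono mult_left_mono Suc.IH K) (use r Suc.prems in auto)
    finally show "norm (h r (picard l y n r) (jump l r)) \<le> ?D * (K * dl r * exp_weight dl K r)"
      by (simp add: mult_ac)
  qed simp
  then have "1 + norm (picard l y (Suc n) s) \<le> (1 + norm y) * 1 + ?D * exp_weight dl K s / 2"
    using norm_triangle_ineq[of y "infsum (\<lambda>r. h r (picard l y n r) (jump l r)) {0..<s}"] by simp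
  also have "\<dots> \<le> (1 + norm y) * exp_weight dl K s + ?D * exp_weight dl K s / 2"
    by (intro add_right_mono mult_left_mono exp_weight_ge_1 dl K) simp
  finally show ?case by linarith
qed

lemma picard_bounded:
  assumes "y \<in> P"
  obtains R where "0 \<le> R" "\<And>n s. s \<in> {0..T} \<Longrightarrow> norm (picard l y n s) \<le> R"
proof -
  obtain K where K: "0 \<le> K" "\<And>s z x. s \<in> {0..T} \<Longrightarrow> z \<in> P \<Longrightarrow> norm (h s z x) \<le> K * (1 + norm z) * (norm x)\<^sup>2"
    using h_growth[of T] by blast
  show ?thesis
  proof (rule that[of "2 * (1 + norm y) * exp_weight dl K T"])
    show "0 \<le> 2 * (1 + norm y) * exp_weight dl K T" by (simp add: exp_weight_def)
    fix n s assume s: "s \<in> {0..T}"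
    have "norm (picard l y n s) \<le> 2 * (1 + norm y) * exp_weight dl K s"
      using picard_growth[OF assms K s, of n] by simp
    also have "\<dots> \<le> 2 * (1 + norm y) * exp_weight dl K T"
      by (intro mult_left_mono exp_weight_mono dl K) (use s in auto)
    finally show "norm (picard l y n s) \<le> 2 * (1 + norm y) * exp_weight dl K T" .
  qed
qed

lemma picard_abs_summable:
  assumes y: "y \<in> P"
  shows "(\<lambda>r. h r (picard l y n r) (jump l r)) abs_summable_on {0..t}"
proof -
  obtain R where "\<And>n s. s \<in> {0..t} \<Longrightarrow> norm (picard l y n s) \<le> R" using picard_bounded[OF y] by metis
  then show ?thesis by (intro h_abs_summable[of _ _ R] picard_in_P y) auto
qed

text \<open>All iterates lie in one ball of radius \<open>R\<close>, so a single Lipschitz constant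
  applies. The first increment is at most \<open>2 R\<close>, and each step through
  \<open>exp_weight_bound\<close> halves the bound.\<close>

lemma picard_increment:
  assumes y: "y \<in> P" and R: "\<And>n s. s \<in> {0..T} \<Longrightarrow> norm (picard l y n s) \<le> R" "0 \<le> R"
    and K: "0 \<le> K" "\<And>s z z' x. s \<in> {0..T} \<Longrightarrow> z \<in> P \<Longrightarrow> z' \<in> P \<Longrightarrow> norm z \<le> R \<Longrightarrow> norm z' \<le> R \<Longrightarrow>
      norm (h s z x - h s z' x) \<le> K * norm (z - z') * (norm x)\<^sup>2"
    and s: "s \<in> {0..T}"
  shows "norm (picard l y (Suc n) s - picard l y n s) \<le> 2 * R * exp_weight dl K s / 2 ^ n"
  using s
proof (induction n arbitrary: s)
  case 0
  have "norm (picard l y (Suc 0) s - picard l y 0 s) \<le> 2 * R * 1"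
    using norm_triangle_ineq4[of "picard l y (Suc 0) s" "picard l y 0 s"] R(1)[OF 0, of "Suc 0"] R(1)[OF 0, of 0]
    by linarith
  also have "\<dots> \<le> 2 * R * exp_weight dl K s"
    by (intro mult_left_mono exp_weight_ge_1 dl K) (use R in auto)
  finally show ?case by simp
next
  case (Suc n)
  let ?f = "\<lambda>n r. h r (picard l y n r) (jump l r)"
  have sum: "?f n summable_on {0..<s}" for n
    by (rule abs_summable_subset(2)[OF picard_abs_summable[OF y, of n s]]) auto
  have "picard l y (Suc (Suc n)) s - picard l y (Suc n) s = infsum (?f (Suc n)) {0..<s} - infsum (?f n) {0..<s}"
    by simp
  also have "\<dots> = infsum (\<lambda>r. ?f (Suc n) r - ?f n r) {0..<s}"
    by (rule infsum_diff[OF sum sum, symmetric])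
  also have "norm \<dots> \<le> (2 * R / 2 ^ n) * exp_weight dl K s / 2"
  proof (rule exp_weight_bound(2)[OF dl K(1)])
    show "0 \<le> 2 * R / 2 ^ n" using R by simp
    fix r assume r: "0 \<le> r" "r < s"
    then have r': "r \<in> {0..T}" using Suc.prems by auto
    have "norm (?f (Suc n) r - ?f n r) \<le> K * norm (picard l y (Suc n) r - picard l y n r) * dl r"
      by (intro K(2) picard_in_P y r' R)
    also have "\<dots> \<le> K * (2 * R * exp_weight dl K r / 2 ^ n) * dl r"
      by (intro mult_right_mono mult_left_mono Suc.IH K r') simp
    finally show "norm (?f (Suc n) r - ?f n r) \<le> (2 * R / 2 ^ n) * (K * dl r * exp_weight dl K r)"
      by (simp add: mult_ac)
  qed
  finally show ?case by (simp add: field_simps)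
qed

lemma picard_uniform:
  assumes y: "y \<in> P"
  obtains c where "\<And>n s. s \<in> {0..T} \<Longrightarrow> norm (left_solution l y s - picard l y n s) \<le> c / 2 ^ n"
    "\<And>s. s \<in> {0..T} \<Longrightarrow> (\<lambda>n. picard l y n s) \<longlonglongrightarrow> left_solution l y s"
proof -
  obtain R where R: "0 \<le> R" "\<And>n s. s \<in> {0..T} \<Longrightarrow> norm (picard l y n s) \<le> R" using picard_bounded[OF y] by metis
  obtain K where K: "0 \<le> K" "\<And>s z z' x. s \<in> {0..T} \<Longrightarrow> z \<in> P \<Longrightarrow> z' \<in> P \<Longrightarrow> norm z \<le> R \<Longrightarrow> norm z' \<le> R \<Longrightarrow>
      norm (h s z x - h s z' x) \<le> K * norm (z - z') * (norm x)\<^sup>2"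
    using h_lipschitz[of T R] by blast
  have inc: "norm (picard l y (Suc n) s - picard l y n s) \<le> 2 * R * exp_weight dl K T / 2 ^ n"
    if s: "s \<in> {0..T}" for n s
    by (rule order_trans[OF picard_increment[OF y R(2,1) K s]])
       (use R s in \<open>auto intro!: divide_right_mono mult_left_mono exp_weight_mono dl K\<close>)
  show ?thesis
    by (rule that[of "2 * (2 * R * exp_weight dl K T)"]; unfold left_solution_def)
       (rule geometric_increments[OF inc]; assumption)+
qed

lemma left_solution_in_P:
  assumes y: "y \<in> P" and s: "0 \<le> s"
  shows "left_solution l y s \<in> P"
proof -
  have "(\<lambda>n. picard l y n s) \<longlonglongrightarrow> left_solution l y s"
    using picard_uniform[OF y, of s] s by (metis atLeastAtMost_iff order_refl)
  then show ?thesis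
    by (rule closed_sequentially[OF closed_P, rotated]) (rule picard_in_P[OF y])
qed

lemma left_solution_bounded:
  assumes y: "y \<in> P"
  obtains R where "0 \<le> R" "\<And>s. s \<in> {0..T} \<Longrightarrow> norm (left_solution l y s) \<le> R"
proof -
  obtain R where R: "0 \<le> R" "\<And>n s. s \<in> {0..T} \<Longrightarrow> norm (picard l y n s) \<le> R" using picard_bounded[OF y] by metis
  show ?thesis
  proof (rule that[OF R(1)])
    fix s assume s: "s \<in> {0..T}"
    then have "(\<lambda>n. picard l y n s) \<longlonglongrightarrow> left_solution l y s"
      using picard_uniform[OF y, of T] by metis
    from tendsto_upperbound[OF tendsto_norm[OF this], of R] R(2)[OF s]
    show "norm (left_solution l y s) \<le> R" by simp
  qed
qed

lemma left_solution_abs_summable: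
  assumes y: "y \<in> P"
  shows "(\<lambda>r. h r (left_solution l y r) (jump l r)) abs_summable_on {0..t}"
proof -
  obtain R where "\<And>s. s \<in> {0..t} \<Longrightarrow> norm (left_solution l y s) \<le> R" using left_solution_bounded[OF y] by metis
  then show ?thesis by (intro h_abs_summable[of _ _ R] left_solution_in_P y) auto
qed

text \<open>The limit passes through the infinite sum since the Lipschitz bound turns the uniform
  rate \<open>c / 2^n\<close> into a multiple of the summable squared jumps.\<close>

lemma left_solution_eq:
  assumes y: "y \<in> P" and s: "0 \<le> s"
  shows "left_solution l y s = y + infsum (\<lambda>r. h r (left_solution l y r) (jump l r)) {0..<s}"
proof -
  let ?v = "left_solution l y"
  obtain c where c: "\<And>n r. r \<in> {0..s} \<Longrightarrow> norm (?v r - picard l y n r) \<le> c / 2 ^ n"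
    "\<And>r. r \<in> {0..s} \<Longrightarrow> (\<lambda>n. picard l y n r) \<longlonglongrightarrow> ?v r" using picard_uniform[OF y] by metis
  obtain R1 where R1: "\<And>n r. r \<in> {0..s} \<Longrightarrow> norm (picard l y n r) \<le> R1" using picard_bounded[OF y] by metis
  obtain R2 where R2: "\<And>r. r \<in> {0..s} \<Longrightarrow> norm (?v r) \<le> R2" using left_solution_bounded[OF y] by metis
  obtain K where K: "0 \<le> K" "\<And>r z z' x. r \<in> {0..s} \<Longrightarrow> z \<in> P \<Longrightarrow> z' \<in> P \<Longrightarrow> norm z \<le> max R1 R2 \<Longrightarrow> norm z' \<le> max R1 R2 \<Longrightarrow>
      norm (h r z x - h r z' x) \<le> K * norm (z - z') * (norm x)\<^sup>2"
    using h_lipschitz[of s "max R1 R2"] by blast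
  let ?f = "\<lambda>n r. h r (picard l y n r) (jump l r)" and ?g = "\<lambda>r. h r (?v r) (jump l r)"
  have g: "?g summable_on {0..<s}"
    by (rule abs_summable_subset(2)[OF left_solution_abs_summable[OF y, of s]]) auto
  have f: "?f n summable_on {0..<s}" for n
    by (rule abs_summable_subset(2)[OF picard_abs_summable[OF y, of n s]]) auto
  have d: "dl summable_on {0..<s}" by (rule summable_on_subset_banach[OF dl(1)[of s]]) auto
  have "norm (infsum (?f n) {0..<s} - infsum ?g {0..<s}) \<le> K * c * infsum dl {0..<s} * (1 / 2) ^ n" for n
  proof -
    have le: "norm (?f n r - ?g r) \<le> K * c * (1 / 2) ^ n * dl r" if "r \<in> {0..<s}" for r
    proof -
      have r: "r \<in> {0..s}" "0 \<le> r" using that by auto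
      have "norm (?f n r - ?g r) \<le> K * norm (picard l y n r - ?v r) * dl r"
        using R1[OF r(1), of n] R2[OF r(1)] by (intro K(2) picard_in_P left_solution_in_P y r) auto
      also have "\<dots> \<le> K * (c / 2 ^ n) * dl r"
        using c(1)[OF r(1), of n] by (intro mult_right_mono mult_left_mono K) (auto simp: norm_minus_commute)
      finally show ?thesis by (simp add: power_divide)
    qed
    have 1: "(\<lambda>r. K * c * (1 / 2) ^ n * dl r) summable_on {0..<s}" by (intro summable_on_cmult_right d)
    have 2: "(\<lambda>r. ?f n r - ?g r) abs_summable_on {0..<s}"
      by (rule summable_on_comparison_test[OF 1 le]) auto
    have "norm (infsum (\<lambda>r. ?f n r - ?g r) {0..<s}) \<le> infsum (\<lambda>r. norm (?f n r - ?g r)) {0..<s}"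
      by (rule norm_infsum_bound[OF 2])
    also have "\<dots> \<le> infsum (\<lambda>r. K * c * (1 / 2) ^ n * dl r) {0..<s}" by (rule infsum_mono[OF 2 1 le])
    also have "\<dots> = K * c * (1 / 2) ^ n * infsum dl {0..<s}" by (rule infsum_cmult_right[OF d])
    finally show ?thesis by (simp add: infsum_diff[OF f g] mult_ac)
  qed
  note bound = this
  have "(\<lambda>n. K * c * infsum dl {0..<s} * (1 / 2) ^ n) \<longlonglongrightarrow> 0"
    by (rule tendsto_mult_right_zero, rule LIMSEQ_power_zero) simp
  then have "(\<lambda>n. infsum (?f n) {0..<s} - infsum ?g {0..<s}) \<longlonglongrightarrow> 0"
    by (rule Lim_null_comparison[OF always_eventually, rotated]) (rule allI, rule bound)
  then have "(\<lambda>n. y + infsum (?f n) {0..<s}) \<longlonglongrightarrow> y + infsum ?g {0..<s}"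
    by (rule tendsto_add[OF tendsto_const LIM_zero_cancel])
  \<comment> \<open>These are the Picard iterates with index shifted by one.\<close>
  moreover have "(\<lambda>n. y + infsum (?f n) {0..<s}) \<longlonglongrightarrow> ?v s"
    using LIMSEQ_Suc[OF c(2)[of s]] s by (simp only: picard.simps atLeastAtMost_iff order_refl simp_thms)
  ultimately show ?thesis by (rule LIMSEQ_unique[symmetric])
qed

text \<open>\<open>solution\<close> includes the jump at the current time; the sum over
  \<open>{0..<t}\<close> is its left limit, which identifies \<open>left_solution\<close>.\<close>

lemma solution:
  assumes y: "y \<in> P"
  shows "cadlag (solution l y)" "0 \<le> t \<Longrightarrow> left_limit (solution l y) t = left_solution l y t"
    "0 \<le> t \<Longrightarrow> solution l y t - y \<in> P" "0 \<le> t \<Longrightarrow> solution l y t \<in> P" "finite_variation_path (solution l y)"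
proof -
  let ?g = "\<lambda>r. h r (left_solution l y r) (jump l r)"
  note g = left_solution_abs_summable[OF y]
  have r: "((solution l y) \<longlongrightarrow> solution l y t) (at_right t)" if "0 \<le> t" for t
    unfolding solution_def by (intro tendsto_add tendsto_const tendsto_infsum_at_right[OF g] that)
  have lft: "((solution l y) \<longlongrightarrow> left_solution l y t) (at_left t)" if "0 < t" for t
  proof -
    have "((solution l y) \<longlongrightarrow> y + infsum ?g {0..<t}) (at_left t)"
      unfolding solution_def by (intro tendsto_add tendsto_const tendsto_infsum_at_left[OF g] that)
    then show ?thesis using left_solution_eq[OF y, of t] that by simp
  qed
  show "cadlag (solution l y)" using r lft by (auto simp: cadlag_def continuous_within)
  \<comment> \<open>There is no jump at time \<open>0\<close> by convention, so \<open>h_0\<close>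
    makes the sum over \<open>{0..0}\<close> vanish.\<close>
  have "solution l y 0 = y" "left_solution l y 0 = y"
    using h_0[OF order_refl left_solution_in_P[OF y order_refl]] left_solution_eq[OF y, of 0] by (auto simp: solution_def)
  then show "0 \<le> t \<Longrightarrow> left_limit (solution l y) t = left_solution l y t"
    using left_limit_eqI[OF lft, of t] by (cases "t = 0") auto
  show d: "0 \<le> t \<Longrightarrow> solution l y t - y \<in> P"
    by (auto simp: solution_def intro!: infsum_in_P h_P left_solution_in_P y)
  show "0 \<le> t \<Longrightarrow> solution l y t \<in> P" using P_add[OF d y] by simp
  show "finite_variation_path (solution l y)"
    using finite_variation_infsum[OF g] by (simp add: finite_variation_path_def solution_def)
qed

end

end

subsection \<open>Adaptedness of the solution\<close>

context filtration
begin

lemma measurable_F_mono: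
  assumes "f \<in> borel_measurable (F s)" "s \<le> t"
  shows "f \<in> borel_measurable (F t)"
  using assms sets_F_mono[OF assms(2)] by (auto simp: measurable_def space_F)

end

text \<open>Riemann sums of the increments also pick up the continuous part of the path; cutting off the small
  increments leaves only the jumps.\<close>

definition cutoff :: "nat \<Rightarrow> real \<Rightarrow> real" where
  "cutoff k r = min 1 (max 0 (real k * r - 1))"

lemma cutoff_bounds: "0 \<le> cutoff k r" "cutoff k r \<le> 1"
  by (auto simp: cutoff_def)

lemma cutoff_eq_0: "0 < k \<Longrightarrow> r < 1 / real k \<Longrightarrow> cutoff k r = 0"
  by (auto simp: cutoff_def field_simps)

lemma cutoff_eq_1: "0 < k \<Longrightarrow> 2 / real k \<le> r \<Longrightarrow> cutoff k r = 1"
  by (auto simp: cutoff_def field_simps)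

lemma tendsto_cutoff: "(f \<longlongrightarrow> l) G \<Longrightarrow> ((\<lambda>x. cutoff k (f x)) \<longlongrightarrow> cutoff k l) G"
  unfolding cutoff_def by (intro tendsto_intros)

lemma measurable_cutoff [measurable]: "cutoff k \<in> borel_measurable borel"
  unfolding cutoff_def by measurable

text \<open>Dominated convergence for sums: on the finite set that carries most of the mass the
  cutoff eventually equals \<open>1\<close>, and elsewhere the error is at most
  \<open>norm (g s)\<close>. It lets the threshold on the jump size tend to zero.\<close>

lemma tendsto_infsum_cutoff:
  fixes g :: "'s \<Rightarrow> 'b::banach" and \<rho> :: "'s \<Rightarrow> real"
  assumes g: "g abs_summable_on A" and g0: "\<And>s. s \<in> A \<Longrightarrow> \<rho> s = 0 \<Longrightarrow> g s = 0"
    and \<rho>: "\<And>s. s \<in> A \<Longrightarrow> 0 \<le> \<rho> s"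
  shows "(\<lambda>k. infsum (\<lambda>s. cutoff k (\<rho> s) *\<^sub>R g s) A) \<longlonglongrightarrow> infsum g A"
proof (rule tendstoI)
  fix e :: real assume e: "0 < e"
  obtain S where S: "finite S" "S \<subseteq> A" "\<And>B. B \<subseteq> A - S \<Longrightarrow> infsum (\<lambda>s. norm (g s)) B < e"
    using infsum_tail_small[OF g norm_ge_zero e] by metis
  have cg: "(\<lambda>s. cutoff k (\<rho> s) *\<^sub>R g s) abs_summable_on A" for k
    by (rule summable_on_comparison_test[OF g]) (auto simp: abs_of_nonneg cutoff_bounds intro!: mult_left_le_one_le)
  have "\<forall>\<^sub>F k in sequentially. \<forall>s\<in>S. cutoff k (\<rho> s) *\<^sub>R g s = g s"
  proof (rule eventually_ball_finite[OF S(1)], rule)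
    fix s assume s: "s \<in> S"
    show "\<forall>\<^sub>F k in sequentially. cutoff k (\<rho> s) *\<^sub>R g s = g s"
    proof (cases "\<rho> s = 0")
      case False
      with \<rho> s S have "0 < \<rho> s" by force
      then have "\<forall>\<^sub>F k in sequentially. 2 / real k < \<rho> s"
        by (rule order_tendstoD(2)[OF lim_const_over_n])
      with eventually_gt_at_top[of 0] show ?thesis
        by eventually_elim (simp add: cutoff_eq_1)
    qed (use g0 s S in auto)
  qed
  then show "\<forall>\<^sub>F k in sequentially. dist (infsum (\<lambda>s. cutoff k (\<rho> s) *\<^sub>R g s) A) (infsum g A) < e"
  proof eventually_elim
    case (elim k)
    have "infsum (\<lambda>s. cutoff k (\<rho> s) *\<^sub>R g s) A - infsum g A = infsum (\<lambda>s. cutoff k (\<rho> s) *\<^sub>R g s - g s) A"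
      by (rule infsum_diff[OF abs_summable_summable[OF cg] abs_summable_summable[OF g], symmetric])
    also have "\<dots> = infsum (\<lambda>s. cutoff k (\<rho> s) *\<^sub>R g s - g s) (A - S)"
      by (rule infsum_cong_neutral) (use elim in auto)
    also have "norm \<dots> \<le> infsum (\<lambda>s. norm (g s)) (A - S)"
    proof (rule norm_infsum_le)
      have 1: "(\<lambda>s. cutoff k (\<rho> s) *\<^sub>R g s) summable_on (A - S)" "g summable_on (A - S)"
        using abs_summable_subset(2)[OF cg] abs_summable_subset(2)[OF g] by auto
      show "((\<lambda>s. cutoff k (\<rho> s) *\<^sub>R g s - g s) has_sum infsum (\<lambda>s. cutoff k (\<rho> s) *\<^sub>R g s - g s) (A - S)) (A - S)"
        using summable_on_add[OF 1(1) summable_on_uminus[THEN iffD2, OF 1(2)]] by simp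
      show "((\<lambda>s. norm (g s)) has_sum infsum (\<lambda>s. norm (g s)) (A - S)) (A - S)"
        using abs_summable_subset(1)[OF g, of "A - S"] by simp
      fix s
      have "cutoff k (\<rho> s) *\<^sub>R g s - g s = - ((1 - cutoff k (\<rho> s)) *\<^sub>R g s)" by (simp add: algebra_simps)
      then have "norm (cutoff k (\<rho> s) *\<^sub>R g s - g s) = \<bar>1 - cutoff k (\<rho> s)\<bar> * norm (g s)" by simp
      also have "\<dots> \<le> norm (g s)" using cutoff_bounds[of k "\<rho> s"] by (intro mult_left_le_one_le) auto
      finally show "norm (cutoff k (\<rho> s) *\<^sub>R g s - g s) \<le> norm (g s)" .
    qed
    also have "\<dots> < e" by (rule S(3)) simp
    finally show ?case by (simp add: dist_norm)
  qed
qed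

context jump_equation
begin

text \<open>\<open>h s\<close> is continuous only on \<open>P\<close>; multiplication by the
  indicator of the closed set \<open>P \<times> UNIV\<close> extends it to a Borel function.\<close>

lemma measurable_h:
  assumes s: "0 \<le> s" and v: "v \<in> borel_measurable N" "\<And>\<omega>. \<omega> \<in> space N \<Longrightarrow> v \<omega> \<in> P"
    and X: "X \<in> borel_measurable N"
  shows "(\<lambda>\<omega>. h s (v \<omega>) (X \<omega>)) \<in> borel_measurable N"
proof -
  let ?A = "P \<times> (UNIV :: 'v set)"
  have "closed ?A" by (intro closed_Times closed_P closed_UNIV)
  then have A: "?A \<in> sets borel" by simp
  have "continuous_on ?A ((\<lambda>(s, z, x). h s z x) \<circ> (\<lambda>p. (s, fst p, snd p)))"
    by (rule continuous_on_compose[OF _ continuous_on_subset[OF h_continuous]])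
       (use s in \<open>auto intro!: continuous_intros\<close>)
  then have "(\<lambda>p. indicator ?A p *\<^sub>R h s (fst p) (snd p)) \<in> borel_measurable borel"
    by (intro borel_measurable_continuous_on_indicator A) (simp add: o_def case_prod_beta)
  from measurable_compose[OF borel_measurable_Pair[OF v(1) X] this] have "(\<lambda>\<omega>. indicator ?A (v \<omega>, X \<omega>) *\<^sub>R h s (v \<omega>) (X \<omega>)) \<in> borel_measurable N"
    by simp
  then show ?thesis
    by (rule measurable_cong[THEN iffD1, rotated]) (use v(2) in \<open>auto simp: indicator_def\<close>)
qed

text \<open>Two limits, in this order: for a fixed threshold the Riemann sums converge, as the grid
  is refined, to a sum over finitely many jumps, and only then the threshold goes to zero. The
  coefficient is evaluated at left end points, where left continuity of \<open>v\<close> gives the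
  limit; all grid points are at most \<open>t\<close>, which keeps the sums
  \<open>F t\<close>-measurable.\<close>

lemma measurable_jump_sum:
  fixes F :: "real \<Rightarrow> 'a measure"
  assumes F: "filtration \<Omega> F"
    and L: "\<And>s. 0 \<le> s \<Longrightarrow> L s \<in> borel_measurable (F s)" "\<And>\<omega>. \<omega> \<in> \<Omega> \<Longrightarrow> cadlag (\<lambda>s. L s \<omega>)"
      "\<And>\<omega>. \<omega> \<in> \<Omega> \<Longrightarrow> square_summable_jumps (\<lambda>s. L s \<omega>)"
    and v: "\<And>s. 0 \<le> s \<Longrightarrow> v s \<in> borel_measurable (F s)" "\<And>s \<omega>. 0 \<le> s \<Longrightarrow> \<omega> \<in> \<Omega> \<Longrightarrow> v s \<omega> \<in> P"
      "\<And>s \<omega>. 0 < s \<Longrightarrow> \<omega> \<in> \<Omega> \<Longrightarrow> ((\<lambda>s. v s \<omega>) \<longlongrightarrow> v s \<omega>) (at_left s)"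
      "\<And>\<omega> t. \<omega> \<in> \<Omega> \<Longrightarrow> (\<lambda>s. h s (v s \<omega>) (jump (\<lambda>s. L s \<omega>) s)) abs_summable_on {0..t}"
    and t: "0 \<le> t"
  shows "(\<lambda>\<omega>. infsum (\<lambda>s. h s (v s \<omega>) (jump (\<lambda>s. L s \<omega>) s)) {0..t}) \<in> borel_measurable (F t)"
proof (cases "t = 0")
  case True
  interpret filtration \<Omega> F by fact
  have "infsum (\<lambda>s. h s (v s \<omega>) (jump (\<lambda>s. L s \<omega>) s)) {0..t} = 0" if "\<omega> \<in> space (F t)" for \<omega>
    using that True v(2)[of 0 \<omega>] by (simp add: space_F h_0)
  then show ?thesis by (subst measurable_cong) auto
next
  case False
  then have t: "0 < t" using t by simp
  interpret filtration \<Omega> F by fact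
  let ?x = "\<lambda>\<omega>. jump (\<lambda>s. L s \<omega>)"
  let ?h = "\<lambda>\<omega> s. h s (v s \<omega>) (?x \<omega> s)"
  let ?inc = "\<lambda>n i \<omega>. grid_increment (\<lambda>s. L s \<omega>) t n i"
  let ?u = "\<lambda>k \<omega> n i. cutoff k (norm (?inc n i \<omega>)) *\<^sub>R h (grid_left t n i) (v (grid_left t n i) \<omega>) (?inc n i \<omega>)"
  have riemann: "(\<lambda>n. \<Sum>i<n. ?u k \<omega> n i) \<longlonglongrightarrow> infsum (\<lambda>s. cutoff k (norm (?x \<omega> s)) *\<^sub>R ?h \<omega> s) {0..t}"
    if k: "0 < k" and \<omega>: "\<omega> \<in> \<Omega>" for k \<omega>
  proof -
    let ?S = "{s \<in> {0<..t}. 1 / real k \<le> norm (?x \<omega> s)}"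
    \<comment> \<open>Square summability leaves finitely many jumps of size at least
      \<open>1 / k\<close>; below that size the cutoff vanishes.\<close>
    have fin: "finite ?S"
    proof (rule finite_subset)
      show "?S \<subseteq> {s \<in> {0..t}. (1 / real k)\<^sup>2 \<le> (norm (?x \<omega> s))\<^sup>2}"
        by (auto intro!: power_mono)
      show "finite {s \<in> {0..t}. (1 / real k)\<^sup>2 \<le> (norm (?x \<omega> s))\<^sup>2}"
        by (rule finite_large_terms) (use L(3)[OF \<omega>] k in \<open>auto simp: square_summable_jumps_def\<close>)
    qed
    have "(\<lambda>n. \<Sum>i<n. ?u k \<omega> n i) \<longlonglongrightarrow> (\<Sum>s\<in>?S. cutoff k (norm (?x \<omega> s)) *\<^sub>R ?h \<omega> s)"
    proof (rule tendsto_grid_sum_large[OF L(2)[OF \<omega>] _ t fin])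
      show "0 < 1 / real k" using k by simp
      show "?u k \<omega> n i = 0" if "norm (?inc n i \<omega>) < 1 / real k" for n i
        using cutoff_eq_0[OF k that] by simp
      fix s assume s: "s \<in> {0<..t}"
      let ?g = "\<lambda>n. grid_left t n (grid_index t n s)" and ?d = "\<lambda>n. ?inc n (grid_index t n s) \<omega>"
      have d: "?d \<longlonglongrightarrow> ?x \<omega> s"
        by (rule tendsto_grid_increment[OF L(2)[OF \<omega>]]) (use s in auto)
      have g: "filterlim ?g (at_left s) sequentially"
        by (rule filterlim_grid_left) (use s in auto)
      then have g': "?g \<longlonglongrightarrow> s" by (simp add: filterlim_at)
      have vg: "(\<lambda>n. v (?g n) \<omega>) \<longlonglongrightarrow> v s \<omega>"
        by (rule filterlim_compose[OF v(3)[OF _ \<omega>] g]) (use s in auto)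
      have "(\<lambda>n. (\<lambda>(s, z, x). h s z x) (?g n, v (?g n) \<omega>, ?d n)) \<longlonglongrightarrow> (\<lambda>(s, z, x). h s z x) (s, v s \<omega>, ?x \<omega> s)"
        by (rule continuous_on_tendsto_compose[OF h_continuous])
           (use s t v(2)[OF _ \<omega>] in \<open>auto intro!: tendsto_Pair g' vg d always_eventually\<close>)
      then show "(\<lambda>n. ?u k \<omega> n (grid_index t n s)) \<longlonglongrightarrow> cutoff k (norm (?x \<omega> s)) *\<^sub>R ?h \<omega> s"
        by (intro tendsto_scaleR tendsto_cutoff tendsto_norm d) simp
    qed
    also have "(\<Sum>s\<in>?S. cutoff k (norm (?x \<omega> s)) *\<^sub>R ?h \<omega> s)
        = infsum (\<lambda>s. cutoff k (norm (?x \<omega> s)) *\<^sub>R ?h \<omega> s) ?S" using fin by simp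
    also have "\<dots> = infsum (\<lambda>s. cutoff k (norm (?x \<omega> s)) *\<^sub>R ?h \<omega> s) {0..t}"
    proof (rule infsum_cong_neutral)
      fix s assume s: "s \<in> {0..t} - ?S"
      then have "norm (?x \<omega> s) < 1 / real k" using k by (cases "s = 0") auto
      then show "cutoff k (norm (?x \<omega> s)) *\<^sub>R ?h \<omega> s = 0" using cutoff_eq_0[OF k] by simp
    qed auto
    finally show ?thesis .
  qed
  have meas: "(\<lambda>\<omega>. infsum (\<lambda>s. cutoff (Suc k) (norm (?x \<omega> s)) *\<^sub>R ?h \<omega> s) {0..t}) \<in> borel_measurable (F t)" for k
  proof (rule borel_measurable_LIMSEQ_metric)
    show "(\<lambda>n. \<Sum>i<n. ?u (Suc k) \<omega> n i) \<longlonglongrightarrow> infsum (\<lambda>s. cutoff (Suc k) (norm (?x \<omega> s)) *\<^sub>R ?h \<omega> s) {0..t}"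
      if "\<omega> \<in> space (F t)" for \<omega> using that by (intro riemann) (auto simp: space_F)
    fix n
    have 1: "L (grid_left t n i) \<in> borel_measurable (F t)" if "i \<le> n" for i
      by (rule measurable_F_mono[OF L(1)]) (use t that in \<open>auto intro!: grid_left_le\<close>)
    have 2: "v (grid_left t n i) \<in> borel_measurable (F t)" if "i \<le> n" for i
      by (rule measurable_F_mono[OF v(1)]) (use t that in \<open>auto intro!: grid_left_le\<close>)
    show "(\<lambda>\<omega>. \<Sum>i<n. ?u (Suc k) \<omega> n i) \<in> borel_measurable (F t)"
    proof (rule borel_measurable_sum)
      fix i assume i: "i \<in> {..<n}"
      have m: "?inc n i \<in> borel_measurable (F t)" using 1[of i] 1[of "Suc i"] i by simp
      have "(\<lambda>\<omega>. h (grid_left t n i) (v (grid_left t n i) \<omega>) (?inc n i \<omega>)) \<in> borel_measurable (F t)"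
        by (rule measurable_h[OF _ 2 _ m]) (use t i v(2) in \<open>auto simp: space_F\<close>)
      with m show "(\<lambda>\<omega>. ?u (Suc k) \<omega> n i) \<in> borel_measurable (F t)" by measurable
    qed
  qed
  show ?thesis
  proof (rule borel_measurable_LIMSEQ_metric[OF meas])
    fix \<omega> assume "\<omega> \<in> space (F t)"
    then have \<omega>: "\<omega> \<in> \<Omega>" by (simp add: space_F)
    have "(\<lambda>k. infsum (\<lambda>s. cutoff k (norm (?x \<omega> s)) *\<^sub>R ?h \<omega> s) {0..t}) \<longlonglongrightarrow> infsum (?h \<omega>) {0..t}"
      by (rule tendsto_infsum_cutoff[OF v(4)[OF \<omega>]]) (use v(2)[OF _ \<omega>] in \<open>auto simp: h_0\<close>)
    then show "(\<lambda>k. infsum (\<lambda>s. cutoff (Suc k) (norm (?x \<omega> s)) *\<^sub>R ?h \<omega> s) {0..t}) \<longlonglongrightarrow> infsum (?h \<omega>) {0..t}"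
      by (rule LIMSEQ_Suc)
  qed
qed

context
  fixes F :: "real \<Rightarrow> 'a measure" and \<Omega> and L :: "real \<Rightarrow> 'a \<Rightarrow> 'v" and Y0 :: "'a \<Rightarrow> 'm"
  assumes F: "filtration \<Omega> F"
    and L: "\<And>s. 0 \<le> s \<Longrightarrow> L s \<in> borel_measurable (F s)" "\<And>\<omega>. \<omega> \<in> \<Omega> \<Longrightarrow> cadlag (\<lambda>s. L s \<omega>)"
      "\<And>\<omega>. \<omega> \<in> \<Omega> \<Longrightarrow> square_summable_jumps (\<lambda>s. L s \<omega>)"
    and Y0: "Y0 \<in> borel_measurable (F 0)" "\<And>\<omega>. \<omega> \<in> \<Omega> \<Longrightarrow> Y0 \<omega> \<in> P"
begin

lemma measurable_Y0: "0 \<le> t \<Longrightarrow> Y0 \<in> borel_measurable (F t)"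
  using filtration.measurable_F_mono[OF F Y0(1)] .

lemma picard_left_continuous:
  assumes "\<omega> \<in> \<Omega>" "0 < s"
  shows "((\<lambda>s. picard (\<lambda>s. L s \<omega>) (Y0 \<omega>) n s) \<longlongrightarrow> picard (\<lambda>s. L s \<omega>) (Y0 \<omega>) n s) (at_left s)"
proof (cases n)
  case (Suc m)
  show ?thesis unfolding Suc picard.simps
    by (intro tendsto_add tendsto_const tendsto_infsum_at_left(2) picard_abs_summable L Y0 assms)
qed simp

text \<open>\<open>measurable_jump_sum\<close> treats closed intervals, whereas the iterates sum
  over \<open>{0..<t}\<close>. The latter is the limit of the sums up to
  \<open>t - t / (k + 1)\<close>, times that stay nonnegative.\<close>

lemma measurable_picard:
  assumes "0 \<le> t"
  shows "(\<lambda>\<omega>. picard (\<lambda>s. L s \<omega>) (Y0 \<omega>) n t) \<in> borel_measurable (F t)"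
  using assms
proof (induction n arbitrary: t)
  case 0
  then show ?case by (simp add: measurable_Y0)
next
  case (Suc n)
  interpret filtration \<Omega> F by (rule F)
  let ?I = "\<lambda>t \<omega>. infsum (\<lambda>r. h r (picard (\<lambda>s. L s \<omega>) (Y0 \<omega>) n r) (jump (\<lambda>s. L s \<omega>) r)) {0..t}"
  have I: "?I t \<in> borel_measurable (F t)" if "0 \<le> t" for t
    by (rule measurable_jump_sum[where v = "\<lambda>s \<omega>. picard (\<lambda>s. L s \<omega>) (Y0 \<omega>) n s"])
       (auto intro!: F L Suc.IH that picard_in_P Y0 picard_left_continuous picard_abs_summable)
  show ?case
  proof (cases "t = 0")
    case True
    then show ?thesis using Y0 by simp
  next
    case False
    with Suc.prems have t: "0 < t" by simp
    let ?t = "\<lambda>k. t - t / real (Suc k)"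
    have t_lim: "filterlim ?t (at_left t) sequentially"
    proof -
      have "?t \<longlonglongrightarrow> t" using tendsto_diff[OF tendsto_const LIMSEQ_Suc[OF lim_const_over_n[of t]], of t] by simp
      then show ?thesis using t by (auto simp: filterlim_at intro!: always_eventually)
    qed
    have tk: "0 \<le> ?t k" "?t k \<le> t" for k using t by (auto simp: field_simps)
    have "(\<lambda>\<omega>. Y0 \<omega> + infsum (\<lambda>r. h r (picard (\<lambda>s. L s \<omega>) (Y0 \<omega>) n r) (jump (\<lambda>s. L s \<omega>) r)) {0..<t}) \<in> borel_measurable (F t)"
    proof (intro borel_measurable_add measurable_Y0)
      show "(\<lambda>\<omega>. infsum (\<lambda>r. h r (picard (\<lambda>s. L s \<omega>) (Y0 \<omega>) n r) (jump (\<lambda>s. L s \<omega>) r)) {0..<t}) \<in> borel_measurable (F t)"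
      proof (rule borel_measurable_LIMSEQ_metric[OF measurable_F_mono[OF I[OF tk(1)] tk(2)]])
        fix \<omega> assume "\<omega> \<in> space (F t)"
        then have \<omega>: "\<omega> \<in> \<Omega>" by (simp add: space_F)
        show "(\<lambda>k. ?I (?t k) \<omega>) \<longlonglongrightarrow> infsum (\<lambda>r. h r (picard (\<lambda>s. L s \<omega>) (Y0 \<omega>) n r) (jump (\<lambda>s. L s \<omega>) r)) {0..<t}"
          by (rule filterlim_compose[OF tendsto_infsum_at_left(1)[OF picard_abs_summable] t_lim])
             (intro L Y0 \<omega> t)+
      qed
    qed (use t in simp)
    then show ?thesis by simp
  qed
qed

lemma measurable_left_solution:
  assumes "0 \<le> t"
  shows "(\<lambda>\<omega>. left_solution (\<lambda>s. L s \<omega>) (Y0 \<omega>) t) \<in> borel_measurable (F t)"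
proof (rule borel_measurable_LIMSEQ_metric[OF measurable_picard[OF assms]])
  interpret filtration \<Omega> F by (rule F)
  fix \<omega> assume "\<omega> \<in> space (F t)"
  then have "\<omega> \<in> \<Omega>" by (simp add: space_F)
  then show "(\<lambda>n. picard (\<lambda>s. L s \<omega>) (Y0 \<omega>) n t) \<longlonglongrightarrow> left_solution (\<lambda>s. L s \<omega>) (Y0 \<omega>) t"
    using picard_uniform[OF L(3) Y0(2), of \<omega> \<omega> t] assms by (metis atLeastAtMost_iff order_refl)
qed

lemma measurable_solution:
  assumes "0 \<le> t"
  shows "(\<lambda>\<omega>. solution (\<lambda>s. L s \<omega>) (Y0 \<omega>) t) \<in> borel_measurable (F t)"
  unfolding solution_def
proof (intro borel_measurable_add measurable_Y0 assms)
  show "(\<lambda>\<omega>. infsum (\<lambda>r. h r (left_solution (\<lambda>s. L s \<omega>) (Y0 \<omega>) r) (jump (\<lambda>s. L s \<omega>) r)) {0..t}) \<in> borel_measurable (F t)"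
  proof (rule measurable_jump_sum[where v = "\<lambda>s \<omega>. left_solution (\<lambda>s. L s \<omega>) (Y0 \<omega>) s"])
    fix s :: real and \<omega> assume s: "0 < s" and \<omega>: "\<omega> \<in> \<Omega>"
    let ?v = "left_solution (\<lambda>s. L s \<omega>) (Y0 \<omega>)"
    let ?g = "\<lambda>r. h r (?v r) (jump (\<lambda>s. L s \<omega>) r)"
    have "((\<lambda>s. Y0 \<omega> + infsum ?g {0..<s}) \<longlongrightarrow> Y0 \<omega> + infsum ?g {0..<s}) (at_left s)"
      by (intro tendsto_add tendsto_const tendsto_infsum_at_left(2) left_solution_abs_summable L Y0 \<omega> s)
    then have "((\<lambda>s. Y0 \<omega> + infsum ?g {0..<s}) \<longlongrightarrow> ?v s) (at_left s)"
      using left_solution_eq[OF L(3)[OF \<omega>] Y0(2)[OF \<omega>] less_imp_le[OF s]] by simp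
    then show "(?v \<longlongrightarrow> ?v s) (at_left s)"
      by (rule Lim_transform_eventually)
         (auto intro!: eventually_mono[OF eventually_at_left_real[OF s]] left_solution_eq[symmetric] L Y0 \<omega>)
  qed (auto intro!: F L assms measurable_left_solution left_solution_in_P Y0 left_solution_abs_summable)
qed

end

end

subsection \<open>Lebesgue--Stieltjes integrals\<close>

text \<open>Two decompositions of one integrator are compared by adding measures instead of
  subtracting them, so that no signed measure occurs.\<close>

definition add_measure :: "'a measure \<Rightarrow> 'a measure \<Rightarrow> 'a measure" where
  "add_measure M N = measure_of (space M) (sets M) (\<lambda>A. emeasure M A + emeasure N A)"

lemma sets_add_measure [simp]: "sets (add_measure M N) = sets M"
  and space_add_measure [simp]: "space (add_measure M N) = space M"
  by (simp_all add: add_measure_def)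

lemma emeasure_add_measure:
  assumes "sets N = sets M" "A \<in> sets M"
  shows "emeasure (add_measure M N) A = emeasure M A + emeasure N A"
  unfolding add_measure_def
proof (rule emeasure_measure_of_sigma)
  show "sigma_algebra (space M) (sets M)" by (rule sets.sigma_algebra_axioms)
  show "positive (sets M) (\<lambda>A. emeasure M A + emeasure N A)" by (simp add: positive_def)
  show "countably_additive (sets M) (\<lambda>A. emeasure M A + emeasure N A)"
    unfolding countably_additive_def
  proof (intro allI impI)
    fix A :: "nat \<Rightarrow> 'a set" assume A: "range A \<subseteq> sets M" "disjoint_family A" "(\<Union>i. A i) \<in> sets M"
    then show "(\<Sum>i. emeasure M (A i) + emeasure N (A i)) = emeasure M (\<Union>i. A i) + emeasure N (\<Union>i. A i)"
      using suminf_emeasure[of A M] suminf_emeasure[of A N] assms(1)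
      by (simp add: suminf_add[symmetric])
  qed
qed fact

lemma nn_integral_add_measure:
  assumes N: "sets N = sets M" and f: "f \<in> borel_measurable M"
  shows "(\<integral>\<^sup>+x. f x \<partial>add_measure M N) = (\<integral>\<^sup>+x. f x \<partial>M) + (\<integral>\<^sup>+x. f x \<partial>N)"
  using f
proof induction
  case (cong f g)
  then show ?case
    using nn_integral_cong[of "add_measure M N" f g] nn_integral_cong[of M f g] nn_integral_cong[of N f g]
      sets_eq_imp_space_eq[OF N] by simp
next
  case (set A)
  then show ?case using N by (simp add: emeasure_add_measure)
next
  case (mult u c)
  have "u \<in> borel_measurable (add_measure M N)" "u \<in> borel_measurable N"
    using mult.hyps N by (simp_all cong: measurable_cong_sets)
  then show ?case using mult by (simp add: nn_integral_cmult distrib_left)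
next
  case (add u v)
  have "u \<in> borel_measurable (add_measure M N)" "u \<in> borel_measurable N"
     "v \<in> borel_measurable (add_measure M N)" "v \<in> borel_measurable N"
    using add.hyps N by (simp_all cong: measurable_cong_sets)
  then show ?case using add by (simp add: nn_integral_add ac_simps)
next
  case (seq U)
  have m: "U i \<in> borel_measurable (add_measure M N)" "U i \<in> borel_measurable N" for i
    using seq.hyps(1)[of i] N by (simp_all cong: measurable_cong_sets)
  have inc: "incseq (\<lambda>i. \<integral>\<^sup>+x. U i x \<partial>K)" for K
    using \<open>incseq U\<close> by (auto simp: incseq_def le_fun_def intro!: nn_integral_mono)
  have *: "(\<integral>\<^sup>+x. (SUP i. U i) x \<partial>K) = (SUP i. \<integral>\<^sup>+x. U i x \<partial>K)" if "\<And>i. U i \<in> borel_measurable K" for K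
    using nn_integral_monotone_convergence_SUP[OF \<open>incseq U\<close> that] by (simp add: image_comp)
  show ?case
    unfolding *[OF m(1)] *[OF m(2)] *[OF seq.hyps(1)] seq.IH
    by (rule ennreal_SUP_add[OF inc inc])
qed

lemma borel_measure_eqI_Ioc:
  fixes \<mu> \<nu> :: "real measure"
  assumes "sets \<mu> = sets borel" "sets \<nu> = sets borel"
    and "\<And>a b. a \<le> b \<Longrightarrow> emeasure \<mu> {a<..b} = emeasure \<nu> {a<..b}"
    and "\<And>a b. a \<le> b \<Longrightarrow> emeasure \<mu> {a<..b} \<noteq> \<infinity>"
  shows "\<mu> = \<nu>"
proof (rule measure_eqI_generator_eq_countable)
  let ?E = "range (\<lambda>(a, b). {a<..b::real})"
  show "Int_stable ?E"
  proof (rule Int_stableI)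
    fix A B assume "A \<in> ?E" "B \<in> ?E"
    then obtain a b c d where "A = {a<..b}" "B = {c<..d}" by auto
    then have "A \<inter> B = (\<lambda>(a, b). {a<..b}) (max a c, min b d)" by auto
    then show "A \<inter> B \<in> ?E" by (metis rangeI)
  qed
  show "?E \<subseteq> Pow UNIV" by simp
  show "emeasure \<mu> X = emeasure \<nu> X" if "X \<in> ?E" for X
  proof -
    from that obtain a b where "X = {a<..b}" by auto
    with assms(3)[of a b] show ?thesis by (cases "a \<le> b") auto
  qed
  show "sets \<mu> = sigma_sets UNIV ?E" "sets \<nu> = sigma_sets UNIV ?E"
    using assms(1,2) by (simp_all add: borel_sigma_sets_Ioc)
  show "range (\<lambda>n::nat. {- real n<..real n}) \<subseteq> ?E" by auto
  show "\<Union> (range (\<lambda>n::nat. {- real n<..real n})) = UNIV"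
  proof (intro equalityI subsetI UNIV_I)
    fix x :: real
    obtain n :: nat where "\<bar>x\<bar> < real n" using reals_Archimedean2 by blast
    then show "x \<in> \<Union> (range (\<lambda>n::nat. {- real n<..real n}))" by (intro UN_I[of n]) auto
  qed
  show "countable (range (\<lambda>n::nat. {- real n<..real n}))" by simp
  show "emeasure \<mu> a \<noteq> \<infinity>" if "a \<in> range (\<lambda>n::nat. {- real n<..real n})" for a
    using that assms(4) by auto
qed

text \<open>If \<open>P - N = P' - N'\<close>, then \<open>P + N'\<close> and \<open>P' + N\<close>
  have the same increments. The corresponding sums of measures agree, and the integrals can be
  rearranged because all of them are finite.\<close>

lemma has_stieltjes_integral_unique:
  assumes I: "has_stieltjes_integral f g t I" and J: "has_stieltjes_integral f g t J"
  shows "I = J"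
proof -
  obtain P N where PN: "mono P" "mono N" "\<And>s. continuous (at_right s) P" "\<And>s. continuous (at_right s) N"
    "\<And>s. s \<in> {0..t} \<Longrightarrow> g s = P s - N s"
    "set_integrable (interval_measure P) {0<..t} f" "set_integrable (interval_measure N) {0<..t} f"
    "I = set_lebesgue_integral (interval_measure P) {0<..t} f - set_lebesgue_integral (interval_measure N) {0<..t} f"
    using I unfolding has_stieltjes_integral_def by blast
  obtain P' N' where PN': "mono P'" "mono N'" "\<And>s. continuous (at_right s) P'" "\<And>s. continuous (at_right s) N'"
    "\<And>s. s \<in> {0..t} \<Longrightarrow> g s = P' s - N' s"
    "set_integrable (interval_measure P') {0<..t} f" "set_integrable (interval_measure N') {0<..t} f"
    "J = set_lebesgue_integral (interval_measure P') {0<..t} f - set_lebesgue_integral (interval_measure N') {0<..t} f"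
    using J unfolding has_stieltjes_integral_def by blast
  \<comment> \<open>The decompositions are known to agree on \<open>{0..t}\<close> only, so the
    measures are restricted to \<open>{0<..t}\<close> before they are compared.\<close>
  define \<mu> where "\<mu> G = density (interval_measure G) (indicator {0<..t})" for G :: "real \<Rightarrow> real"
  have sets_\<mu> [simp]: "sets (\<mu> G) = sets borel" for G by (simp add: \<mu>_def)
  have Int: "emeasure (\<mu> G) {a<..b} = emeasure (interval_measure G) {max a 0<..min b t}" for G a b
  proof -
    have "emeasure (\<mu> G) {a<..b} = emeasure (interval_measure G) ({0<..t} \<inter> {a<..b})"
      by (simp add: \<mu>_def emeasure_restricted)
    also have "{0<..t} \<inter> {a<..b} = {max a 0<..min b t}" by auto
    finally show ?thesis .
  qed
  have Ioc: "emeasure (interval_measure G) {x<..y} = ennreal (G y - G x)"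
    if "mono G" "\<And>s. continuous (at_right s) G" "x \<le> y" for G x y
    using that by (intro emeasure_interval_measure_Ioc) (auto simp: mono_def)
  have eq: "add_measure (\<mu> P) (\<mu> N') = add_measure (\<mu> P') (\<mu> N)"
  proof (rule borel_measure_eqI_Ioc)
    fix a b :: real assume "a \<le> b"
    have *: "P s + N' s = P' s + N s" if "s \<in> {0..t}" for s using PN(5)[OF that] PN'(5)[OF that] by simp
    define x y where "x = max a 0" and "y = min b t"
    have "emeasure (add_measure (\<mu> P) (\<mu> N')) {a<..b} \<noteq> \<infinity> \<and>
      emeasure (add_measure (\<mu> P) (\<mu> N')) {a<..b} = emeasure (add_measure (\<mu> P') (\<mu> N)) {a<..b}"
    proof (cases "x \<le> y")
      case True
      then have xy: "x \<in> {0..t}" "y \<in> {0..t}" by (auto simp: x_def y_def)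
      have "emeasure (add_measure (\<mu> P) (\<mu> N')) {a<..b} = ennreal ((P y - P x) + (N' y - N' x))"
        using PN(1-4) PN'(1-4) True by (simp add: emeasure_add_measure Int Ioc x_def[symmetric] y_def[symmetric] mono_def)
      moreover have "(P y - P x) + (N' y - N' x) = (P' y - P' x) + (N y - N x)"
        using *[OF xy(1)] *[OF xy(2)] by simp
      moreover have "emeasure (add_measure (\<mu> P') (\<mu> N)) {a<..b} = ennreal ((P' y - P' x) + (N y - N x))"
        using PN(1-4) PN'(1-4) True by (simp add: emeasure_add_measure Int Ioc x_def[symmetric] y_def[symmetric] mono_def)
      ultimately show ?thesis by simp
    next
      case False
      then have "{x<..y} = {}" by auto
      then show ?thesis by (simp add: emeasure_add_measure Int x_def[symmetric] y_def[symmetric])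
    qed
    then show "emeasure (add_measure (\<mu> P) (\<mu> N')) {a<..b} \<noteq> \<infinity>"
      "emeasure (add_measure (\<mu> P) (\<mu> N')) {a<..b} = emeasure (add_measure (\<mu> P') (\<mu> N)) {a<..b}" by auto
  qed simp_all
  define F where "F x = indicator {0<..t} x *\<^sub>R f x" for x
  have F: "F \<in> borel_measurable borel"
    using borel_measurable_integrable[OF PN(6)[unfolded set_integrable_def]] by (simp add: F_def[abs_def])
  have *: "(\<integral>\<^sup>+x. ennreal (c * F x) \<partial>interval_measure P) + (\<integral>\<^sup>+x. ennreal (c * F x) \<partial>interval_measure N') =
      (\<integral>\<^sup>+x. ennreal (c * F x) \<partial>interval_measure P') + (\<integral>\<^sup>+x. ennreal (c * F x) \<partial>interval_measure N)" for c
  proof -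
    have m: "(\<lambda>x. ennreal (c * F x)) \<in> borel_measurable borel" using F by measurable
    have \<mu>: "(\<integral>\<^sup>+x. ennreal (c * F x) \<partial>\<mu> G) = (\<integral>\<^sup>+x. ennreal (c * F x) \<partial>interval_measure G)" for G
      unfolding \<mu>_def using m
      by (subst nn_integral_density) (auto intro!: nn_integral_cong simp: F_def indicator_def)
    show ?thesis
      using nn_integral_add_measure[of "\<mu> N'" "\<mu> P" "\<lambda>x. ennreal (c * F x)"]
        nn_integral_add_measure[of "\<mu> N" "\<mu> P'" "\<lambda>x. ennreal (c * F x)"] m eq
      by (simp add: \<mu> cong: measurable_cong_sets)
  qed
  \<comment> \<open>As \<open>ennreal\<close> sends negative numbers to \<open>0\<close>, the
    choices \<open>c = 1\<close> and \<open>c = -1\<close> single out the positive and the negative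
    part of \<open>F\<close>.\<close>
  define \<Phi> where "\<Phi> c G = enn2real (\<integral>\<^sup>+x. ennreal (c * F x) \<partial>interval_measure G)" for c and G :: "real \<Rightarrow> real"
  have int: "set_lebesgue_integral (interval_measure G) {0<..t} f = \<Phi> 1 G - \<Phi> (-1) G"
      "(\<integral>\<^sup>+x. ennreal (c * F x) \<partial>interval_measure G) < \<infinity>"
    if "set_integrable (interval_measure G) {0<..t} f" for G c
  proof -
    have i: "integrable (interval_measure G) F" using that by (simp add: set_integrable_def F_def[abs_def])
    show "set_lebesgue_integral (interval_measure G) {0<..t} f = \<Phi> 1 G - \<Phi> (-1) G"
      using real_lebesgue_integral_def[OF i]
      by (simp add: \<Phi>_def set_lebesgue_integral_def F_def[abs_def])
    have "integrable (interval_measure G) (\<lambda>x. c * F x)" using i by simp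
    then show "(\<integral>\<^sup>+x. ennreal (c * F x) \<partial>interval_measure G) < \<infinity>"
      unfolding real_integrable_def by (simp add: less_top)
  qed
  have "\<Phi> c P + \<Phi> c N' = \<Phi> c P' + \<Phi> c N" for c
    using arg_cong[OF *[of c], of enn2real] int(2)[OF PN(6), of c] int(2)[OF PN(7), of c]
      int(2)[OF PN'(6), of c] int(2)[OF PN'(7), of c]
    by (simp add: \<Phi>_def enn2real_plus)
  from this[of 1] this[of "-1"] show ?thesis
    by (simp add: PN(8) PN'(8) int(1)[OF PN(6)] int(1)[OF PN(7)] int(1)[OF PN'(6)] int(1)[OF PN'(7)])
qed

lemma stieltjes_integral_eqI: "has_stieltjes_integral f g t I \<Longrightarrow> stieltjes_integral f g t = I"
  unfolding stieltjes_integral_def using has_stieltjes_integral_unique by blast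

section \<open>Integration against pure jump functions\<close>

context
  fixes p :: "real \<Rightarrow> real"
  assumes p: "p summable_on UNIV" "\<And>s. 0 \<le> p s"
begin

lemma p_summable: "p summable_on A"
  using p(1) by (rule summable_on_subset_banach) simp

lemma p_abs_summable: "Infinite_Set_Sum.abs_summable_on p A"
  using p_summable[of A] p(2) by (simp add: abs_summable_equivalent[symmetric])

lemma mono_infsum_atMost: "mono (\<lambda>u. infsum p {..u})"
  by (intro monoI infsum_mono2 p_summable) (use p in auto)

lemma infsum_atMost_diff: "a \<le> b \<Longrightarrow> infsum p {..b} - infsum p {..a} = infsum p {a<..b}"
  using infsum_Un_disjoint[OF p_summable p_summable, of "{..a}" "{a<..b}"] ivl_disj_un_one(3)[of a b] by force

lemma continuous_infsum_atMost: "continuous (at_right s) (\<lambda>u. infsum p {..u})"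
  unfolding continuous_within
proof (rule tendstoI)
  fix e :: real assume e: "0 < e"
  obtain S where S: "finite S" "\<And>B. B \<subseteq> UNIV - S \<Longrightarrow> infsum p B < e"
    using infsum_tail_small[OF p(1) p(2) e] by metis
  have "\<forall>\<^sub>F u in at_right s. \<forall>x\<in>S. \<not> (s < x \<and> x \<le> u)"
  proof (rule eventually_ball_finite[OF S(1)], rule)
    fix x
    show "\<forall>\<^sub>F u in at_right s. \<not> (s < x \<and> x \<le> u)"
      by (cases "s < x") (auto simp: not_le intro!: eventually_at_rightI[of s x])
  qed
  with eventually_at_right_less[of s]
  show "\<forall>\<^sub>F u in at_right s. dist (infsum p {..u}) (infsum p {..s}) < e"
  proof eventually_elim
    case (elim u)
    have "infsum p {s<..u} < e" by (rule S(2)) (use elim in auto)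
    moreover have "0 \<le> infsum p {s<..u}" by (rule infsum_nonneg) (rule p)
    ultimately show ?case using infsum_atMost_diff[of s u] elim by (simp add: dist_real_def)
  qed
qed

text \<open>The Stieltjes measure of a pure jump function is the counting measure weighted by the
  jumps. The \<open>distr\<close> along the identity merely restricts it from all sets to the Borel
  sets.\<close>

lemma interval_measure_infsum:
  "interval_measure (\<lambda>u. infsum p {..u}) = distr (density (count_space UNIV) p) borel (\<lambda>x. x)"
proof (rule borel_measure_eqI_Ioc)
  fix a b :: real assume ab: "a \<le> b"
  have 1: "emeasure (interval_measure (\<lambda>u. infsum p {..u})) {a<..b} = ennreal (infsum p {a<..b})"
    using emeasure_interval_measure_Ioc[OF ab, of "\<lambda>u. infsum p {..u}"] mono_infsum_atMost continuous_infsum_atMost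
    by (simp add: infsum_atMost_diff[OF ab] mono_def)
  have "emeasure (distr (density (count_space UNIV) p) borel (\<lambda>x. x)) {a<..b} = (\<integral>\<^sup>+x. ennreal (p x) * indicator {a<..b} x \<partial>count_space UNIV)"
    by (subst emeasure_distr) (auto simp: emeasure_density)
  also have "\<dots> = (\<integral>\<^sup>+x. ennreal (p x) \<partial>count_space {a<..b})" by (simp add: nn_integral_count_space_indicator)
  also have "\<dots> = ennreal (infsum p {a<..b})"
    using nn_integral_conv_infsetsum[OF p_abs_summable] p(2) by (simp add: infsetsum_infsum[OF p_abs_summable])
  finally show "emeasure (interval_measure (\<lambda>u. infsum p {..u})) {a<..b} =
      emeasure (distr (density (count_space UNIV) p) borel (\<lambda>x. x)) {a<..b}" using 1 by simp
  show "emeasure (interval_measure (\<lambda>u. infsum p {..u})) {a<..b} \<noteq> \<infinity>" by (simp add: 1)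
qed simp_all

lemma set_integral_interval_measure_infsum:
  fixes f :: "real \<Rightarrow> real"
  assumes f: "(\<lambda>x. indicator A x *\<^sub>R f x) \<in> borel_measurable borel" and K: "\<And>x. x \<in> A \<Longrightarrow> \<bar>f x\<bar> \<le> K"
  shows "set_integrable (interval_measure (\<lambda>u. infsum p {..u})) A f" (is ?A)
    and "set_lebesgue_integral (interval_measure (\<lambda>u. infsum p {..u})) A f = infsum (\<lambda>x. f x * p x) A" (is ?B)
proof -
  have "(\<lambda>x. f x * p x) abs_summable_on A"
  proof (rule summable_on_comparison_test)
    show "(\<lambda>x. K * p x) summable_on A" by (intro summable_on_cmult_right p_summable)
    show "norm (f x * p x) \<le> K * p x" if "x \<in> A" for x
      using K[OF that] p(2) by (simp add: abs_mult mult_right_mono)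
  qed simp
  then have abs: "Infinite_Set_Sum.abs_summable_on (\<lambda>x. f x * p x) A" by (simp only: abs_summable_equivalent)
  have eq: "p x * (indicator A x * f x) = indicator A x * (f x * p x)" for x by (simp add: mult_ac)
  show ?A
    unfolding set_integrable_def interval_measure_infsum
    using abs f p by (simp add: integrable_distr_eq integrable_density eq abs_summable_on_altdef set_integrable_def)
  have "set_lebesgue_integral (interval_measure (\<lambda>u. infsum p {..u})) A f = infsetsum (\<lambda>x. f x * p x) A"
    unfolding set_lebesgue_integral_def interval_measure_infsum
    using f p by (simp add: integral_distr integral_density eq infsetsum_altdef set_lebesgue_integral_def)
  then show ?B using infsetsum_infsum[OF abs] by simp
qed

end

text \<open>The positive and negative parts of \<open>q\<close> give an admissible decomposition of
  \<open>g\<close>. By uniqueness of the integral it may be computed from this one, for which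
  integrals are sums.\<close>

lemma stieltjes_integral_pure_jump:
  fixes f q :: "real \<Rightarrow> real"
  assumes q: "q abs_summable_on {0..t}" "q 0 = 0"
    and g: "\<And>s. s \<in> {0..t} \<Longrightarrow> g s = infsum q {0..s}"
    and f: "(\<lambda>x. indicator {0<..t} x *\<^sub>R f x) \<in> borel_measurable borel" "\<And>x. x \<in> {0<..t} \<Longrightarrow> \<bar>f x\<bar> \<le> K"
  shows "stieltjes_integral f g t = infsum (\<lambda>s. f s * q s) {0..t}"
proof (rule stieltjes_integral_eqI)
  \<comment> \<open>\<open>p 1\<close> and \<open>p (-1)\<close> are the positive and negative parts
    of \<open>q\<close>, set to zero off \<open>{0..t}\<close> so that both are summable over the
    whole line.\<close>
  define p where "p c s = (if s \<in> {0..t} then max 0 (c * q s) else 0)" for c s :: real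
  have p: "p c summable_on UNIV" "0 \<le> p c s" if "\<bar>c\<bar> \<le> 1" for c s
  proof -
    have "p c summable_on {0..t}"
    proof (rule summable_on_comparison_test[OF q(1)])
      show "p c x \<le> norm (q x)" if "x \<in> {0..t}" for x
      proof -
        have "\<bar>c * q x\<bar> \<le> \<bar>q x\<bar>" using \<open>\<bar>c\<bar> \<le> 1\<close> by (simp add: abs_mult mult_left_le_one_le)
        then show ?thesis by (auto simp: p_def)
      qed
    qed (simp add: p_def)
    then show "p c summable_on UNIV"
      by (rule summable_on_cong_neutral[THEN iffD1, rotated -1]) (auto simp: p_def)
    show "0 \<le> p c s" by (simp add: p_def)
  qed
  have "\<bar>1\<bar> \<le> (1::real)" "\<bar>-1\<bar> \<le> (1::real)" by simp_all
  note pos = p(1)[OF this(1)] p(2)[OF this(1)] and neg = p(1)[OF this(2)] p(2)[OF this(2)]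
  have S: "set_integrable (interval_measure (\<lambda>u. infsum (p c) {..u})) {0<..t} f"
      "set_lebesgue_integral (interval_measure (\<lambda>u. infsum (p c) {..u})) {0<..t} f = infsum (\<lambda>x. f x * p c x) {0<..t}"
    if "\<bar>c\<bar> \<le> 1" for c
  proof -
    show "set_integrable (interval_measure (\<lambda>u. infsum (p c) {..u})) {0<..t} f"
      by (rule set_integral_interval_measure_infsum(1)[where K = K]) (rule p[OF that] f | assumption)+
    show "set_lebesgue_integral (interval_measure (\<lambda>u. infsum (p c) {..u})) {0<..t} f = infsum (\<lambda>x. f x * p c x) {0<..t}"
      by (rule set_integral_interval_measure_infsum(2)[where K = K]) (rule p[OF that] f | assumption)+
  qed
  have sum: "(\<lambda>x. f x * p c x) summable_on {0<..t}" if "\<bar>c\<bar> \<le> 1" for c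
  proof (rule abs_summable_summable, rule summable_on_comparison_test)
    show "(\<lambda>x. K * p c x) summable_on {0<..t}"
      by (rule summable_on_cmult_right, rule p_summable) (rule p[OF that])+
    show "norm (f x * p c x) \<le> K * p c x" if "x \<in> {0<..t}" for x
      using f(2)[OF that] p(2)[OF \<open>\<bar>c\<bar> \<le> 1\<close>, of x] by (simp add: abs_mult mult_right_mono)
  qed simp
  have dif: "p 1 s - p (-1) s = q s" if "s \<in> {0..t}" for s
    using that by (simp add: p_def max_def)
  \<comment> \<open>The integral leaves out time \<open>0\<close> and the sum includes it;
    \<open>q 0 = 0\<close> reconciles the two.\<close>
  have "infsum (\<lambda>s. f s * q s) {0..t} = infsum (\<lambda>x. f x * p 1 x - f x * p (-1) x) {0<..t}"
  proof (rule infsum_cong_neutral)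
    fix x assume "x \<in> {0..t} \<inter> {0<..t}"
    then show "f x * q x = f x * p 1 x - f x * p (-1) x" using dif[of x] by (simp add: right_diff_distrib[symmetric])
  next
    fix x assume "x \<in> {0..t} - {0<..t}"
    then have "x = 0" by auto
    then show "f x * q x = 0" using q by simp
  qed auto
  also have "\<dots> = infsum (\<lambda>x. f x * p 1 x) {0<..t} - infsum (\<lambda>x. f x * p (-1) x) {0<..t}"
    by (intro infsum_diff sum) auto
  finally have I: "infsum (\<lambda>s. f s * q s) {0..t} = \<dots>" .
  show "has_stieltjes_integral f g t (infsum (\<lambda>s. f s * q s) {0..t})"
    unfolding has_stieltjes_integral_def
  proof (intro exI conjI allI ballI)
    show "mono (\<lambda>u. infsum (p 1) {..u})" "mono (\<lambda>u. infsum (p (-1)) {..u})"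
      by (intro mono_infsum_atMost pos neg)+
    show "continuous (at_right s) (\<lambda>u. infsum (p 1) {..u})" "continuous (at_right s) (\<lambda>u. infsum (p (-1)) {..u})" for s
      by (intro continuous_infsum_atMost pos neg)+
    show "g s = infsum (p 1) {..s} - infsum (p (-1)) {..s}" if s: "s \<in> {0..t}" for s
    proof -
      have "infsum (p 1) {..s} - infsum (p (-1)) {..s} = infsum (\<lambda>x. p 1 x - p (-1) x) {..s}"
        by (rule infsum_diff[symmetric]; rule p_summable; rule pos neg)
      also have "\<dots> = infsum q {0..s}"
        by (rule infsum_cong_neutral) (use s dif in \<open>auto simp: p_def\<close>)
      finally show ?thesis using g[OF s] by simp
    qed
  qed (use I in \<open>simp_all only: S abs_one abs_minus_cancel order_refl\<close>)
qed

subsection \<open>Matrices with the Frobenius norm\<close>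

lemma inner_matrix_rows: "X \<bullet> Y = (\<Sum>i\<in>UNIV. (X $ i) \<bullet> (Y $ i))" for X Y :: "real ^ 'n ^ 'm"
  by (simp add: inner_vec_def)

lemma inner_matrix_columns: "X \<bullet> Y = (\<Sum>j\<in>UNIV. column j X \<bullet> column j Y)" for X Y :: "real ^ 'n ^ 'm"
  unfolding inner_vec_def column_def by (simp, rule sum.swap)

lemma column_matrix_mult: "column j (X ** Y) = X *v column j Y"
  by (simp add: column_def matrix_matrix_mult_def matrix_vector_mult_def vec_eq_iff)

lemma norm_matrix_rows: "(norm X)\<^sup>2 = (\<Sum>i\<in>UNIV. (norm (X $ i))\<^sup>2)" for X :: "real ^ 'n ^ 'm"
  by (simp add: power2_norm_eq_inner inner_matrix_rows)

lemma norm_matrix_columns: "(norm X)\<^sup>2 = (\<Sum>j\<in>UNIV. (norm (column j X))\<^sup>2)" for X :: "real ^ 'n ^ 'm"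
  by (simp add: power2_norm_eq_inner inner_matrix_columns)

lemma norm_matrix_vector_mult_le: "norm (X *v v) \<le> norm X * norm v" for X :: "real ^ 'n ^ 'm"
proof -
  have "(norm (X *v v))\<^sup>2 = (\<Sum>i\<in>UNIV. ((X $ i) \<bullet> v)\<^sup>2)"
    unfolding power2_norm_eq_inner inner_vec_def[of "X *v v"]
    by (simp add: matrix_vector_mul_component power2_eq_square)
  also have "\<dots> \<le> (\<Sum>i\<in>UNIV. (norm (X $ i))\<^sup>2 * (norm v)\<^sup>2)"
    by (intro sum_mono) (metis Cauchy_Schwarz_ineq power2_norm_eq_inner)
  also have "\<dots> = (norm X * norm v)\<^sup>2"
    by (simp add: norm_matrix_rows power_mult_distrib sum_distrib_right)
  finally show ?thesis by (rule power2_le_imp_le) simp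
qed

text \<open>\<open>r\<close> is an operator norm bound, applied to each column. The Frobenius norm
  of the left factor may exceed \<open>1\<close> where its operator norm does not, which matters for
  the contraction in \<open>ex_square_root\<close>.\<close>

lemma norm_matrix_mult_bound:
  fixes X :: "real ^ 'n ^ 'm" and Y :: "real ^ 'k ^ 'n"
  assumes r: "0 \<le> r" "\<And>v. norm (X *v v) \<le> r * norm v"
  shows "norm (X ** Y) \<le> r * norm Y"
proof (rule power2_le_imp_le)
  have "(norm (X ** Y))\<^sup>2 \<le> (\<Sum>j\<in>UNIV. (r * norm (column j Y))\<^sup>2)"
    unfolding norm_matrix_columns column_matrix_mult by (intro sum_mono power_mono r norm_ge_zero)
  also have "\<dots> = (r * norm Y)\<^sup>2"
    by (simp add: norm_matrix_columns power_mult_distrib sum_distrib_left)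
  finally show "(norm (X ** Y))\<^sup>2 \<le> (r * norm Y)\<^sup>2" .
qed (use r in simp)

lemma norm_matrix_mult_le: "norm (X ** Y) \<le> norm X * norm Y"
  for X :: "real ^ 'n ^ 'm" and Y :: "real ^ 'k ^ 'n"
  by (rule norm_matrix_mult_bound) (auto intro: norm_matrix_vector_mult_le)

lemma matrix_mult_scaleR_left: "(r *\<^sub>R X) ** Y = r *\<^sub>R (X ** Y)"
  and matrix_mult_scaleR_right: "X ** (r *\<^sub>R Y) = r *\<^sub>R (X ** Y)"
  for X :: "real ^ 'n ^ 'm" and Y :: "real ^ 'k ^ 'n"
  by (simp_all add: matrix_matrix_mult_def vec_eq_iff sum_distrib_left mult_ac)

lemma bounded_bilinear_matrix_mult:
  "bounded_bilinear ((**) :: real ^ 'n ^ 'm \<Rightarrow> real ^ 'k ^ 'n \<Rightarrow> real ^ 'k ^ 'm)"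
proof
  show "\<exists>K. \<forall>X Y. norm (X ** Y :: real ^ 'k ^ 'm) \<le> norm (X :: real ^ 'n ^ 'm) * norm Y * K"
    by (rule exI[of _ 1]) (simp add: norm_matrix_mult_le)
  show "(X + X') ** Y = X ** Y + X' ** Y" for X X' :: "real ^ 'n ^ 'm" and Y :: "real ^ 'k ^ 'n"
    by (simp add: matrix_matrix_mult_def vec_eq_iff sum.distrib distrib_right)
qed (rule matrix_add_ldistrib matrix_mult_scaleR_left matrix_mult_scaleR_right)+

interpretation matrix_mult: bounded_bilinear "(**) :: real ^ 'n ^ 'm \<Rightarrow> real ^ 'k ^ 'n \<Rightarrow> real ^ 'k ^ 'm"
  by (rule bounded_bilinear_matrix_mult)

lemma transpose_add: "transpose (X + Y) = transpose X + transpose Y"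
  and transpose_diff: "transpose (X - Y) = transpose X - transpose Y" for X Y :: "real ^ 'n ^ 'm"
  by (simp_all add: transpose_def vec_eq_iff)

lemma norm_transpose [simp]: "norm (transpose X) = norm X" for X :: "real ^ 'n ^ 'm"
proof -
  have "(norm (transpose X))\<^sup>2 = (\<Sum>i\<in>UNIV. (norm (transpose X $ i))\<^sup>2)" by (rule norm_matrix_rows)
  also have "\<dots> = (\<Sum>i\<in>UNIV. (norm (column i X))\<^sup>2)" by (simp add: transpose_def column_def)
  also have "\<dots> = (norm X)\<^sup>2" by (rule norm_matrix_columns[symmetric])
  finally show ?thesis by simp
qed

lemma bounded_linear_transpose: "bounded_linear (transpose :: real ^ 'n ^ 'm \<Rightarrow> real ^ 'm ^ 'n)"
  by standard (auto simp: transpose_add transpose_scalar intro: exI[of _ 1])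

lemma inner_transpose: "transpose X \<bullet> transpose Y = X \<bullet> Y" for X Y :: "real ^ 'n ^ 'm"
  by (subst inner_matrix_columns) (simp add: inner_matrix_rows column_transpose row_def)

lemma matrix_vector_inner: "(X *v u) \<bullet> v = u \<bullet> (transpose X *v v)" for X :: "real ^ 'n ^ 'm"
  by (metis dot_lmul_matrix inner_commute transpose_matrix_vector)

lemma matrix_mult_inner_left: "(X ** Y) \<bullet> Z = Y \<bullet> (transpose X ** Z)" for X :: "real ^ 'n ^ 'm"
  by (simp only: inner_matrix_columns column_matrix_mult matrix_vector_inner)

definition outer :: "real ^ 'd \<Rightarrow> real ^ 'd ^ 'd" where
  "outer v = (\<chi> i j. v $ i * v $ j)"

lemma outer_eq_columnvector: "(columnvector v :: real ^ 1 ^ 'd) ** transpose (columnvector v) = outer v"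
  by (simp add: outer_def columnvector_def transpose_def matrix_matrix_mult_def vec_eq_iff)

lemma outer_vector_mult: "outer v *v u = (v \<bullet> u) *\<^sub>R v"
  by (simp add: outer_def matrix_vector_mult_def vec_eq_iff inner_vec_def sum_distrib_right sum_distrib_left mult_ac)

lemma outer_matrix_vector_mult: "outer (X *v v) = X ** outer v ** transpose X"
proof -
  have "outer (X *v v) $ i $ j = (X ** outer v ** transpose X) $ i $ j" for i j
    by (simp add: outer_def matrix_matrix_mult_def matrix_vector_mult_def transpose_def
        sum_product sum_distrib_right sum_distrib_left mult_ac)
  then show ?thesis by (simp add: vec_eq_iff)
qed

lemma norm_outer: "norm (outer v) = (norm v)\<^sup>2"
proof -
  have "outer v $ i = (v $ i) *\<^sub>R v" for i by (simp add: outer_def vec_eq_iff)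
  then have "(norm (outer v))\<^sup>2 = (\<Sum>i\<in>UNIV. (v $ i)\<^sup>2) * (norm v)\<^sup>2"
    by (simp add: norm_matrix_rows power_mult_distrib sum_distrib_right)
  also have "(\<Sum>i\<in>UNIV. (v $ i)\<^sup>2) = (norm v)\<^sup>2"
    by (simp add: power2_norm_eq_inner inner_vec_def) (simp add: power2_eq_square)
  finally have "(norm (outer v))\<^sup>2 = ((norm v)\<^sup>2)\<^sup>2" by (simp add: power2_eq_square)
  then show ?thesis by (rule power2_eq_imp_eq) auto
qed

lemma continuous_on_outer: "continuous_on UNIV outer"
  unfolding outer_def by (intro continuous_intros)

subsection \<open>Positive semidefinite matrices\<close>

lemma psd_0: "psd 0"
  by (simp add: psd_def symmetric_matrix_def transpose_def vec_eq_iff)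

lemma psd_add: "psd X \<Longrightarrow> psd Y \<Longrightarrow> psd (X + Y)"
  by (simp add: psd_def symmetric_matrix_def transpose_add matrix_vector_mult_add_rdistrib inner_add_right)

lemma psd_congruence: "psd X \<Longrightarrow> psd (A ** X ** transpose A)"
proof -
  assume X: "psd X"
  have "0 \<le> v \<bullet> ((A ** X ** transpose A) *v v)" for v
  proof -
    have "v \<bullet> ((A ** X ** transpose A) *v v) = (transpose A *v v) \<bullet> (X *v (transpose A *v v))"
      using matrix_vector_inner[of A "X *v (transpose A *v v)" v]
      by (simp only: matrix_vector_mul_assoc[symmetric] inner_commute)
    then show ?thesis using X by (simp only: psd_def)
  qed
  then show ?thesis using X
    by (simp add: psd_def symmetric_matrix_def matrix_transpose_mul matrix_mul_assoc)
qed

lemma psd_outer: "psd (outer v)"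
  by (auto simp: psd_def symmetric_matrix_def outer_vector_mult inner_commute[of _ v])
     (simp add: outer_def transpose_def vec_eq_iff mult.commute)

lemma closed_psd: "closed {X :: real ^ 'd ^ 'd. psd X}"
proof -
  have "{X :: real ^ 'd ^ 'd. psd X} = {X. transpose X = X} \<inter> (\<Inter>v. {X. 0 \<le> v \<bullet> (X *v v)})"
    by (auto simp: psd_def symmetric_matrix_def)
  moreover have "closed {X :: real ^ 'd ^ 'd. transpose X = X}"
    by (intro closed_Collect_eq linear_continuous_on bounded_linear_transpose continuous_on_id)
  moreover have "closed {X :: real ^ 'd ^ 'd. 0 \<le> v \<bullet> (X *v v)}" for v
    unfolding inner_vec_def matrix_vector_mult_def by (intro closed_Collect_le continuous_intros)
  ultimately show ?thesis by (auto intro!: closed_Int closed_INT)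
qed

text \<open>The form is nonnegative along \<open>u + t v\<close>, so its discriminant as a
  polynomial in \<open>t\<close> is not positive; \<open>c = 0\<close>, where the polynomial is
  affine, is treated apart.\<close>

lemma psd_Cauchy_Schwarz:
  assumes H: "psd H"
  shows "(u \<bullet> (H *v v))\<^sup>2 \<le> (u \<bullet> (H *v u)) * (v \<bullet> (H *v v))"
proof -
  define a b c where "a = u \<bullet> (H *v u)" and "b = u \<bullet> (H *v v)" and "c = v \<bullet> (H *v v)"
  have sym: "v \<bullet> (H *v u) = b"
    using H matrix_vector_inner[of H u v] by (simp add: b_def psd_def symmetric_matrix_def inner_commute)
  have q: "0 \<le> a + 2 * t * b + t\<^sup>2 * c" for t
  proof -
    have "0 \<le> (u + t *\<^sub>R v) \<bullet> (H *v (u + t *\<^sub>R v))" using H by (simp add: psd_def)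
    also have "\<dots> = a + 2 * t * b + t\<^sup>2 * c"
      using sym by (simp add: matrix_vector_right_distrib matrix_vector_mult_scaleR inner_add_left inner_add_right
          a_def b_def c_def power2_eq_square algebra_simps)
    finally show ?thesis .
  qed
  have c0: "0 \<le> c" using H by (simp add: c_def psd_def)
  have "b\<^sup>2 \<le> a * c"
  proof (cases "c = 0")
    case True
    have "b = 0"
    proof (rule ccontr)
      assume "b \<noteq> 0"
      \<comment> \<open>With \<open>c = 0\<close> this \<open>t\<close> gives the polynomial the
        value \<open>a + 2 t b = -1\<close>.\<close>
      then show False using q[of "- (a + 1) / (2 * b)"] True by (simp add: field_simps)
    qed
    then show ?thesis using True by simp
  next
    case False
    \<comment> \<open>The minimiser of the quadratic polynomial.\<close>
    then show ?thesis using q[of "- b / c"] c0 by (simp add: field_simps power2_eq_square)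
  qed
  then show ?thesis by (simp add: a_def b_def c_def)
qed

text \<open>In Cauchy-Schwarz for the form of \<open>H\<close> at \<open>H *v v\<close> and
  \<open>v\<close> both factors on the right are controlled by \<open>r\<close>, and one square of
  \<open>norm (H *v v)\<close> cancels. For psd matrices the form thus controls the operator
  norm.\<close>

lemma psd_norm_le:
  assumes H: "psd H" and r: "\<And>v. v \<bullet> (H *v v) \<le> r * (norm v)\<^sup>2"
  shows "norm (H *v v) \<le> r * norm v"
proof (cases "H *v v = 0")
  case True
  have "0 \<le> r * (norm v)\<^sup>2" using H r[of v] by (meson order_trans psd_def)
  then have "0 \<le> r * norm v" by (cases "v = 0") (auto simp: zero_le_mult_iff)
  then show ?thesis using True by simp
next
  case False
  let ?w = "H *v v"
  have "((norm ?w)\<^sup>2)\<^sup>2 \<le> (?w \<bullet> (H *v ?w)) * (v \<bullet> (H *v v))"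
    using psd_Cauchy_Schwarz[OF H, of ?w v] by (simp add: power2_norm_eq_inner)
  also have "\<dots> \<le> (r * (norm ?w)\<^sup>2) * (r * (norm v)\<^sup>2)"
    by (intro mult_mono r) (use H r[of ?w] in \<open>auto simp: psd_def intro: order_trans\<close>)
  finally have "(norm ?w)\<^sup>2 * (norm ?w)\<^sup>2 \<le> (norm ?w)\<^sup>2 * (r * norm v)\<^sup>2"
    by (simp add: power2_eq_square mult_ac)
  then have "(norm ?w)\<^sup>2 \<le> (r * norm v)\<^sup>2"
    by (rule mult_left_le_imp_le) (use False in simp)
  moreover have "0 \<le> r * norm v"
  proof -
    have "0 \<le> r * (norm v)\<^sup>2" using H r[of v] by (meson order_trans psd_def)
    then show ?thesis by (cases "v = 0") (auto simp: zero_le_mult_iff)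
  qed
  ultimately show ?thesis by (rule power2_le_imp_le)
qed

text \<open>The bound \<open>X >= c I\<close>: positive definiteness with a constant, which survives
  adding psd matrices. One \<open>c\<close> serves for all \<open>C + Y\<close> and fixes the
  Lipschitz constant of the square root.\<close>

definition coercive :: "real \<Rightarrow> real ^ 'd ^ 'd \<Rightarrow> bool" where
  "coercive c X \<longleftrightarrow> symmetric_matrix X \<and> (\<forall>v. c * (norm v)\<^sup>2 \<le> v \<bullet> (X *v v))"

text \<open>The constant is the minimum of the quadratic form over the compact unit sphere.\<close>

lemma pos_def_coercive:
  fixes C :: "real ^ 'd ^ 'd"
  assumes C: "pos_def C"
  obtains c where "0 < c" "coercive c C"
proof -
  have "continuous_on (sphere 0 1) (\<lambda>v. v \<bullet> (C *v v))"
    unfolding inner_vec_def matrix_vector_mult_def by (intro continuous_intros)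
  moreover have "axis undefined 1 \<in> sphere (0 :: real ^ 'd) 1" by simp
  ultimately obtain x where x: "x \<in> sphere 0 1" "\<And>y. y \<in> sphere 0 1 \<Longrightarrow> x \<bullet> (C *v x) \<le> y \<bullet> (C *v y)"
    using continuous_attains_inf[OF compact_sphere, of 0 1 "\<lambda>v. v \<bullet> (C *v v)"] by blast
  let ?c = "x \<bullet> (C *v x)"
  have "?c * (norm v)\<^sup>2 \<le> v \<bullet> (C *v v)" for v
  proof (cases "v = 0")
    case False
    have "?c \<le> (v /\<^sub>R norm v) \<bullet> (C *v (v /\<^sub>R norm v))" by (rule x(2)) (use False in simp)
    also have "\<dots> = v \<bullet> (C *v v) / (norm v)\<^sup>2"
      by (simp add: matrix_vector_mult_scaleR power2_eq_square divide_simps)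
    finally show ?thesis using False by (simp add: field_simps)
  qed simp
  moreover have "x \<noteq> 0" using x(1) by auto
  then have "0 < ?c" using C by (simp add: pos_def_def)
  ultimately show ?thesis using C by (intro that[of ?c]) (auto simp: coercive_def pos_def_def)
qed

lemma coercive_add_psd: "coercive c X \<Longrightarrow> psd Y \<Longrightarrow> coercive c (X + Y)"
  unfolding coercive_def psd_def symmetric_matrix_def
  by (auto simp: transpose_add matrix_vector_mult_add_rdistrib inner_add_right intro: add_increasing2)

lemma coercive_psd: "0 \<le> c \<Longrightarrow> coercive c X \<Longrightarrow> psd X"
  unfolding coercive_def psd_def by (meson mult_nonneg_nonneg order_trans zero_le_power2)

text \<open>The right side is the trace of \<open>D^T S D\<close>, that is, the form of
  \<open>S\<close> summed over the columns of \<open>D\<close>.\<close>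

lemma coercive_inner:
  assumes "coercive c S"
  shows "c * (norm D)\<^sup>2 \<le> D \<bullet> (S ** D)"
proof -
  have "c * (norm D)\<^sup>2 = (\<Sum>j\<in>UNIV. c * (norm (column j D))\<^sup>2)"
    by (simp add: norm_matrix_columns sum_distrib_left)
  also have "\<dots> \<le> (\<Sum>j\<in>UNIV. column j D \<bullet> (S *v column j D))"
    by (intro sum_mono) (use assms in \<open>auto simp: coercive_def\<close>)
  also have "\<dots> = D \<bullet> (S ** D)" by (simp add: inner_matrix_columns column_matrix_mult)
  finally show ?thesis .
qed

text \<open>With \<open>D = S - T\<close> one has \<open>S\<^sup>2 - T\<^sup>2 = S D + D T\<close>, hence
  \<open>tr (D (S\<^sup>2 - T\<^sup>2)) = tr (D S D) + tr (D T D)\<close>.\<close>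

lemma coercive_square_diff:
  fixes S T :: "real ^ 'd ^ 'd"
  assumes S: "coercive c S" and T: "psd T"
  shows "c * norm (S - T) \<le> norm (S ** S - T ** T)"
proof (cases "S = T")
  case False
  let ?D = "S - T"
  have sym: "transpose S = S" "transpose T = T" using S T by (auto simp: coercive_def psd_def symmetric_matrix_def)
  have "S ** S - T ** T = S ** ?D + ?D ** T"
    by (simp add: matrix_mult.diff_left matrix_mult.diff_right)
  then have "?D \<bullet> (S ** S - T ** T) = ?D \<bullet> (S ** ?D) + ?D \<bullet> (?D ** T)"
    by (simp add: inner_add_right)
  also have "?D \<bullet> (?D ** T) = ?D \<bullet> (T ** ?D)"
    using inner_transpose[of ?D "?D ** T"] by (simp add: matrix_transpose_mul transpose_diff sym)
  also have "c * (norm ?D)\<^sup>2 \<le> ?D \<bullet> (S ** ?D) + ?D \<bullet> (T ** ?D)"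
    using coercive_inner[OF S, of ?D] coercive_inner[of 0 T ?D] T
    by (simp add: coercive_def psd_def)
  finally have "c * (norm ?D)\<^sup>2 \<le> ?D \<bullet> (S ** S - T ** T)" by simp
  also have "\<dots> \<le> norm ?D * norm (S ** S - T ** T)" by (rule norm_cauchy_schwarz)
  finally show ?thesis using False by (simp add: power2_eq_square)
qed simp

text \<open>After scaling, \<open>X = I - H\<close> with \<open>\<parallel>H\<parallel> \<le> 1 - \<delta>\<close>, and \<open>I - R\<close> is a square root of \<open>X\<close> if and only if \<open>R\<close>
  is a fixed point of the contraction \<open>R \<mapsto> (H + R\<^sup>2) / 2\<close> of the ball of radius \<open>1 - sqrt \<delta>\<close>.\<close>

lemma ex_square_root:
  fixes X :: "real ^ 'd ^ 'd"
  assumes c: "0 < c" and X: "coercive c X"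
  shows "\<exists>S. coercive (sqrt c) S \<and> S ** S = X"
proof -
  \<comment> \<open>\<open>a\<close> dominates the form of \<open>X\<close>, which makes
    \<open>H\<close> psd, and \<open>a >= c > 0\<close> puts \<open>\<delta>\<close> into
    \<open>(0, 1]\<close>.\<close>
  define a where "a = norm X + c"
  have a: "0 < a" "c \<le> a" using c by (auto simp: a_def add_nonneg_pos)
  define H where "H = mat 1 - (1 / a) *\<^sub>R X"
  define \<delta> where "\<delta> = c / a"
  have \<delta>: "0 < \<delta>" "\<delta> \<le> 1" using a c by (auto simp: \<delta>_def)
  have symX: "transpose X = X" using X by (simp add: coercive_def symmetric_matrix_def)
  have Hv: "v \<bullet> (H *v v) = (norm v)\<^sup>2 - v \<bullet> (X *v v) / a" for v
    by (simp add: H_def matrix_vector_mult_diff_rdistrib inner_diff_right power2_norm_eq_inner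
        scaleR_matrix_vector_assoc[symmetric])
  have "v \<bullet> (X *v v) \<le> a * (norm v)\<^sup>2" for v
  proof -
    have "v \<bullet> (X *v v) \<le> norm v * (norm X * norm v)"
      using norm_cauchy_schwarz[of v "X *v v"] norm_matrix_vector_mult_le[of X v]
      by (meson mult_left_mono norm_ge_zero order_trans)
    also have "\<dots> \<le> a * (norm v)\<^sup>2" using c by (simp add: a_def power2_eq_square algebra_simps)
    finally show ?thesis .
  qed
  then have psdH: "psd H"
    using a by (simp add: psd_def Hv field_simps) (simp add: symmetric_matrix_def H_def transpose_diff transpose_scalar symX)
  have "v \<bullet> (H *v v) \<le> (1 - \<delta>) * (norm v)\<^sup>2" for v
  proof -
    have "c * (norm v)\<^sup>2 \<le> v \<bullet> (X *v v)" using X by (simp add: coercive_def)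
    then show ?thesis using a by (simp add: Hv \<delta>_def field_simps)
  qed
  then have normH: "norm (H *v v) \<le> (1 - \<delta>) * norm v" for v by (rule psd_norm_le[OF psdH])
  \<comment> \<open>\<open>\<rho>\<close> is the smaller solution of
    \<open>(1 - \<delta>) + \<rho>^2 = 2 \<rho>\<close>, so the ball of this radius is mapped into
    itself; it is also the contraction constant.\<close>
  define \<rho> where "\<rho> = 1 - sqrt \<delta>"
  have \<rho>: "0 \<le> \<rho>" "\<rho> < 1" "(1 - \<delta>) + \<rho> * \<rho> = 2 * \<rho>"
    using \<delta> by (auto simp: \<rho>_def algebra_simps)
  \<comment> \<open>The radius is measured in the operator norm, the contraction in the Frobenius
    norm.\<close>
  define \<R> where "\<R> = {R :: real ^ 'd ^ 'd. transpose R = R} \<inter> (\<Inter>v. {R. norm (R *v v) \<le> \<rho> * norm v})"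
  define \<Phi> where "\<Phi> R = (1 / 2) *\<^sub>R (H + R ** R)" for R
  have "closed \<R>"
  proof -
    have "closed {R :: real ^ 'd ^ 'd. transpose R = R}"
      by (intro closed_Collect_eq linear_continuous_on bounded_linear_transpose continuous_on_id)
    moreover have "closed {R :: real ^ 'd ^ 'd. norm (R *v v) \<le> \<rho> * norm v}" for v
      unfolding matrix_vector_mult_def by (intro closed_Collect_le continuous_intros)
    ultimately show ?thesis by (auto simp: \<R>_def intro!: closed_Int closed_INT)
  qed
  note closed = this
  have "0 \<in> \<R>" using \<rho> by (simp add: \<R>_def) (simp add: transpose_def vec_eq_iff)
  then have "\<R> \<noteq> {}" by blast
  moreover have "\<Phi> ` \<R> \<subseteq> \<R>"
  proof (rule image_subsetI)
    fix R assume R: "R \<in> \<R>"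
    then have R1: "transpose R = R" "\<And>v. norm (R *v v) \<le> \<rho> * norm v" by (auto simp: \<R>_def)
    have "norm (\<Phi> R *v v) \<le> \<rho> * norm v" for v
    proof -
      have "norm (R *v (R *v v)) \<le> \<rho> * (\<rho> * norm v)"
        using R1(2)[of "R *v v"] R1(2)[of v] \<rho> by (meson mult_left_mono order_trans)
      then have "norm (H *v v + R *v (R *v v)) \<le> (1 - \<delta>) * norm v + \<rho> * (\<rho> * norm v)"
        using normH[of v] by (meson add_mono norm_triangle_ineq order_trans)
      also have "\<dots> = ((1 - \<delta>) + \<rho> * \<rho>) * norm v" by (simp add: algebra_simps)
      finally show ?thesis
        by (simp add: \<rho> \<Phi>_def scaleR_matrix_vector_assoc[symmetric] matrix_vector_mult_add_rdistrib matrix_vector_mul_assoc)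
    qed
    moreover have "transpose (\<Phi> R) = \<Phi> R"
      using R1 psdH by (simp add: \<Phi>_def transpose_scalar transpose_add matrix_transpose_mul psd_def symmetric_matrix_def)
    ultimately show "\<Phi> R \<in> \<R>" by (simp add: \<R>_def)
  qed
  moreover have "dist (\<Phi> R) (\<Phi> R') \<le> \<rho> * dist R R'" if "R \<in> \<R>" "R' \<in> \<R>" for R R'
  proof -
    have R: "transpose R = R" "\<And>v. norm (R *v v) \<le> \<rho> * norm v" "transpose R' = R'" "\<And>v. norm (R' *v v) \<le> \<rho> * norm v"
      using that by (auto simp: \<R>_def)
    \<comment> \<open>\<open>norm_matrix_mult_bound\<close> controls a left factor; transposition
      moves the symmetric \<open>R'\<close> to the left.\<close>
    have "norm ((R - R') ** R') = norm (R' ** transpose (R - R'))"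
      using norm_transpose[of "(R - R') ** R'"] by (simp add: matrix_transpose_mul R)
    also have "\<dots> \<le> \<rho> * norm (R - R')" using norm_matrix_mult_bound[OF \<rho>(1) R(4), of "transpose (R - R')"] by simp
    finally have 1: "norm ((R - R') ** R') \<le> \<rho> * norm (R - R')" .
    have "norm (R ** (R - R') + (R - R') ** R') \<le> \<rho> * norm (R - R') + \<rho> * norm (R - R')"
      by (intro norm_triangle_mono 1 norm_matrix_mult_bound \<rho> R)
    moreover have "\<Phi> R - \<Phi> R' = (1 / 2) *\<^sub>R (R ** (R - R') + (R - R') ** R')"
      by (simp add: \<Phi>_def matrix_mult.diff_left matrix_mult.diff_right algebra_simps)
    ultimately show ?thesis by (simp add: dist_norm)
  qed
  ultimately obtain R where R: "R \<in> \<R>" "\<Phi> R = R"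
    using Banach_fix[OF closed[folded complete_eq_closed], of \<rho> \<Phi>] \<rho> by blast
  define S where "S = sqrt a *\<^sub>R (mat 1 - R)"
  have "2 *\<^sub>R R = 2 *\<^sub>R \<Phi> R" by (simp only: R(2))
  also have "\<dots> = H + R ** R" by (simp add: \<Phi>_def)
  finally have "2 *\<^sub>R R = H + R ** R" .
  then have "mat 1 - 2 *\<^sub>R R + R ** R = (1 / a) *\<^sub>R X" by (simp add: H_def)
  moreover have "S ** S = a *\<^sub>R (mat 1 - 2 *\<^sub>R R + R ** R)"
    using a by (simp add: S_def matrix_mult.diff_left matrix_mult.diff_right matrix_mult_scaleR_left matrix_mult_scaleR_right
        algebra_simps scaleR_2)
  ultimately have "S ** S = X" using a by simp
  moreover have "coercive (sqrt c) S"
  proof -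
    have "sqrt c * (norm v)\<^sup>2 \<le> v \<bullet> (S *v v)" for v
    proof -
      have "v \<bullet> (R *v v) \<le> norm v * (\<rho> * norm v)"
        using norm_cauchy_schwarz[of v "R *v v"] R(1) by (auto simp: \<R>_def intro: order_trans[OF _ mult_left_mono])
      then have "(1 - \<rho>) * (norm v)\<^sup>2 \<le> v \<bullet> ((mat 1 - R) *v v)"
        by (simp add: matrix_vector_mult_diff_rdistrib inner_diff_right power2_norm_eq_inner[symmetric] power2_eq_square algebra_simps)
      then have "sqrt a * ((1 - \<rho>) * (norm v)\<^sup>2) \<le> sqrt a * (v \<bullet> ((mat 1 - R) *v v))"
        using a by (intro mult_left_mono) auto
      moreover have "sqrt a * (1 - \<rho>) = sqrt c" using a c by (simp add: \<rho>_def \<delta>_def real_sqrt_divide)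
      ultimately show ?thesis by (simp add: S_def scaleR_matrix_vector_assoc[symmetric] mult.assoc[symmetric])
    qed
    moreover have "transpose S = S" using R(1) by (simp add: S_def \<R>_def transpose_scalar transpose_diff)
    ultimately show ?thesis by (simp add: coercive_def symmetric_matrix_def)
  qed
  ultimately show ?thesis by blast
qed

text \<open>Since \<open>coercive_square_diff\<close> asks the second root only to be psd, the
  coercive root is the only psd root, and the description operator in \<open>psd_sqrt\<close>
  selects it.\<close>

lemma psd_sqrt_coercive:
  assumes c: "0 < c" and X: "coercive c X"
  shows "coercive (sqrt c) (psd_sqrt X)" "psd_sqrt X ** psd_sqrt X = X"
proof -
  obtain S where S: "coercive (sqrt c) S" "S ** S = X" using ex_square_root[OF assms] by blast
  have "T = S" if T: "psd T \<and> T ** T = X" for T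
  proof -
    have "sqrt c * norm (S - T) \<le> norm (S ** S - T ** T)"
      by (rule coercive_square_diff[OF S(1)]) (use T in simp)
    then show ?thesis using T S(2) c by (simp add: mult_le_0_iff)
  qed
  moreover have "psd S" using coercive_psd[OF _ S(1)] c by simp
  ultimately have "psd_sqrt X = S"
    unfolding psd_sqrt_def by (intro the_equality conjI S(2))
  with S show "coercive (sqrt c) (psd_sqrt X)" "psd_sqrt X ** psd_sqrt X = X" by auto
qed

lemma transpose_psd_sqrt: "0 < c \<Longrightarrow> coercive c X \<Longrightarrow> transpose (psd_sqrt X) = psd_sqrt X"
  using psd_sqrt_coercive(1) by (auto simp: coercive_def symmetric_matrix_def)

lemma psd_sqrt_lipschitz:
  assumes c: "0 < c" "coercive c X" "coercive c Y"
  shows "norm (psd_sqrt X - psd_sqrt Y) \<le> norm (X - Y) / sqrt c"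
proof -
  have "sqrt c * norm (psd_sqrt X - psd_sqrt Y) \<le> norm (X - Y)"
    using coercive_square_diff[OF psd_sqrt_coercive(1)[OF c(1,2)] coercive_psd[OF _ psd_sqrt_coercive(1)[OF c(1,3)]]] c
    by (simp add: psd_sqrt_coercive(2))
  then show ?thesis using c by (simp add: field_simps)
qed

text \<open>For a symmetric root \<open>S\<close> of \<open>X\<close> one has
  \<open>(norm S)^2 = tr (S S) = tr X\<close>, which is linear in \<open>X\<close>. This is the
  source of the linear growth of the jump coefficient.\<close>

lemma norm_psd_sqrt:
  fixes X :: "real ^ 'd ^ 'd"
  assumes c: "0 < c" "coercive c X"
  shows "(norm (psd_sqrt X))\<^sup>2 \<le> norm X * norm (mat 1 :: real ^ 'd ^ 'd)"
proof -
  have "(norm (psd_sqrt X))\<^sup>2 = (psd_sqrt X ** mat 1) \<bullet> psd_sqrt X" by (simp add: power2_norm_eq_inner)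
  also have "\<dots> = mat 1 \<bullet> X"
    by (simp add: matrix_mult_inner_left transpose_psd_sqrt[OF c] psd_sqrt_coercive(2)[OF c] del: matrix_mul_rid)
  also have "\<dots> \<le> norm X * norm (mat 1 :: real ^ 'd ^ 'd)"
    using norm_cauchy_schwarz[of "mat 1" X] by (simp add: mult.commute)
  finally show ?thesis .
qed

subsection \<open>The matrix exponential\<close>

text \<open>Inner products with a fixed vector reduce the claim to termwise differentiation of a
  real power series.\<close>

lemma power_series_has_vector_derivative:
  fixes a :: "nat \<Rightarrow> 'b::euclidean_space"
  assumes a: "\<And>y. summable (\<lambda>n. norm (a n) * \<bar>y\<bar> ^ n)"
  shows "((\<lambda>t. \<Sum>n. t ^ n *\<^sub>R a n) has_vector_derivative (\<Sum>n. t ^ n *\<^sub>R (real (Suc n) *\<^sub>R a (Suc n)))) (at t)"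
proof -
  have sum: "summable (\<lambda>n. t ^ n *\<^sub>R a n)" for t :: real
    by (rule summable_norm_cancel) (use a[of t] in \<open>simp add: power_abs mult.commute\<close>)
  have sum': "summable (\<lambda>n. (a n \<bullet> b) * y ^ n)" for b y
    using bounded_linear.summable[OF bounded_linear_inner_left sum[of y], of b] by (simp add: mult.commute)
  have D: "DERIV (\<lambda>t. \<Sum>n. (a n \<bullet> b) * t ^ n) t :> (\<Sum>n. diffs (\<lambda>n. a n \<bullet> b) n * t ^ n)" for b
    by (rule termdiffs_strong_converges_everywhere[OF sum'])
  have nsum: "summable (\<lambda>n. norm (diffs (\<lambda>n. norm (a n)) n * \<bar>t\<bar> ^ n))"
  proof -
    have "summable (\<lambda>n. diffs (\<lambda>n. norm (a n)) n * \<bar>t\<bar> ^ n)"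
      by (rule termdiff_converges_all) (rule summable_norm_cancel, use a in \<open>simp add: power_abs abs_mult\<close>)
    then show ?thesis by (simp add: diffs_def abs_mult)
  qed
  have sumD: "summable (\<lambda>n. t ^ n *\<^sub>R (real (Suc n) *\<^sub>R a (Suc n)))"
    by (rule summable_norm_cancel) (use nsum in \<open>simp add: diffs_def power_abs abs_mult mult_ac\<close>)
  have "((\<lambda>t. (\<Sum>n. t ^ n *\<^sub>R a n) \<bullet> b) has_derivative (\<lambda>x. (x *\<^sub>R (\<Sum>n. t ^ n *\<^sub>R (real (Suc n) *\<^sub>R a (Suc n)))) \<bullet> b)) (at t)" for b
  proof -
    have 1: "(\<lambda>t. (\<Sum>n. t ^ n *\<^sub>R a n) \<bullet> b) = (\<lambda>t. \<Sum>n. (a n \<bullet> b) * t ^ n)"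
      using bounded_linear.suminf[OF bounded_linear_inner_left[of b] sum] by (simp add: mult.commute)
    have 2: "(\<Sum>n. t ^ n *\<^sub>R (real (Suc n) *\<^sub>R a (Suc n))) \<bullet> b = (\<Sum>n. diffs (\<lambda>n. a n \<bullet> b) n * t ^ n)"
      using bounded_linear.suminf[OF bounded_linear_inner_left[of b] sumD] by (simp add: diffs_def mult_ac)
    show ?thesis
      using D[of b] unfolding 1 has_field_derivative_def inner_scaleR_left 2 by (simp add: mult_commute_abs)
  qed
  then show ?thesis
    unfolding has_vector_derivative_def by (subst has_derivative_componentwise_within) auto
qed

lemma norm_matrix_power_le:
  fixes B :: "real ^ 'd ^ 'd"
  shows "norm (((**) B ^^ n) (mat 1)) \<le> norm B ^ n * norm (mat 1 :: real ^ 'd ^ 'd)"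
proof (induction n)
  case (Suc n)
  have "norm (B ** ((**) B ^^ n) (mat 1)) \<le> norm B * norm (((**) B ^^ n) (mat 1))" by (rule norm_matrix_mult_le)
  also have "\<dots> \<le> norm B * (norm B ^ n * norm (mat 1 :: real ^ 'd ^ 'd))" by (intro mult_left_mono Suc) simp
  finally show ?case by (simp add: mult_ac)
qed simp

lemma matrix_power_scaleR: "((**) (t *\<^sub>R B) ^^ n) (mat 1) = t ^ n *\<^sub>R ((**) B ^^ n) (mat 1)"
  for B :: "real ^ 'd ^ 'd"
  by (induction n) (simp_all add: matrix_mult_scaleR_left matrix_mult_scaleR_right)

lemma matrix_power_commute: "B ** ((**) B ^^ n) (mat 1) = ((**) B ^^ n) (mat 1) ** B"
  for B :: "real ^ 'd ^ 'd"
proof (induction n)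
  case (Suc n)
  have "B ** (B ** ((**) B ^^ n) (mat 1)) = B ** (((**) B ^^ n) (mat 1) ** B)" by (simp only: Suc)
  then show ?case by (simp add: matrix_mul_assoc)
qed simp

lemma transpose_matrix_power: "transpose (((**) B ^^ n) (mat 1)) = ((**) (transpose B) ^^ n) (mat 1)"
  for B :: "real ^ 'd ^ 'd"
  by (induction n) (simp_all add: matrix_transpose_mul matrix_power_commute)

lemma matrix_exp_summable:
  fixes B :: "real ^ 'd ^ 'd"
  shows "summable (\<lambda>n. norm ((1 / fact n) *\<^sub>R ((**) B ^^ n) (mat 1)) * \<bar>y\<bar> ^ n)"
proof (rule summable_comparison_test')
  let ?I = "norm (mat 1 :: real ^ 'd ^ 'd)"
  show "summable (\<lambda>n. ?I * (inverse (fact n) * (norm B * \<bar>y\<bar>) ^ n))"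
    by (intro summable_mult summable_exp)
  show "norm (norm ((1 / fact n) *\<^sub>R ((**) B ^^ n) (mat 1)) * \<bar>y\<bar> ^ n) \<le> ?I * (inverse (fact n) * (norm B * \<bar>y\<bar>) ^ n)" for n
  proof -
    have "norm ((1 / fact n) *\<^sub>R ((**) B ^^ n) (mat 1)) * \<bar>y\<bar> ^ n = norm (((**) B ^^ n) (mat 1)) * (inverse (fact n) * \<bar>y\<bar> ^ n)"
      by (simp add: divide_inverse)
    also have "\<dots> \<le> (norm B ^ n * ?I) * (inverse (fact n) * \<bar>y\<bar> ^ n)"
      by (intro mult_right_mono norm_matrix_power_le) simp
    finally show ?thesis by (simp add: power_mult_distrib mult_ac abs_mult power_abs)
  qed
qed

definition exp_coeff :: "real ^ 'd ^ 'd \<Rightarrow> nat \<Rightarrow> real ^ 'd ^ 'd" where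
  "exp_coeff B n = (1 / fact n) *\<^sub>R ((**) B ^^ n) (mat 1)"

lemma exp_coeff_Suc: "real (Suc n) *\<^sub>R exp_coeff B (Suc n) = B ** exp_coeff B n"
proof -
  have "real (Suc n) * (1 / fact (Suc n)) = 1 / fact n" by (simp add: field_simps del: of_nat_Suc)
  then show ?thesis by (simp add: exp_coeff_def matrix_mult_scaleR_right del: of_nat_Suc)
qed

lemma exp_coeff_commute: "B ** exp_coeff B n = exp_coeff B n ** B"
  by (simp add: exp_coeff_def matrix_mult_scaleR_left matrix_mult_scaleR_right matrix_power_commute)

lemma transpose_exp_coeff: "transpose (exp_coeff B n) = exp_coeff (transpose B) n"
  by (simp add: exp_coeff_def transpose_scalar transpose_matrix_power)

lemma matrix_exp_scaleR: "matrix_exp (t *\<^sub>R B) = (\<Sum>n. t ^ n *\<^sub>R exp_coeff B n)"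
  by (simp add: matrix_exp_def matrix_power_scaleR exp_coeff_def)

lemma matrix_exp_summable': "summable (\<lambda>n. t ^ n *\<^sub>R exp_coeff B n)"
  by (rule summable_norm_cancel) (use matrix_exp_summable[of B t] in \<open>simp add: exp_coeff_def power_abs mult_ac\<close>)

lemma matrix_exp_derivative:
  "((\<lambda>t. matrix_exp (t *\<^sub>R B)) has_vector_derivative B ** matrix_exp (t *\<^sub>R B)) (at t)"
proof -
  have "(\<Sum>n. t ^ n *\<^sub>R (real (Suc n) *\<^sub>R exp_coeff B (Suc n))) = (\<Sum>n. B ** (t ^ n *\<^sub>R exp_coeff B n))"
    by (simp only: exp_coeff_Suc matrix_mult_scaleR_right)
  also have "\<dots> = B ** matrix_exp (t *\<^sub>R B)"
    unfolding matrix_exp_scaleR by (rule bounded_linear.suminf[OF matrix_mult.bounded_linear_right matrix_exp_summable', symmetric])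
  finally show ?thesis
    using power_series_has_vector_derivative[of "exp_coeff B" t, OF matrix_exp_summable[of B, folded exp_coeff_def]]
    by (simp only: matrix_exp_scaleR)
qed

lemma matrix_exp_0 [simp]: "matrix_exp (0 :: real ^ 'd ^ 'd) = mat 1"
proof -
  have "matrix_exp (0 *\<^sub>R 0 :: real ^ 'd ^ 'd) = (\<Sum>n\<in>{0}. 0 ^ n *\<^sub>R exp_coeff (0 :: real ^ 'd ^ 'd) n)"
    unfolding matrix_exp_scaleR by (rule suminf_finite) auto
  then show ?thesis by (simp add: exp_coeff_def)
qed

lemma matrix_exp_commute: "B ** matrix_exp (t *\<^sub>R B) = matrix_exp (t *\<^sub>R B) ** B"
  unfolding matrix_exp_scaleR
    bounded_linear.suminf[OF matrix_mult.bounded_linear_right matrix_exp_summable']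
    bounded_linear.suminf[OF matrix_mult.bounded_linear_left matrix_exp_summable']
  by (simp only: matrix_mult_scaleR_left matrix_mult_scaleR_right exp_coeff_commute)

lemma transpose_matrix_exp: "transpose (matrix_exp (t *\<^sub>R B)) = matrix_exp (t *\<^sub>R transpose B)"
  unfolding matrix_exp_scaleR bounded_linear.suminf[OF bounded_linear_transpose matrix_exp_summable']
  by (simp only: transpose_scalar transpose_exp_coeff)

text \<open>\<open>B\<close> commutes with its exponential, so the product has derivative zero and
  keeps its value at \<open>t = 0\<close>.\<close>

lemma matrix_exp_inverse: "matrix_exp (t *\<^sub>R B) ** matrix_exp ((- t) *\<^sub>R B) = mat 1" for B :: "real ^ 'd ^ 'd"
proof -
  let ?f = "\<lambda>t. matrix_exp (t *\<^sub>R B) ** matrix_exp ((- t) *\<^sub>R B)"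
  have 1: "((\<lambda>t. matrix_exp ((- t) *\<^sub>R B)) has_vector_derivative - (B ** matrix_exp ((- t) *\<^sub>R B))) (at t)" for t
  proof -
    have "(uminus has_vector_derivative (-1)) (at t)" by (auto intro!: derivative_eq_intros)
    from vector_diff_chain_at[OF this matrix_exp_derivative]
    show ?thesis by (simp add: o_def)
  qed
  have "(?f has_vector_derivative 0) (at t within UNIV)" for t
  proof -
    have "(?f has_vector_derivative (matrix_exp (t *\<^sub>R B) ** - (B ** matrix_exp ((- t) *\<^sub>R B)) + (B ** matrix_exp (t *\<^sub>R B)) ** matrix_exp ((- t) *\<^sub>R B))) (at t)"
      by (rule matrix_mult.has_vector_derivative[OF matrix_exp_derivative 1])
    then show ?thesis
      by (simp add: matrix_mult.minus_right matrix_mul_assoc matrix_exp_commute)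
  qed
  then obtain c where c: "\<And>t. ?f t = c"
    using has_vector_derivative_zero_constant[of UNIV ?f] by auto
  from c[of t] c[of 0] show ?thesis by simp
qed

text \<open>\<open>f\<close> is the pointwise limit of step functions that take the value of
  \<open>g\<close> at the left end of each grid cell. With \<open>g\<close> cadlag, \<open>f\<close>
  is its path of left limits.\<close>

lemma borel_measurable_left_limits:
  fixes f g :: "real \<Rightarrow> 'b::{real_normed_vector, second_countable_topology}"
  assumes g: "\<And>s. 0 < s \<Longrightarrow> s \<le> t \<Longrightarrow> (g \<longlongrightarrow> f s) (at_left s)"
  shows "(\<lambda>s. indicator {0<..t} s *\<^sub>R f s) \<in> borel_measurable borel"
proof (rule borel_measurable_LIMSEQ_metric)
  fix n
  have "grid_index t n \<in> borel \<rightarrow>\<^sub>M count_space UNIV"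
    unfolding grid_index_def by measurable
  then have [measurable]: "(\<lambda>s. g (grid_left t n (grid_index t n s))) \<in> borel_measurable borel"
    by (rule measurable_compose) simp
  show "(\<lambda>s. indicator {0<..t} s *\<^sub>R g (grid_left t n (grid_index t n s))) \<in> borel_measurable borel"
    by measurable
next
  fix s :: real
  show "(\<lambda>n. indicator {0<..t} s *\<^sub>R g (grid_left t n (grid_index t n s))) \<longlonglongrightarrow> indicator {0<..t} s *\<^sub>R f s"
  proof (cases "s \<in> {0<..t}")
    case True
    then have "0 < s" "s \<le> t" by auto
    then have "(\<lambda>n. g (grid_left t n (grid_index t n s))) \<longlonglongrightarrow> f s"
      by (intro filterlim_compose[OF g filterlim_grid_left])
    then show ?thesis using True by simp
  qed simp
qed

lemma set_integrable_left_limits: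
  fixes f g :: "real \<Rightarrow> 'b::euclidean_space"
  assumes g: "\<And>s. 0 < s \<Longrightarrow> s \<le> t \<Longrightarrow> (g \<longlongrightarrow> f s) (at_left s)"
    and K: "\<And>s. s \<in> {0..t} \<Longrightarrow> norm (f s) \<le> K"
  shows "set_integrable lborel {0..t} f"
proof -
  have m: "(\<lambda>s. indicator {0<..t} s *\<^sub>R f s) \<in> borel_measurable borel" by (rule borel_measurable_left_limits[OF g])
  \<comment> \<open>The representation by left limits says nothing at time \<open>0\<close>, which
    is added as a single point.\<close>
  have "(\<lambda>s. indicator {0..t} s *\<^sub>R f s) = (\<lambda>s. indicator {0<..t} s *\<^sub>R f s + indicator ({0..t} \<inter> {0}) s *\<^sub>R f 0)"
    by (auto simp: fun_eq_iff indicator_def)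
  also have "\<dots> \<in> borel_measurable borel" using m by measurable
  finally have m: "(\<lambda>s. indicator {0..t} s *\<^sub>R f s) \<in> borel_measurable borel" .
  show ?thesis unfolding set_integrable_def
    by (rule integrableI_bounded_set[where A = "{0..t}" and B = K])
       (use m K in \<open>auto simp: emeasure_lborel_Icc_eq indicator_def\<close>)
qed

text \<open>The shape of the bound records that the integrand vanishes up to \<open>a\<close>, as
  for the difference of two solutions that agree before \<open>a\<close>.\<close>

lemma norm_set_integral_le:
  fixes f :: "real \<Rightarrow> 'b::{banach, second_countable_topology}"
  assumes f: "set_integrable lborel {0..t} f" and a: "0 \<le> a" "a \<le> t" and D: "0 \<le> D"
    and le: "\<And>s. s \<in> {0..t} \<Longrightarrow> norm (f s) \<le> (if a < s then D else 0)"
  shows "norm (LBINT s:{0..t}. f s) \<le> D * (t - a)"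
proof -
  have "norm (LBINT s:{0..t}. f s) \<le> (LINT s|lborel. norm (indicator {0..t} s *\<^sub>R f s))"
    unfolding set_lebesgue_integral_def by (rule integral_norm_bound)
  also have "\<dots> \<le> (LINT s|lborel. indicator {a<..t} s *\<^sub>R D)"
  proof (rule integral_mono)
    show "integrable lborel (\<lambda>s. norm (indicator {0..t} s *\<^sub>R f s))"
      using f unfolding set_integrable_def by (rule integrable_norm)
    show "integrable lborel (\<lambda>s. indicator {a<..t} s *\<^sub>R D)"
      by (rule integrableI_bounded_set_indicator[where B = D]) (use D a in \<open>auto simp: emeasure_lborel_Ioc\<close>)
    show "norm (indicator {0..t} s *\<^sub>R f s) \<le> indicator {a<..t} s *\<^sub>R D" for s
      using le[of s] a D by (auto simp: indicator_def split: if_splits)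
  qed
  also have "\<dots> = D * (t - a)" using a by simp
  finally show ?thesis .
qed

subsection \<open>The coefficients of the equation\<close>

text \<open>The value at time \<open>t\<close> of the solution of \<open>Z' = drift B Z\<close> with
  \<open>Z 0 = X\<close>. Being a congruence, it maps the psd cone into itself.\<close>

definition flow :: "real ^ 'd ^ 'd \<Rightarrow> real \<Rightarrow> real ^ 'd ^ 'd \<Rightarrow> real ^ 'd ^ 'd" where
  "flow B t X = matrix_exp (t *\<^sub>R B) ** X ** transpose (matrix_exp (t *\<^sub>R B))"

definition drift :: "real ^ 'd ^ 'd \<Rightarrow> real ^ 'd ^ 'd \<Rightarrow> real ^ 'd ^ 'd" where
  "drift B X = B ** X + X ** transpose B"

lemma bounded_linear_drift: "bounded_linear (drift B)"
  unfolding drift_def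
  by (intro bounded_linear_add matrix_mult.bounded_linear_right matrix_mult.bounded_linear_left)

lemma norm_drift_le: "norm (drift B X) \<le> 2 * norm B * norm X"
  unfolding drift_def
  using norm_triangle_mono[OF norm_matrix_mult_le[of B X] norm_matrix_mult_le[of X "transpose B"]] by simp

lemma bounded_linear_flow: "bounded_linear (flow B t)"
  unfolding flow_def
  by (intro bounded_linear_compose[OF matrix_mult.bounded_linear_left matrix_mult.bounded_linear_right])

lemmas flow_add = linear_add[OF bounded_linear.linear[OF bounded_linear_flow]]
  and flow_diff = linear_diff[OF bounded_linear.linear[OF bounded_linear_flow]]

lemma flow_0 [simp]: "flow B 0 X = X"
  by (simp add: flow_def)

lemma flow_inverse: "flow B t (flow B (- t) X) = X"
proof -
  let ?E = "\<lambda>t. matrix_exp (t *\<^sub>R B)"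
  have "flow B t (flow B (- t) X) = (?E t ** ?E (- t)) ** X ** transpose (?E t ** ?E (- t))"
    by (simp only: flow_def matrix_transpose_mul matrix_mul_assoc)
  then show ?thesis unfolding matrix_exp_inverse by simp
qed

lemma flow_derivative: "((\<lambda>t. flow B t X) has_vector_derivative drift B (flow B t X)) (at t)"
proof -
  let ?E = "\<lambda>t. matrix_exp (t *\<^sub>R B)"
  have 1: "((\<lambda>t. ?E t ** X) has_vector_derivative (B ** ?E t) ** X) (at t)"
    by (rule bounded_linear.has_vector_derivative[OF matrix_mult.bounded_linear_left matrix_exp_derivative])
  have 2: "((\<lambda>t. transpose (?E t)) has_vector_derivative transpose (B ** ?E t)) (at t)"
    by (rule bounded_linear.has_vector_derivative[OF bounded_linear_transpose matrix_exp_derivative])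
  have "((\<lambda>t. flow B t X) has_vector_derivative (?E t ** X ** transpose (B ** ?E t) + (B ** ?E t) ** X ** transpose (?E t))) (at t)"
    unfolding flow_def by (rule matrix_mult.has_vector_derivative[OF 1 2])
  then show ?thesis by (simp add: flow_def drift_def matrix_transpose_mul matrix_mul_assoc add.commute)
qed

lemma continuous_on_matrix_exp: "continuous_on S (\<lambda>t. matrix_exp (t *\<^sub>R B))"
  by (intro continuous_at_imp_continuous_on ballI has_vector_derivative_continuous[OF matrix_exp_derivative])

lemma continuous_on_flow:
  assumes "continuous_on S f" "continuous_on S g"
  shows "continuous_on S (\<lambda>x. flow B (f x) (g x))"
proof -
  have E: "continuous_on S (\<lambda>x. matrix_exp (f x *\<^sub>R B))"
    using continuous_on_compose[OF assms(1) continuous_on_matrix_exp] by (simp add: o_def)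
  have "continuous_on S (\<lambda>x. transpose (matrix_exp (f x *\<^sub>R B)))"
    by (rule continuous_on_compose2[OF linear_continuous_on[OF bounded_linear_transpose, of UNIV] E]) simp
  then show ?thesis unfolding flow_def
    by (intro matrix_mult.continuous_on E assms)
qed

lemma psd_flow: "psd X \<Longrightarrow> psd (flow B t X)"
  unfolding flow_def by (rule psd_congruence)

text \<open>The outer factors are kept separate for the mixed terms in
  \<open>jump_coeff_lipschitz\<close>.\<close>

lemma norm_congruence_le: "norm (U ** X ** transpose V) \<le> norm U * norm V * norm X" for X :: "real ^ 'd ^ 'd"
proof -
  have "norm (U ** X ** transpose V) \<le> norm (U ** X) * norm V"
    using norm_matrix_mult_le[of "U ** X" "transpose V"] by simp
  also have "\<dots> \<le> (norm U * norm X) * norm V" by (intro mult_right_mono norm_matrix_mult_le norm_ge_zero)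
  finally show ?thesis by (simp add: mult_ac)
qed

lemma flow_bound:
  obtains M where "1 \<le> M" "\<And>s X. s \<in> {0..T} \<Longrightarrow> norm (flow B s X) \<le> M * norm X"
    "\<And>s X. s \<in> {0..T} \<Longrightarrow> norm (flow B (- s) X) \<le> M * norm X"
proof -
  have "bounded ((\<lambda>t. matrix_exp (t *\<^sub>R B)) ` {- T..T})"
    by (intro compact_imp_bounded compact_continuous_image continuous_on_matrix_exp compact_Icc)
  then obtain M where M: "0 < M" "\<And>s. s \<in> {- T..T} \<Longrightarrow> norm (matrix_exp (s *\<^sub>R B)) \<le> M"
    unfolding bounded_pos by auto
  have *: "norm (flow B s X) \<le> max 1 (M * M) * norm X" if "s \<in> {- T..T}" for s X
  proof -
    let ?E = "matrix_exp (s *\<^sub>R B)"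
    have "norm (flow B s X) \<le> (norm ?E * norm ?E) * norm X"
      unfolding flow_def by (rule norm_congruence_le)
    also have "\<dots> \<le> (M * M) * norm X" by (intro mult_right_mono mult_mono M(2) that) (use M in auto)
    also have "\<dots> \<le> max 1 (M * M) * norm X" by (intro mult_right_mono) auto
    finally show ?thesis .
  qed
  show ?thesis
    by (rule that[of "max 1 (M * M)"]) (auto intro!: *)
qed

definition jump_coeff :: "real ^ 'd ^ 'd \<Rightarrow> real ^ 'd ^ 'd \<Rightarrow> real ^ 'd ^ 'd \<Rightarrow> real ^ 'd \<Rightarrow> real ^ 'd ^ 'd" where
  "jump_coeff A C Y x = outer ((A ** psd_sqrt (C + Y)) *v x)"

text \<open>If \<open>Y\<close> solves the equation, then \<open>exp (-Bt) Y\<^sub>t exp (-B\<^sup>*t)\<close> solves the equation without drift whose jumps are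
  given by the following coefficient.\<close>

definition flow_coeff :: "real ^ 'd ^ 'd \<Rightarrow> real ^ 'd ^ 'd \<Rightarrow> real ^ 'd ^ 'd \<Rightarrow> real \<Rightarrow> real ^ 'd ^ 'd \<Rightarrow> real ^ 'd
    \<Rightarrow> real ^ 'd ^ 'd" where
  "flow_coeff A B C s z x = flow B (- s) (jump_coeff A C (flow B s z) x)"

lemma psd_jump_coeff: "psd (jump_coeff A C Y x)"
  by (simp add: jump_coeff_def psd_outer)

context
  fixes A B C :: "real ^ 'd ^ 'd" and c :: real
  assumes c: "0 < c" and C: "coercive c C"
begin

lemma coercive_C_add: "psd Y \<Longrightarrow> coercive c (C + Y)"
  by (rule coercive_add_psd[OF C])

lemma norm_jump_factor:
  assumes "psd Y"
  shows "(norm (A ** psd_sqrt (C + Y)))\<^sup>2 \<le> (norm A)\<^sup>2 * ((norm C + norm Y) * norm (mat 1 :: real ^ 'd ^ 'd))"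
proof -
  have "(norm (A ** psd_sqrt (C + Y)))\<^sup>2 \<le> (norm A * norm (psd_sqrt (C + Y)))\<^sup>2"
    by (intro power_mono norm_matrix_mult_le norm_ge_zero)
  also have "\<dots> = (norm A)\<^sup>2 * (norm (psd_sqrt (C + Y)))\<^sup>2" by (rule power_mult_distrib)
  also have "\<dots> \<le> (norm A)\<^sup>2 * (norm (C + Y) * norm (mat 1 :: real ^ 'd ^ 'd))"
    by (intro mult_left_mono norm_psd_sqrt[OF c coercive_C_add[OF assms]]) simp
  also have "\<dots> \<le> (norm A)\<^sup>2 * ((norm C + norm Y) * norm (mat 1 :: real ^ 'd ^ 'd))"
    by (intro mult_left_mono mult_right_mono norm_triangle_ineq) simp_all
  finally show ?thesis .
qed

lemma jump_coeff_growth: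
  assumes "psd Y"
  shows "norm (jump_coeff A C Y x) \<le> (norm A)\<^sup>2 * ((norm C + norm Y) * norm (mat 1 :: real ^ 'd ^ 'd)) * (norm x)\<^sup>2"
proof -
  have "norm (jump_coeff A C Y x) \<le> (norm (A ** psd_sqrt (C + Y)) * norm x)\<^sup>2"
    unfolding jump_coeff_def norm_outer by (intro power_mono norm_matrix_vector_mult_le norm_ge_zero)
  also have "\<dots> \<le> (norm A)\<^sup>2 * ((norm C + norm Y) * norm (mat 1 :: real ^ 'd ^ 'd)) * (norm x)\<^sup>2"
    unfolding power_mult_distrib by (intro mult_right_mono norm_jump_factor assms) simp
  finally show ?thesis .
qed

text \<open>With \<open>U\<close> for \<open>A\<close> times the root of \<open>C + Y\<close>, the
  coefficient is \<open>U x x^T U^T\<close>. Changing one factor \<open>U\<close> at a time gives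
  \<open>2 m k\<close>, where \<open>m\<close> bounds \<open>U\<close> on the ball and
  \<open>k\<close> is the Lipschitz constant of \<open>U\<close>.\<close>

lemma jump_coeff_lipschitz:
  obtains K where "0 \<le> K" "\<And>Y Y' x. psd Y \<Longrightarrow> psd Y' \<Longrightarrow> norm Y \<le> R \<Longrightarrow> norm Y' \<le> R \<Longrightarrow>
    norm (jump_coeff A C Y x - jump_coeff A C Y' x) \<le> K * norm (Y - Y') * (norm x)\<^sup>2"
proof -
  let ?U = "\<lambda>Y. A ** psd_sqrt (C + Y)"
  define m where "m = sqrt ((norm A)\<^sup>2 * ((norm C + \<bar>R\<bar>) * norm (mat 1 :: real ^ 'd ^ 'd)))"
  define k where "k = norm A / sqrt c"
  have m0: "0 \<le> m" "0 \<le> k" by (auto simp: m_def k_def c less_imp_le)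
  have m: "norm (?U Y) \<le> m" if "psd Y" "norm Y \<le> R" for Y
    unfolding m_def
    by (rule real_le_rsqrt, rule order_trans[OF norm_jump_factor[OF that(1)]])
       (intro mult_left_mono mult_right_mono add_left_mono, use that in auto)
  have k: "norm (?U Y - ?U Y') \<le> k * norm (Y - Y')" if "psd Y" "psd Y'" for Y Y'
  proof -
    have "norm (?U Y - ?U Y') \<le> norm A * norm (psd_sqrt (C + Y) - psd_sqrt (C + Y'))"
      unfolding matrix_mult.diff_right[symmetric] by (rule norm_matrix_mult_le)
    also have "\<dots> \<le> norm A * (norm ((C + Y) - (C + Y')) / sqrt c)"
      by (intro mult_left_mono psd_sqrt_lipschitz coercive_C_add c that) simp
    finally show ?thesis by (simp add: k_def)
  qed
  show ?thesis
  proof (rule that[of "2 * m * k"])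
    fix Y Y' :: "real ^ 'd ^ 'd" and x :: "real ^ 'd" assume Y: "psd Y" "psd Y'" "norm Y \<le> R" "norm Y' \<le> R"
    let ?X = "outer x"
    have "jump_coeff A C Y x - jump_coeff A C Y' x
        = (?U Y - ?U Y') ** ?X ** transpose (?U Y) + ?U Y' ** ?X ** transpose (?U Y - ?U Y')"
      unfolding jump_coeff_def outer_matrix_vector_mult transpose_diff matrix_mult.diff_left matrix_mult.diff_right
      by simp
    also have "norm \<dots> \<le> norm (?U Y - ?U Y') * norm (?U Y) * norm ?X + norm (?U Y') * norm (?U Y - ?U Y') * norm ?X"
      by (intro norm_triangle_mono norm_congruence_le)
    also have "\<dots> \<le> (k * norm (Y - Y')) * m * norm ?X + m * (k * norm (Y - Y')) * norm ?X"
      by (intro add_mono mult_right_mono mult_mono k m Y m0 mult_nonneg_nonneg norm_ge_zero)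
    finally show "norm (jump_coeff A C Y x - jump_coeff A C Y' x) \<le> 2 * m * k * norm (Y - Y') * (norm x)\<^sup>2"
      by (simp add: norm_outer algebra_simps)
  qed (use m0 in simp)
qed

lemma continuous_on_psd_sqrt: "continuous_on {Y. psd Y} (\<lambda>Y. psd_sqrt (C + Y))"
proof (rule lipschitz_on_continuous_on)
  show "(1 / sqrt c)-lipschitz_on {Y. psd Y} (\<lambda>Y. psd_sqrt (C + Y))"
  proof (rule lipschitz_onI)
    fix Y Y' :: "real ^ 'd ^ 'd" assume "Y \<in> {Y. psd Y}" "Y' \<in> {Y. psd Y}"
    then show "dist (psd_sqrt (C + Y)) (psd_sqrt (C + Y')) \<le> 1 / sqrt c * dist Y Y'"
      using psd_sqrt_lipschitz[OF c coercive_C_add coercive_C_add, of Y Y'] by (simp add: dist_norm)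
  qed (use c in simp)
qed

lemma continuous_on_jump_coeff:
  assumes "continuous_on S f" "continuous_on S g" "\<And>x. x \<in> S \<Longrightarrow> psd (f x)"
  shows "continuous_on S (\<lambda>x. jump_coeff A C (f x) (g x))"
proof -
  have U: "continuous_on S (\<lambda>x. A ** psd_sqrt (C + f x))"
    by (intro matrix_mult.continuous_on continuous_on_const continuous_on_compose2[OF continuous_on_psd_sqrt assms(1)])
       (use assms(3) in auto)
  have UT: "continuous_on S (\<lambda>x. transpose (A ** psd_sqrt (C + f x)))"
    by (rule continuous_on_compose2[OF linear_continuous_on[OF bounded_linear_transpose, of UNIV] U]) simp
  have o: "continuous_on S (\<lambda>x. outer (g x))"
    by (rule continuous_on_compose2[OF continuous_on_outer assms(2)]) simp
  show ?thesis unfolding jump_coeff_def outer_matrix_vector_mult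
    by (intro matrix_mult.continuous_on U UT o)
qed

text \<open>\<open>flow\<close> and its inverse are bounded by a common \<open>M\<close> on
  \<open>{0..T}\<close>, so the bounds for \<open>jump_coeff\<close> survive conjugation. The flow
  moves the ball of radius \<open>R\<close> into that of radius \<open>M R\<close>, for which the
  Lipschitz constant is taken.\<close>

lemma jump_equation_flow_coeff: "jump_equation {X. psd X} (flow_coeff A B C)"
proof
  show "closed {X :: real ^ 'd ^ 'd. psd X}" by (rule closed_psd)
  show "0 \<in> {X :: real ^ 'd ^ 'd. psd X}" by (simp add: psd_0)
  show "X + Y \<in> {X. psd X}" if "X \<in> {X. psd X}" "Y \<in> {X. psd X}" for X Y :: "real ^ 'd ^ 'd"
    using that by (simp add: psd_add)
  show "flow_coeff A B C s z x \<in> {X. psd X}" if "0 \<le> s" "z \<in> {X. psd X}" for s z x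
    by (simp add: flow_coeff_def psd_flow psd_jump_coeff)
  let ?I = "norm (mat 1 :: real ^ 'd ^ 'd)"
  show "\<exists>K\<ge>0. \<forall>s\<in>{0..T}. \<forall>z\<in>{X. psd X}. \<forall>x. norm (flow_coeff A B C s z x) \<le> K * (1 + norm z) * (norm x)\<^sup>2" for T
  proof -
    obtain M where M: "1 \<le> M" "\<And>s X. s \<in> {0..T} \<Longrightarrow> norm (flow B s X) \<le> M * norm X"
      "\<And>s X. s \<in> {0..T} \<Longrightarrow> norm (flow B (- s) X) \<le> M * norm X" using flow_bound[of T B] by metis
    show ?thesis
    proof (intro exI[of _ "M * ((norm A)\<^sup>2 * ((norm C + M) * ?I))"] conjI ballI allI)
      fix s x and z :: "real ^ 'd ^ 'd" assume s: "s \<in> {0..T}" and z: "z \<in> {X. psd X}"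
      have le: "norm C + norm (flow B s z) \<le> (norm C + M) * (1 + norm z)"
      proof -
        have "0 \<le> norm C * norm z" by simp
        then show ?thesis using M(2)[OF s, of z] M(1) by (simp only: distrib_left distrib_right mult_1_right)
      qed
      have "norm (flow_coeff A B C s z x) \<le> M * norm (jump_coeff A C (flow B s z) x)"
        unfolding flow_coeff_def by (rule M(3)[OF s])
      also have "\<dots> \<le> M * ((norm A)\<^sup>2 * ((norm C + norm (flow B s z)) * ?I) * (norm x)\<^sup>2)"
        using M(1) z by (intro mult_left_mono jump_coeff_growth psd_flow) auto
      also have "\<dots> \<le> M * ((norm A)\<^sup>2 * (((norm C + M) * (1 + norm z)) * ?I) * (norm x)\<^sup>2)"
        using M(1) by (intro mult_left_mono mult_right_mono le) auto
      finally show "norm (flow_coeff A B C s z x) \<le> M * ((norm A)\<^sup>2 * ((norm C + M) * ?I)) * (1 + norm z) * (norm x)\<^sup>2"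
        by (simp add: mult_ac)
    qed (use M(1) in simp)
  qed
  show "\<exists>K\<ge>0. \<forall>s\<in>{0..T}. \<forall>z\<in>{X. psd X}. \<forall>z'\<in>{X. psd X}. norm z \<le> R \<longrightarrow> norm z' \<le> R \<longrightarrow>
      (\<forall>x. norm (flow_coeff A B C s z x - flow_coeff A B C s z' x) \<le> K * norm (z - z') * (norm x)\<^sup>2)" for T R
  proof -
    obtain M where M: "1 \<le> M" "\<And>s X. s \<in> {0..T} \<Longrightarrow> norm (flow B s X) \<le> M * norm X"
      "\<And>s X. s \<in> {0..T} \<Longrightarrow> norm (flow B (- s) X) \<le> M * norm X" using flow_bound[of T B] by metis
    obtain K where K: "0 \<le> K" "\<And>Y Y' x. psd Y \<Longrightarrow> psd Y' \<Longrightarrow> norm Y \<le> M * R \<Longrightarrow> norm Y' \<le> M * R \<Longrightarrow>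
      norm (jump_coeff A C Y x - jump_coeff A C Y' x) \<le> K * norm (Y - Y') * (norm x)\<^sup>2"
      using jump_coeff_lipschitz[of "M * R"] by metis
    show ?thesis
    proof (intro exI[of _ "M * (K * M)"] conjI ballI allI impI)
      fix s x and z z' :: "real ^ 'd ^ 'd" assume s: "s \<in> {0..T}" and z: "z \<in> {X. psd X}" "z' \<in> {X. psd X}" "norm z \<le> R" "norm z' \<le> R"
      have R: "norm (flow B s X) \<le> M * R" if "norm X \<le> R" for X
        using M(2)[OF s, of X] that M(1) by (meson mult_left_mono order_trans zero_le_one)
      have "norm (flow_coeff A B C s z x - flow_coeff A B C s z' x) \<le> M * norm (jump_coeff A C (flow B s z) x - jump_coeff A C (flow B s z') x)"
        unfolding flow_coeff_def flow_diff[symmetric] by (rule M(3)[OF s])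
      also have "\<dots> \<le> M * (K * norm (flow B s z - flow B s z') * (norm x)\<^sup>2)"
        using M(1) z by (intro mult_left_mono K psd_flow R) auto
      also have "\<dots> \<le> M * (K * (M * norm (z - z')) * (norm x)\<^sup>2)"
        unfolding flow_diff[symmetric] using M(1) K(1) by (intro mult_left_mono mult_right_mono M(2) s) auto
      finally show "norm (flow_coeff A B C s z x - flow_coeff A B C s z' x) \<le> M * (K * M) * norm (z - z') * (norm x)\<^sup>2"
        by (simp add: mult_ac)
    qed (use M(1) K in simp)
  qed
  show "continuous_on ({0..} \<times> {X. psd X} \<times> UNIV) (\<lambda>(s, z, x). flow_coeff A B C s z x)"
    unfolding flow_coeff_def case_prod_beta
    by (intro continuous_on_flow continuous_on_jump_coeff continuous_intros) (auto intro: psd_flow)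
qed

end

subsection \<open>Variation of constants\<close>

lemmas flow_zero = linear_0[OF bounded_linear.linear[OF bounded_linear_flow]]
  and drift_zero = linear_0[OF bounded_linear.linear[OF bounded_linear_drift]]
  and drift_add = linear_add[OF bounded_linear.linear[OF bounded_linear_drift]]
  and drift_diff = linear_diff[OF bounded_linear.linear[OF bounded_linear_drift]]

lemma continuous_on_drift_flow:
  assumes "continuous_on S f" "continuous_on S g"
  shows "continuous_on S (\<lambda>x. drift B (flow B (f x) (g x)))"
  by (rule continuous_on_compose2[OF linear_continuous_on[OF bounded_linear_drift, of UNIV] continuous_on_flow[OF assms]]) simp

lemma flow_increment:
  assumes "a \<le> b"
  shows "(LBINT s:{a..b}. drift B (flow B s X)) = flow B b X - flow B a X"
  unfolding set_lebesgue_integral_def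
proof (rule integral_FTC_atLeastAtMost[OF assms])
  show "((\<lambda>s. flow B s X) has_vector_derivative drift B (flow B s X)) (at s within {a..b})" for s
    by (rule has_vector_derivative_at_within[OF flow_derivative])
  show "continuous_on {a..b} (\<lambda>s. drift B (flow B s X))"
    by (intro continuous_on_drift_flow continuous_on_id continuous_on_const)
qed

lemma set_integrable_drift_flow:
  fixes \<zeta> :: "real \<Rightarrow> real ^ 'd ^ 'd"
  assumes \<zeta>: "\<And>t. \<zeta> abs_summable_on {0..t}"
  shows "set_integrable lborel {0..t} (\<lambda>s. drift B (flow B s (infsum \<zeta> {0..<s})))"
proof -
  obtain M where M: "1 \<le> M" "\<And>s X. s \<in> {0..t} \<Longrightarrow> norm (flow B s X) \<le> M * norm X" using flow_bound[of t B] by metis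
  show ?thesis
  proof (rule set_integrable_left_limits)
    fix s :: real assume s: "0 < s" "s \<le> t"
    have "((\<lambda>s. (s, infsum \<zeta> {0..<s})) \<longlongrightarrow> (s, infsum \<zeta> {0..<s})) (at_left s)"
      by (intro tendsto_Pair tendsto_ident_at tendsto_infsum_at_left(2) \<zeta> s)
    moreover have "continuous_on UNIV (\<lambda>p. drift B (flow B (fst p) (snd p)))"
      by (intro continuous_on_drift_flow continuous_intros)
    ultimately show "((\<lambda>s. drift B (flow B s (infsum \<zeta> {0..<s}))) \<longlongrightarrow> drift B (flow B s (infsum \<zeta> {0..<s}))) (at_left s)"
      using continuous_on_tendsto_compose[of UNIV "\<lambda>p. drift B (flow B (fst p) (snd p))" "\<lambda>s. (s, infsum \<zeta> {0..<s})"
          "(s, infsum \<zeta> {0..<s})" "at_left s"] by simp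
  next
    fix s assume s: "s \<in> {0..t}"
    have "norm (infsum \<zeta> {0..<s}) \<le> infsum (\<lambda>s. norm (\<zeta> s)) {0..<s}"
      by (rule abs_summable_subset(3)[OF \<zeta>[of s]]) auto
    also have "\<dots> \<le> infsum (\<lambda>s. norm (\<zeta> s)) {0..t}"
      by (rule infsum_mono2) (use s in \<open>auto intro!: abs_summable_subset(1)[OF \<zeta>[of t]]\<close>)
    finally have "2 * norm B * norm (flow B s (infsum \<zeta> {0..<s})) \<le> 2 * norm B * (M * infsum (\<lambda>s. norm (\<zeta> s)) {0..t})"
      using M(1) by (intro mult_left_mono order_trans[OF M(2)[OF s]]) auto
    then show "norm (drift B (flow B s (infsum \<zeta> {0..<s}))) \<le> 2 * norm B * (M * infsum (\<lambda>s. norm (\<zeta> s)) {0..t})"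
      by (rule order_trans[OF norm_drift_le])
  qed
qed

text \<open>Its vanishing is the product rule for the flow applied to the running sum of
  \<open>\<zeta>\<close>: the integral comes from differentiating the flow, the last sum collects
  the transported jumps.\<close>

definition flow_defect :: "real ^ 'd ^ 'd \<Rightarrow> real \<Rightarrow> (real \<Rightarrow> real ^ 'd ^ 'd) \<Rightarrow> real ^ 'd ^ 'd" where
  "flow_defect B t \<zeta> = flow B t (infsum \<zeta> {0..t}) -
     (LBINT s:{0..t}. drift B (flow B s (infsum \<zeta> {0..<s}))) - infsum (\<lambda>s. flow B s (\<zeta> s)) {0..t}"

context
  fixes B :: "real ^ 'd ^ 'd" and t :: real
  assumes t: "0 \<le> t"
begin

lemma flow_abs_summable:
  assumes "\<zeta> abs_summable_on {0..t}"
  shows "(\<lambda>s. flow B s (\<zeta> s)) abs_summable_on {0..t}"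
proof -
  obtain M where M: "1 \<le> M" "\<And>s X. s \<in> {0..t} \<Longrightarrow> norm (flow B s X) \<le> M * norm X" using flow_bound[of t B] by metis
  show ?thesis
    by (rule summable_on_comparison_test[OF summable_on_cmult_right[OF assms, of M]]) (use M(2) in auto)
qed

lemma flow_defect_add:
  assumes \<zeta>: "\<And>t. \<zeta> abs_summable_on {0..t}" and \<xi>: "\<And>t. \<xi> abs_summable_on {0..t}"
  shows "flow_defect B t (\<lambda>s. \<zeta> s + \<xi> s) = flow_defect B t \<zeta> + flow_defect B t \<xi>"
proof -
  have 1: "infsum (\<lambda>s. \<zeta> s + \<xi> s) A = infsum \<zeta> A + infsum \<xi> A" if "A \<subseteq> {0..u}" for A u
    by (rule infsum_add) (rule abs_summable_subset(2)[OF \<zeta> that] abs_summable_subset(2)[OF \<xi> that])+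
  have 2: "infsum (\<lambda>s. flow B s (\<zeta> s) + flow B s (\<xi> s)) {0..t} = infsum (\<lambda>s. flow B s (\<zeta> s)) {0..t} + infsum (\<lambda>s. flow B s (\<xi> s)) {0..t}"
    by (rule infsum_add[OF abs_summable_summable[OF flow_abs_summable[OF \<zeta>]] abs_summable_summable[OF flow_abs_summable[OF \<xi>]]])
  have 3: "drift B (flow B s (infsum (\<lambda>s. \<zeta> s + \<xi> s) {0..<s})) =
      drift B (flow B s (infsum \<zeta> {0..<s})) + drift B (flow B s (infsum \<xi> {0..<s}))" for s
  proof -
    have "{0..<s} \<subseteq> {0..s}" by auto
    from 1[OF this] show ?thesis by (simp only: flow_add drift_add)
  qed
  show ?thesis
    unfolding flow_defect_def 3 flow_add 2 1[of "{0..t}" t, OF order_refl]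
      set_integral_add(2)[OF set_integrable_drift_flow[OF \<zeta>] set_integrable_drift_flow[OF \<xi>]]
    by simp
qed

lemma flow_defect_single:
  assumes r: "r \<in> {0..t}"
  shows "flow_defect B t (\<lambda>s. if s = r then w else 0) = 0"
proof -
  let ?\<zeta> = "\<lambda>s. if s = r then w else 0"
  have sum: "infsum ?\<zeta> A = (if r \<in> A then w else 0)" for A
  proof -
    have "infsum ?\<zeta> A = infsum ?\<zeta> (A \<inter> {r})" by (rule infsum_cong_neutral) auto
    then show ?thesis by (cases "r \<in> A") auto
  qed
  have 1: "infsum (\<lambda>s. flow B s (?\<zeta> s)) {0..t} = flow B r w"
  proof -
    have "infsum (\<lambda>s. flow B s (?\<zeta> s)) {0..t} = infsum (\<lambda>s. flow B s (?\<zeta> s)) {r}"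
      by (rule infsum_cong_neutral) (use r in \<open>auto simp: flow_zero\<close>)
    then show ?thesis by simp
  qed
  have sing: "?\<zeta> abs_summable_on {0..u}" for u
  proof -
    have "(\<lambda>x. norm (?\<zeta> x)) summable_on ({0..u} \<inter> {r})" by (rule summable_on_finite) simp
    then show ?thesis by (rule summable_on_cong_neutral[THEN iffD1, rotated -1]) auto
  qed
  have m1: "(\<lambda>s. indicator {0..t} s *\<^sub>R drift B (flow B s (infsum ?\<zeta> {0..<s}))) \<in> borel_measurable lborel"
    by (rule borel_measurable_integrable, rule set_integrable_drift_flow[OF sing, unfolded set_integrable_def])
  have "continuous_on {r..t} (\<lambda>s. drift B (flow B s w))"
    by (intro continuous_on_drift_flow continuous_on_id continuous_on_const)
  then have m2: "(\<lambda>s. indicator {r..t} s *\<^sub>R drift B (flow B s w)) \<in> borel_measurable lborel"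
    by (rule borel_measurable_integrable[OF borel_integrable_atLeastAtMost'[unfolded set_integrable_def]])
  have "(LBINT s:{0..t}. drift B (flow B s (infsum ?\<zeta> {0..<s}))) = (LBINT s:{r..t}. drift B (flow B s w))"
    unfolding set_lebesgue_integral_def
  proof (rule integral_cong_AE[OF m1 m2])
    \<comment> \<open>At \<open>s = r\<close> the sum over \<open>{0..<s}\<close> does not yet
      contain the jump, whereas \<open>{r..t}\<close> contains \<open>r\<close>; the integrands
      differ at most in this point.\<close>
    show "AE s in lborel. indicator {0..t} s *\<^sub>R drift B (flow B s (infsum ?\<zeta> {0..<s})) = indicator {r..t} s *\<^sub>R drift B (flow B s w)"
      using AE_lborel_singleton[of r]
    proof eventually_elim
      case (elim s)
      then show ?case using r by (simp only: sum) (auto simp: indicator_def flow_zero drift_zero)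
    qed
  qed
  also have "\<dots> = flow B t w - flow B r w" by (rule flow_increment) (use r in auto)
  finally show ?thesis
    unfolding flow_defect_def 1 sum using r by simp
qed

lemma flow_defect_bound:
  obtains c where "\<And>\<zeta>. (\<And>t. \<zeta> abs_summable_on {0..t}) \<Longrightarrow> norm (flow_defect B t \<zeta>) \<le> c * infsum (\<lambda>s. norm (\<zeta> s)) {0..t}"
    "0 \<le> c"
proof -
  obtain M where M: "1 \<le> M" "\<And>s X. s \<in> {0..t} \<Longrightarrow> norm (flow B s X) \<le> M * norm X" using flow_bound[of t B] by metis
  show ?thesis
  \<comment> \<open>The three summands bound the end value, the drift integral over a time span
    \<open>t\<close>, and the sum of the transported jumps.\<close>
  proof (rule that[of "M + 2 * norm B * M * t + M"])
    show "0 \<le> M + 2 * norm B * M * t + M" using M(1) t by simp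
    fix \<zeta> :: "real \<Rightarrow> real ^ 'd ^ 'd" assume \<zeta>: "\<And>t. \<zeta> abs_summable_on {0..t}"
    let ?N = "infsum (\<lambda>s. norm (\<zeta> s)) {0..t}"
    have N0: "0 \<le> ?N" by (rule infsum_nonneg) simp
    have part: "norm (infsum \<zeta> A) \<le> ?N" if "A \<subseteq> {0..t}" for A
      by (rule order_trans[OF abs_summable_subset(3)[OF \<zeta> that]
        infsum_mono2[OF abs_summable_subset(1)[OF \<zeta> that] \<zeta>[of t] that]]) simp
    have 1: "norm (flow B t (infsum \<zeta> {0..t})) \<le> M * ?N"
      by (rule order_trans[OF M(2)]) (use t M(1) in \<open>auto intro!: mult_left_mono part\<close>)
    have 2: "norm (LBINT s:{0..t}. drift B (flow B s (infsum \<zeta> {0..<s}))) \<le> (2 * norm B * (M * ?N)) * (t - 0)"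
    proof (rule norm_set_integral_le[OF set_integrable_drift_flow[OF \<zeta>] order_refl t])
      show "0 \<le> 2 * norm B * (M * ?N)" using M(1) N0 by simp
      fix s assume s: "s \<in> {0..t}"
      have "norm (drift B (flow B s (infsum \<zeta> {0..<s}))) \<le> 2 * norm B * (M * ?N)"
        by (rule order_trans[OF norm_drift_le], intro mult_left_mono order_trans[OF M(2)[OF s]] part) (use M(1) s in auto)
      moreover have "drift B (flow B s (infsum \<zeta> {0..<s})) = 0" if "\<not> 0 < s"
        using that by (simp add: flow_zero drift_zero)
      ultimately show "norm (drift B (flow B s (infsum \<zeta> {0..<s}))) \<le> (if 0 < s then 2 * norm B * (M * ?N) else 0)" by auto
    qed
    have 3: "norm (infsum (\<lambda>s. flow B s (\<zeta> s)) {0..t}) \<le> M * ?N"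
    proof -
      have "norm (infsum (\<lambda>s. flow B s (\<zeta> s)) {0..t}) \<le> infsum (\<lambda>s. norm (flow B s (\<zeta> s))) {0..t}"
        by (rule norm_infsum_bound[OF flow_abs_summable[OF \<zeta>]])
      also have "\<dots> \<le> infsum (\<lambda>s. M * norm (\<zeta> s)) {0..t}"
        by (rule infsum_mono[OF flow_abs_summable[OF \<zeta>] summable_on_cmult_right[OF \<zeta>]]) (use M(2) in auto)
      also have "\<dots> = M * ?N" by (rule infsum_cmult_right[OF \<zeta>])
      finally show ?thesis .
    qed
    have tri: "norm (x - y - z) \<le> norm x + norm y + norm z" for x y z :: "real ^ 'd ^ 'd"
      using norm_triangle_ineq4[of "x - y" z] norm_triangle_ineq4[of x y] by linarith
    have "norm (flow_defect B t \<zeta>) \<le> M * ?N + (2 * norm B * (M * ?N)) * (t - 0) + M * ?N"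
      unfolding flow_defect_def by (rule order_trans[OF tri add_mono[OF add_mono[OF 1 2] 3]])
    then show "norm (flow_defect B t \<zeta>) \<le> (M + 2 * norm B * M * t + M) * ?N" by (simp add: algebra_simps)
  qed
qed

text \<open>Both sides of the variation of constants formula are continuous in \<open>\<zeta>\<close> for the \<open>\<ell>\<^sup>1\<close> norm, so it
  suffices to check it for a single jump, where it is the fundamental theorem of calculus.\<close>

lemma flow_defect_eq_0:
  assumes \<zeta>: "\<And>t. \<zeta> abs_summable_on {0..t}"
  shows "flow_defect B t \<zeta> = 0"
proof -
  obtain c where c: "\<And>\<zeta>. (\<And>t. \<zeta> abs_summable_on {0..t}) \<Longrightarrow> norm (flow_defect B t \<zeta>) \<le> c * infsum (\<lambda>s. norm (\<zeta> s)) {0..t}" "0 \<le> c"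
    using flow_defect_bound by metis
  have restr: "(\<lambda>s. if s \<in> A then \<zeta> s else 0) abs_summable_on {0..u}" for A u
    by (rule summable_on_comparison_test[OF \<zeta>[of u]]) auto
  have fin: "flow_defect B t (\<lambda>s. if s \<in> S then \<zeta> s else 0) = 0" if "finite S" "S \<subseteq> {0..t}" for S
    using that
  proof (induction S)
    case empty
    then show ?case using c(1)[of "\<lambda>_. 0"] by simp
  next
    case (insert r S)
    have "(\<lambda>s. if s \<in> {r} then \<zeta> s else 0) = (\<lambda>s. if s = r then \<zeta> r else 0)" by auto
    with restr[of "{r}"] have sing: "(\<lambda>s. if s = r then \<zeta> r else 0) abs_summable_on {0..u}" for u by metis
    have "(\<lambda>s. if s \<in> insert r S then \<zeta> s else 0) = (\<lambda>s. (if s = r then \<zeta> r else 0) + (if s \<in> S then \<zeta> s else 0))"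
      using insert.hyps by auto
    then show ?case
      using flow_defect_add[OF sing restr[of S]] flow_defect_single[of r "\<zeta> r"] insert by simp
  qed
  have bound: "norm (flow_defect B t \<zeta>) \<le> c * e" if e: "0 < e" for e
  proof -
    obtain S where S: "finite S" "S \<subseteq> {0..t}" "\<And>B. B \<subseteq> {0..t} - S \<Longrightarrow> infsum (\<lambda>s. norm (\<zeta> s)) B < e"
      using infsum_tail_small[OF \<zeta>[of t] norm_ge_zero e] by metis
    have "\<zeta> = (\<lambda>s. (if s \<in> S then \<zeta> s else 0) + (if s \<in> - S then \<zeta> s else 0))" by auto
    then have "flow_defect B t \<zeta> = flow_defect B t (\<lambda>s. (if s \<in> S then \<zeta> s else 0) + (if s \<in> - S then \<zeta> s else 0))"
      by (rule arg_cong)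
    also have "\<dots> = flow_defect B t (\<lambda>s. if s \<in> - S then \<zeta> s else 0)"
      unfolding flow_defect_add[OF restr[of S] restr[of "- S"]] fin[OF S(1,2)] by simp
    also have "norm \<dots> \<le> c * infsum (\<lambda>s. norm (if s \<in> - S then \<zeta> s else 0)) {0..t}" by (rule c(1)[OF restr])
    also have "infsum (\<lambda>s. norm (if s \<in> - S then \<zeta> s else 0)) {0..t} = infsum (\<lambda>s. norm (\<zeta> s)) ({0..t} - S)"
      by (rule infsum_cong_neutral) auto
    also have "c * \<dots> \<le> c * e" by (rule mult_left_mono[OF less_imp_le[OF S(3)] c(2)]) simp
    finally show ?thesis .
  qed
  have "norm (flow_defect B t \<zeta>) \<le> 0 + e" if "0 < e" for e
  proof -
    \<comment> \<open>Division by \<open>c + 1\<close> and not by \<open>c\<close>, since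
      \<open>c\<close> may be \<open>0\<close>.\<close>
    have "norm (flow_defect B t \<zeta>) \<le> c * (e / (c + 1))" using that c(2) by (intro bound divide_pos_pos) auto
    also have "\<dots> \<le> e"
    proof -
      have "c * e \<le> e * (c + 1)" using that by (simp add: algebra_simps)
      then show ?thesis using c(2) by (simp add: pos_divide_le_eq)
    qed
    finally show ?thesis by simp
  qed
  then have "norm (flow_defect B t \<zeta>) \<le> 0" by (rule field_le_epsilon)
  then show ?thesis by simp
qed

lemma variation_of_constants:
  assumes \<zeta>: "\<And>t. \<zeta> abs_summable_on {0..t}"
  shows "flow B t (y + infsum \<zeta> {0..t}) =
    y + (LBINT s:{0..t}. drift B (flow B s (y + infsum \<zeta> {0..<s}))) + infsum (\<lambda>s. flow B s (\<zeta> s)) {0..t}"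
proof -
  have const: "set_integrable lborel {0..t} (\<lambda>s. drift B (flow B s y))"
    by (intro borel_integrable_atLeastAtMost' continuous_on_drift_flow continuous_on_id continuous_on_const)
  have "(LBINT s:{0..t}. drift B (flow B s (y + infsum \<zeta> {0..<s}))) =
      (flow B t y - y) + (LBINT s:{0..t}. drift B (flow B s (infsum \<zeta> {0..<s})))"
    unfolding flow_add drift_add
      set_integral_add(2)[OF const set_integrable_drift_flow[OF \<zeta>]] flow_increment[OF t] by simp
  note integral = this
  have "flow B t (infsum \<zeta> {0..t}) =
      (LBINT s:{0..t}. drift B (flow B s (infsum \<zeta> {0..<s}))) + infsum (\<lambda>s. flow B s (\<zeta> s)) {0..t}"
    using flow_defect_eq_0[OF \<zeta>] unfolding flow_defect_def by (simp add: algebra_simps)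
  then show ?thesis unfolding integral by (simp add: flow_add)
qed

end

subsection \<open>Pathwise solutions\<close>

lemma infsum_sum_finite:
  fixes f :: "'i \<Rightarrow> 's \<Rightarrow> 'b::real_normed_vector"
  assumes "finite I" "\<And>i. i \<in> I \<Longrightarrow> f i summable_on A"
  shows "(\<lambda>x. \<Sum>i\<in>I. f i x) summable_on A" "infsum (\<lambda>x. \<Sum>i\<in>I. f i x) A = (\<Sum>i\<in>I. infsum (f i) A)"
proof -
  have "((\<lambda>x. \<Sum>i\<in>I. f i x) has_sum (\<Sum>i\<in>I. infsum (f i) A)) A"
    using assms by (induction I) (auto intro!: has_sum_add)
  then show "(\<lambda>x. \<Sum>i\<in>I. f i x) summable_on A" "infsum (\<lambda>x. \<Sum>i\<in>I. f i x) A = (\<Sum>i\<in>I. infsum (f i) A)"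
    by (auto intro: has_sum_imp_summable infsumI)
qed

lemma infsum_matrix_nth:
  fixes f :: "'s \<Rightarrow> real ^ 'n ^ 'm"
  assumes "f summable_on A"
  shows "infsum f A $ i $ j = infsum (\<lambda>s. f s $ i $ j) A"
proof -
  have "bounded_linear (\<lambda>X :: real ^ 'n ^ 'm. X $ i $ j)"
    by (rule bounded_linear_compose[OF bounded_linear_vec_nth bounded_linear_vec_nth])
  from has_sum_bounded_linear[OF this has_sum_infsum[OF assms]] show ?thesis by (simp add: o_def infsumI)
qed

lemma abs_matrix_nth_le: "\<bar>X $ i $ j\<bar> \<le> norm X" for X :: "real ^ 'n ^ 'm"
  using order_trans[OF component_le_norm_cart[of "X $ i" j] Finite_Cartesian_Product.norm_nth_le[of X i]] .

lemma matrix_mult3_nth: "(X ** Q ** W) $ i $ j = (\<Sum>k\<in>UNIV. \<Sum>m\<in>UNIV. (X $ i $ k * W $ m $ j) * Q $ k $ m)"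
  for X Q W :: "real ^ 'd ^ 'd"
proof -
  have "(X ** Q ** W) $ i $ j = (\<Sum>m\<in>UNIV. \<Sum>k\<in>UNIV. (X $ i $ k * W $ m $ j) * Q $ k $ m)"
    by (simp add: matrix_matrix_mult_def sum_distrib_right sum_distrib_left mult_ac)
  also have "\<dots> = (\<Sum>k\<in>UNIV. \<Sum>m\<in>UNIV. (X $ i $ k * W $ m $ j) * Q $ k $ m)" by (rule sum.swap)
  finally show ?thesis .
qed

lemma abs_summable_outer:
  assumes "square_summable_jumps l"
  shows "(\<lambda>s. outer (jump l s)) abs_summable_on {0..t}"
  using assms by (simp add: norm_outer square_summable_jumps_def)

lemma disc_quad_var_eq: "disc_quad_var l t = infsum (\<lambda>s. outer (jump l s)) {0..t}"
  unfolding disc_quad_var_def outer_eq_columnvector ..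

text \<open>The equation on one path, with the matrix integral already written as a sum over jumps;
  \<open>psd_solution_iff_path_solution\<close> links it to the original form.\<close>

definition path_solution :: "real ^ 'd ^ 'd \<Rightarrow> real ^ 'd ^ 'd \<Rightarrow> real ^ 'd ^ 'd \<Rightarrow> (real \<Rightarrow> real ^ 'd) \<Rightarrow> real ^ 'd ^ 'd
    \<Rightarrow> (real \<Rightarrow> real ^ 'd ^ 'd) \<Rightarrow> bool" where
  "path_solution A B C l y0 y \<longleftrightarrow> cadlag y \<and> (\<forall>t\<ge>0. psd (y t)) \<and>
    (\<forall>t\<ge>0. y t = y0 + (LBINT s:{0..t}. drift B (left_limit y s))
      + infsum (\<lambda>s. jump_coeff A C (left_limit y s) (jump l s)) {0..t})"

definition flow_solution :: "real ^ 'd ^ 'd \<Rightarrow> real ^ 'd ^ 'd \<Rightarrow> real ^ 'd ^ 'd \<Rightarrow> (real \<Rightarrow> real ^ 'd) \<Rightarrow> real ^ 'd ^ 'd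
    \<Rightarrow> real \<Rightarrow> real ^ 'd ^ 'd" where
  "flow_solution A B C l y0 t = flow B t (jump_equation.solution (flow_coeff A B C) l y0 t)"

lemma path_solutionD:
  assumes "path_solution A B C l y0 y" "0 \<le> t"
  shows "y t = y0 + (LBINT s:{0..t}. drift B (left_limit y s))
      + infsum (\<lambda>s. jump_coeff A C (left_limit y s) (jump l s)) {0..t}"
proof -
  have "\<forall>t\<ge>0. y t = y0 + (LBINT s:{0..t}. drift B (left_limit y s))
      + infsum (\<lambda>s. jump_coeff A C (left_limit y s) (jump l s)) {0..t}"
    using assms(1) unfolding path_solution_def by (elim conjE)
  from this[rule_format, OF assms(2)] show ?thesis .
qed

lemma psd_left_limit:
  assumes "cadlag y" "\<And>t. 0 \<le> t \<Longrightarrow> psd (y t)" "0 \<le> t"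
  shows "psd (left_limit y t)"
  using cadlag_continuous_map(3)[OF assms(1) closed_psd _ continuous_on_id, of t] assms(2,3) by simp

context
  fixes A B C :: "real ^ 'd ^ 'd" and c :: real and l :: "real \<Rightarrow> real ^ 'd"
  assumes c: "0 < c" and C: "coercive c C" and l: "square_summable_jumps l"
begin

text \<open>Each entry of the matrix integral is a finite double sum of pure jump integrals, whose
  integrands are measurable and bounded as left limits of cadlag paths. Pulling the finite sums
  inside reassembles \<open>U x x^T U^T\<close>, which is \<open>jump_coeff\<close>.\<close>

lemma matrix_stieltjes_integral_disc_quad_var:
  assumes y: "cadlag y" "\<And>t. 0 \<le> t \<Longrightarrow> psd (y t)"
  shows "matrix_stieltjes_integral (\<lambda>s. A ** psd_sqrt (C + left_limit y s)) (disc_quad_var l)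
      (\<lambda>s. psd_sqrt (C + left_limit y s) ** transpose A) t
    = infsum (\<lambda>s. jump_coeff A C (left_limit y s) (jump l s)) {0..t}"
proof -
  let ?X = "\<lambda>s. A ** psd_sqrt (C + left_limit y s)" and ?W = "\<lambda>s. psd_sqrt (C + left_limit y s) ** transpose A"
  let ?X' = "\<lambda>s. A ** psd_sqrt (C + y s)" and ?W' = "\<lambda>s. psd_sqrt (C + y s) ** transpose A"
  have yS: "\<And>t. 0 \<le> t \<Longrightarrow> y t \<in> {Y. psd Y}" using y(2) by simp
  have cX: "continuous_on {Y. psd Y} (\<lambda>Y. A ** psd_sqrt (C + Y))"
    and cW: "continuous_on {Y. psd Y} (\<lambda>Y. psd_sqrt (C + Y) ** transpose A)"
    by (intro matrix_mult.continuous_on continuous_on_const continuous_on_psd_sqrt[OF c C])+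
  note X = cadlag_continuous_map[OF y(1) closed_psd yS cX] and W = cadlag_continuous_map[OF y(1) closed_psd yS cW]
  obtain KX where KX: "\<And>s. s \<in> {0..t} \<Longrightarrow> norm (?X' s) \<le> KX" using cadlag_bounded[OF X(1)] by metis
  obtain KW where KW: "\<And>s. s \<in> {0..t} \<Longrightarrow> norm (?W' s) \<le> KW" using cadlag_bounded[OF W(1)] by metis
  have bX: "norm (?X s) \<le> KX" if s: "s \<in> {0..t}" for s
    using left_limit_norm_le[OF X(1) KX s] X(2)[of s] s by simp
  have bW: "norm (?W s) \<le> KW" if s: "s \<in> {0..t}" for s
    using left_limit_norm_le[OF W(1) KW s] W(2)[of s] s by simp
  have int: "stieltjes_integral (\<lambda>s. ?X s $ i $ k * ?W s $ m $ j) (\<lambda>s. disc_quad_var l s $ k $ m) t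
      = infsum (\<lambda>s. (?X s $ i $ k * ?W s $ m $ j) * outer (jump l s) $ k $ m) {0..t}"
    (is "stieltjes_integral ?f _ t = _") for i j k m
  proof (rule stieltjes_integral_pure_jump)
    show "(\<lambda>s. outer (jump l s) $ k $ m) abs_summable_on {0..t}"
    proof (rule summable_on_comparison_test[OF abs_summable_outer[OF l]])
      show "norm (outer (jump l s) $ k $ m) \<le> norm (outer (jump l s))" for s
        unfolding real_norm_def by (rule abs_matrix_nth_le)
    qed simp
    show "outer (jump l 0) $ k $ m = 0" by (simp add: outer_def)
    show "disc_quad_var l s $ k $ m = infsum (\<lambda>s. outer (jump l s) $ k $ m) {0..s}" for s
      unfolding disc_quad_var_eq by (rule infsum_matrix_nth[OF abs_summable_summable[OF abs_summable_outer[OF l]]])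
    show "(\<lambda>s. indicator {0<..t} s *\<^sub>R ?f s) \<in> borel_measurable borel"
    proof (rule borel_measurable_left_limits)
      fix s :: real assume s: "0 < s" "s \<le> t"
      have "(?X' \<longlongrightarrow> ?X s) (at_left s)" "(?W' \<longlongrightarrow> ?W s) (at_left s)"
        using tendsto_left_limit[OF X(1) s(1)] tendsto_left_limit[OF W(1) s(1)] X(2)[of s] W(2)[of s] s by simp_all
      then show "((\<lambda>s. ?X' s $ i $ k * ?W' s $ m $ j) \<longlongrightarrow> ?f s) (at_left s)"
        by (intro tendsto_mult tendsto_vec_nth)
    qed
    fix s assume "s \<in> {0<..t}"
    then have s: "s \<in> {0..t}" by auto
    have "\<bar>?X s $ i $ k\<bar> \<le> KX" "\<bar>?W s $ m $ j\<bar> \<le> KW"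
      by (rule order_trans[OF abs_matrix_nth_le bX[OF s]] order_trans[OF abs_matrix_nth_le bW[OF s]])+
    then show "\<bar>?f s\<bar> \<le> KX * KW" unfolding abs_mult by (intro mult_mono) auto
  qed
  have coeff: "jump_coeff A C (left_limit y s) (jump l s) = ?X s ** outer (jump l s) ** ?W s" if "s \<in> {0..t}" for s
    using that psd_left_limit[OF y, of s]
    by (simp add: jump_coeff_def outer_matrix_vector_mult matrix_transpose_mul transpose_psd_sqrt[OF c coercive_C_add[OF c C]])
  have abs: "(\<lambda>s. (?X s $ i $ k * ?W s $ m $ j) * outer (jump l s) $ k $ m) summable_on {0..t}" for i j k m
  proof (rule abs_summable_summable, rule summable_on_comparison_test)
    show "(\<lambda>s. KX * KW * norm (outer (jump l s))) summable_on {0..t}"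
      by (rule summable_on_cmult_right[OF abs_summable_outer[OF l]])
    fix s assume s: "s \<in> {0..t}"
    have "\<bar>?X s $ i $ k\<bar> \<le> KX" "\<bar>?W s $ m $ j\<bar> \<le> KW" "\<bar>outer (jump l s) $ k $ m\<bar> \<le> norm (outer (jump l s))"
      by (rule order_trans[OF abs_matrix_nth_le bX[OF s]] order_trans[OF abs_matrix_nth_le bW[OF s]] abs_matrix_nth_le)+
    then show "norm ((?X s $ i $ k * ?W s $ m $ j) * outer (jump l s) $ k $ m) \<le> KX * KW * norm (outer (jump l s))"
      unfolding real_norm_def abs_mult by (intro mult_mono mult_nonneg_nonneg) auto
  qed simp
  have summ: "(\<lambda>s. jump_coeff A C (left_limit y s) (jump l s)) summable_on {0..t}"
  proof (rule abs_summable_summable, rule summable_on_comparison_test)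
    show "(\<lambda>s. (KX * KW) * norm (outer (jump l s))) summable_on {0..t}"
      by (rule summable_on_cmult_right[OF abs_summable_outer[OF l]])
    fix s assume s: "s \<in> {0..t}"
    have "norm (?X s ** outer (jump l s) ** ?W s) \<le> (norm (?X s) * norm (outer (jump l s))) * norm (?W s)"
      by (rule order_trans[OF norm_matrix_mult_le mult_right_mono[OF norm_matrix_mult_le norm_ge_zero]])
    also have "\<dots> \<le> (KX * norm (outer (jump l s))) * KW"
      using order_trans[OF norm_ge_zero bX[OF s]]
      by (intro mult_mono mult_nonneg_nonneg bX bW s norm_ge_zero order_refl)
    finally show "norm (jump_coeff A C (left_limit y s) (jump l s)) \<le> (KX * KW) * norm (outer (jump l s))"
      using coeff[OF s] by (simp add: mult_ac)
  qed simp
  have "matrix_stieltjes_integral ?X (disc_quad_var l) ?W t $ i $ j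
      = infsum (\<lambda>s. jump_coeff A C (left_limit y s) (jump l s)) {0..t} $ i $ j" for i j
  proof -
    have "matrix_stieltjes_integral ?X (disc_quad_var l) ?W t $ i $ j
        = (\<Sum>k\<in>UNIV. \<Sum>m\<in>UNIV. infsum (\<lambda>s. (?X s $ i $ k * ?W s $ m $ j) * outer (jump l s) $ k $ m) {0..t})"
      by (simp add: matrix_stieltjes_integral_def int)
    also have "\<dots> = (\<Sum>k\<in>UNIV. infsum (\<lambda>s. \<Sum>m\<in>UNIV. (?X s $ i $ k * ?W s $ m $ j) * outer (jump l s) $ k $ m) {0..t})"
      by (intro sum.cong refl infsum_sum_finite(2)[symmetric] abs) simp
    also have "\<dots> = infsum (\<lambda>s. \<Sum>k\<in>UNIV. \<Sum>m\<in>UNIV. (?X s $ i $ k * ?W s $ m $ j) * outer (jump l s) $ k $ m) {0..t}"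
      by (intro infsum_sum_finite(2)[symmetric] infsum_sum_finite(1) abs) simp_all
    also have "\<dots> = infsum (\<lambda>s. jump_coeff A C (left_limit y s) (jump l s) $ i $ j) {0..t}"
      by (rule infsum_cong) (simp only: coeff matrix_mult3_nth)
    finally show ?thesis by (simp only: infsum_matrix_nth[OF summ])
  qed
  then show ?thesis by (simp add: vec_eq_iff)
qed

interpretation J: jump_equation "{X. psd X}" "flow_coeff A B C"
  by (rule jump_equation_flow_coeff[OF c C])

text \<open>\<open>variation_of_constants\<close> converts the drift-free equation into the one with
  drift, and \<open>flow_inverse\<close> cancels the conjugation in \<open>flow_coeff\<close>. The
  lower bound is the psd matrix \<open>z - y0\<close> transported by the flow.\<close>

lemma flow_solution:
  assumes y0: "psd y0"
  shows "path_solution A B C l y0 (flow_solution A B C l y0)"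
    and "0 \<le> t \<Longrightarrow> psd (flow_solution A B C l y0 t - flow B t y0)"
    and "finite_variation_path (flow_solution A B C l y0)"
proof -
  have y0': "y0 \<in> {X. psd X}" using y0 by simp
  note z = J.solution[OF l y0']
  let ?z = "J.solution l y0" and ?zl = "J.left_solution l y0"
  let ?\<zeta> = "\<lambda>s. flow_coeff A B C s (?zl s) (jump l s)"
  note \<zeta> = J.left_solution_abs_summable[OF l y0']
  have right: "(flow_solution A B C l y0 \<longlongrightarrow> flow_solution A B C l y0 t) (at_right t)" if "0 \<le> t" for t
  proof -
    have "((\<lambda>s. (s, ?z s)) \<longlongrightarrow> (t, ?z t)) (at_right t)"
      by (intro tendsto_Pair tendsto_ident_at tendsto_right_cadlag z(1) that)
    moreover have "continuous_on UNIV (\<lambda>p. flow B (fst p) (snd p))"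
      by (intro continuous_on_flow continuous_intros)
    ultimately show ?thesis
      using continuous_on_tendsto_compose[of UNIV "\<lambda>p. flow B (fst p) (snd p)" "\<lambda>s. (s, ?z s)" "(t, ?z t)" "at_right t"]
      by (simp add: flow_solution_def[abs_def])
  qed
  have left: "(flow_solution A B C l y0 \<longlongrightarrow> flow B t (?zl t)) (at_left t)" if "0 < t" for t
  proof -
    have "((\<lambda>s. (s, ?z s)) \<longlongrightarrow> (t, ?zl t)) (at_left t)"
      using tendsto_left_limit[OF z(1) that] z(2)[of t] that by (intro tendsto_Pair tendsto_ident_at) simp
    moreover have "continuous_on UNIV (\<lambda>p. flow B (fst p) (snd p))"
      by (intro continuous_on_flow continuous_intros)
    ultimately show ?thesis
      using continuous_on_tendsto_compose[of UNIV "\<lambda>p. flow B (fst p) (snd p)" "\<lambda>s. (s, ?z s)" "(t, ?zl t)" "at_left t"]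
      by (simp add: flow_solution_def[abs_def])
  qed
  have cad: "cadlag (flow_solution A B C l y0)" using right left by (auto simp: cadlag_def continuous_within)
  have ll: "left_limit (flow_solution A B C l y0) t = flow B t (?zl t)" if "0 \<le> t" for t
    using left_limit_eqI[OF left, of t] that z(2)[of 0] by (cases "t = 0") (auto simp: flow_solution_def)
  have "flow_solution A B C l y0 t = y0 + (LBINT s:{0..t}. drift B (left_limit (flow_solution A B C l y0) s))
      + infsum (\<lambda>s. jump_coeff A C (left_limit (flow_solution A B C l y0) s) (jump l s)) {0..t}" if t: "0 \<le> t" for t
  proof -
    have "flow_solution A B C l y0 t = flow B t (y0 + infsum ?\<zeta> {0..t})" by (simp only: flow_solution_def J.solution_def)
    also have "\<dots> = y0 + (LBINT s:{0..t}. drift B (flow B s (y0 + infsum ?\<zeta> {0..<s}))) + infsum (\<lambda>s. flow B s (?\<zeta> s)) {0..t}"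
      by (rule variation_of_constants[OF t \<zeta>])
    also have "(LBINT s:{0..t}. drift B (flow B s (y0 + infsum ?\<zeta> {0..<s}))) = (LBINT s:{0..t}. drift B (left_limit (flow_solution A B C l y0) s))"
      by (rule set_lebesgue_integral_cong) (auto simp: ll J.left_solution_eq[OF l y0', symmetric])
    also have "infsum (\<lambda>s. flow B s (?\<zeta> s)) {0..t} = infsum (\<lambda>s. jump_coeff A C (left_limit (flow_solution A B C l y0) s) (jump l s)) {0..t}"
      by (rule infsum_cong) (simp add: ll flow_coeff_def flow_inverse)
    finally show ?thesis .
  qed
  moreover have psd: "psd (flow_solution A B C l y0 t)" if "0 \<le> t" for t
    using z(4)[OF that] by (simp add: flow_solution_def psd_flow)
  ultimately show "path_solution A B C l y0 (flow_solution A B C l y0)"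
    using cad by (simp add: path_solution_def)
  show "0 \<le> t \<Longrightarrow> psd (flow_solution A B C l y0 t - flow B t y0)"
    using z(3)[of t] by (simp add: flow_solution_def flow_diff[symmetric] psd_flow)
  show "finite_variation_path (flow_solution A B C l y0)"
    unfolding finite_variation_path_def
  proof (intro allI impI)
    fix T :: real assume T: "0 \<le> T"
    obtain M where M: "1 \<le> M" "\<And>s X. s \<in> {0..T} \<Longrightarrow> norm (flow B s X) \<le> M * norm X" using flow_bound[of T B] by metis
    obtain R where R: "\<And>s. s \<in> {0..T} \<Longrightarrow> norm (?z s) \<le> R" using cadlag_bounded[OF z(1)] by metis
    have R0: "0 \<le> R" using order_trans[OF norm_ge_zero R[of 0]] T by simp
    have "\<exists>V. \<forall>n \<tau>. mono \<tau> \<and> range \<tau> \<subseteq> {0..T} \<longrightarrow> (\<Sum>i<n. norm (?z (\<tau> (Suc i)) - ?z (\<tau> i))) \<le> V"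
      using z(5) T unfolding finite_variation_path_def by simp
    then obtain V where V: "\<And>n \<tau>. mono \<tau> \<Longrightarrow> range \<tau> \<subseteq> {0..T} \<Longrightarrow> (\<Sum>i<n. norm (?z (\<tau> (Suc i)) - ?z (\<tau> i))) \<le> V"
      by blast
    \<comment> \<open>A Lipschitz constant of the flow in time: its derivative is the drift of a
      matrix of norm at most \<open>M R\<close>.\<close>
    let ?k = "2 * norm B * (M * R)"
    have inc: "norm (flow_solution A B C l y0 b - flow_solution A B C l y0 a) \<le> M * norm (?z b - ?z a) + ?k * (b - a)"
      if ab: "0 \<le> a" "a \<le> b" "b \<le> T" for a b
    proof -
      have "norm (flow B b (?z a) - flow B a (?z a)) \<le> ?k * norm (b - a)"
      proof (rule differentiable_bound[where S = "{a..b}"])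
        show "((\<lambda>s. flow B s (?z a)) has_derivative (\<lambda>h. h *\<^sub>R drift B (flow B s (?z a)))) (at s within {a..b})" for s
          using has_vector_derivative_at_within[OF flow_derivative, of B "?z a" s "{a..b}"]
          unfolding has_vector_derivative_def by simp
        show "onorm (\<lambda>h. h *\<^sub>R drift B (flow B s (?z a))) \<le> ?k" if s: "s \<in> {a..b}" for s
        proof (rule onorm_le)
          have "norm (drift B (flow B s (?z a))) \<le> ?k"
            by (rule order_trans[OF norm_drift_le], intro mult_left_mono order_trans[OF M(2)])
               (use s ab M(1) R[of a] in auto)
          then have "\<bar>h\<bar> * norm (drift B (flow B s (?z a))) \<le> \<bar>h\<bar> * ?k" for h by (rule mult_left_mono) simp
          then show "norm (h *\<^sub>R drift B (flow B s (?z a))) \<le> ?k * norm h" for h by (simp add: mult.commute)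
        qed
      qed (use ab in auto)
      moreover have "norm (flow B b (?z b - ?z a)) \<le> M * norm (?z b - ?z a)" by (rule M(2)) (use ab in auto)
      moreover have "flow_solution A B C l y0 b - flow_solution A B C l y0 a = flow B b (?z b - ?z a) + (flow B b (?z a) - flow B a (?z a))"
        by (simp add: flow_solution_def flow_diff)
      ultimately show ?thesis
        using norm_triangle_ineq[of "flow B b (?z b - ?z a)" "flow B b (?z a) - flow B a (?z a)"] ab by simp
    qed
    show "\<exists>K. \<forall>n (\<tau> :: nat \<Rightarrow> real). mono \<tau> \<and> range \<tau> \<subseteq> {0..T} \<longrightarrow>
        (\<Sum>i<n. norm (flow_solution A B C l y0 (\<tau> (Suc i)) - flow_solution A B C l y0 (\<tau> i))) \<le> K"
    proof (intro exI[of _ "M * V + ?k * T"] allI impI, elim conjE)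
      fix n and \<tau> :: "nat \<Rightarrow> real" assume \<tau>: "mono \<tau>" "range \<tau> \<subseteq> {0..T}"
      have \<tau>': "0 \<le> \<tau> i" "\<tau> i \<le> T" "\<tau> i \<le> \<tau> (Suc i)" for i using \<tau> by (auto simp: mono_def subset_iff)
      have "(\<Sum>i<n. norm (flow_solution A B C l y0 (\<tau> (Suc i)) - flow_solution A B C l y0 (\<tau> i)))
          \<le> (\<Sum>i<n. M * norm (?z (\<tau> (Suc i)) - ?z (\<tau> i)) + ?k * (\<tau> (Suc i) - \<tau> i))"
        by (intro sum_mono inc \<tau>')
      also have "\<dots> = M * (\<Sum>i<n. norm (?z (\<tau> (Suc i)) - ?z (\<tau> i))) + ?k * (\<tau> n - \<tau> 0)"
        by (simp only: sum.distrib sum_distrib_left[symmetric] sum_lessThan_telescope)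
      also have "\<dots> \<le> M * V + ?k * T"
        using M(1) R0 \<tau>'(1)[of 0] \<tau>'(2)[of n] by (intro add_mono mult_left_mono V \<tau>) auto
      finally show "(\<Sum>i<n. norm (flow_solution A B C l y0 (\<tau> (Suc i)) - flow_solution A B C l y0 (\<tau> i))) \<le> M * V + ?k * T" .
    qed
  qed
qed

end

section \<open>Uniqueness of the solution on a path\<close>

context
  fixes A B C :: "real ^ 'd ^ 'd" and c :: real and l :: "real \<Rightarrow> real ^ 'd"
  assumes c: "0 < c" and C: "coercive c C" and l: "square_summable_jumps l"
begin

text \<open>Up to time \<open>a\<close> the left limits agree, so only the drift and the jumps on
  \<open>{a<..t}\<close> contribute. The bound \<open>D\<close> refers to times before
  \<open>t\<close>, because the integrands are left limits; with \<open>t = a\<close> and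
  \<open>D = 0\<close> the lemma therefore carries agreement on \<open>[0, a)\<close> over to
  \<open>a\<close>.\<close>

lemma path_solution_difference:
  fixes y y' :: "real \<Rightarrow> real ^ 'd ^ 'd"
  assumes y: "path_solution A B C l y0 y" "path_solution A B C l y0 y'"
    and R: "\<And>s. s \<in> {0..T} \<Longrightarrow> norm (y s) \<le> R" "\<And>s. s \<in> {0..T} \<Longrightarrow> norm (y' s) \<le> R"
    and K: "0 \<le> K" "\<And>Y Y' x. psd Y \<Longrightarrow> psd Y' \<Longrightarrow> norm Y \<le> R \<Longrightarrow> norm Y' \<le> R \<Longrightarrow>
      norm (jump_coeff A C Y x - jump_coeff A C Y' x) \<le> K * norm (Y - Y') * (norm x)\<^sup>2"
    and a: "0 \<le> a" "a \<le> t" "t \<le> T"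
    and D: "0 \<le> D" "\<And>s. 0 \<le> s \<Longrightarrow> s < a \<Longrightarrow> y s = y' s" "y 0 = y' 0" "\<And>s. a \<le> s \<Longrightarrow> s < t \<Longrightarrow> norm (y s - y' s) \<le> D"
  shows "norm (y t - y' t) \<le> D * (2 * norm B * (t - a) + K * infsum (\<lambda>s. (norm (jump l s))\<^sup>2) {a<..t})"
proof -
  let ?d = "\<lambda>s. left_limit y s - left_limit y' s"
  have cad: "cadlag y" "cadlag y'" and psd: "\<And>s. 0 \<le> s \<Longrightarrow> psd (y s)" "\<And>s. 0 \<le> s \<Longrightarrow> psd (y' s)"
    using y by (auto simp: path_solution_def)
  have RT: "norm (left_limit y s) \<le> R" "norm (left_limit y' s) \<le> R" if "s \<in> {0..T}" for s
    using left_limit_norm_le[OF cad(1) R(1) that] left_limit_norm_le[OF cad(2) R(2) that] by auto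
  have lpsd: "psd (left_limit y s)" "psd (left_limit y' s)" if "0 \<le> s" for s
    using psd_left_limit cad psd that by auto
  have d: "norm (?d s) \<le> (if a < s then D else 0)" if s: "s \<in> {0..t}" for s
  proof (cases "s = 0")
    case True
    then show ?thesis using D(1,3) by simp
  next
    case False
    then have s': "0 < s" using s by simp
    have lim: "((\<lambda>s. norm (y s - y' s)) \<longlongrightarrow> norm (?d s)) (at_left s)"
      by (intro tendsto_norm tendsto_diff tendsto_left_limit cad s')
    show ?thesis
    proof (rule tendsto_upperbound[OF lim])
      show "\<forall>\<^sub>F u in at_left s. norm (y u - y' u) \<le> (if a < s then D else 0)"
        using eventually_at_left_real[OF s']
      proof eventually_elim
        case (elim u)
        then show ?case using D(1) D(2)[of u] D(4)[of u] s by (cases "u < a") auto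
      qed
    qed simp
  qed
  have int: "set_integrable lborel {0..t} (\<lambda>s. drift B (left_limit f s))"
    if f: "cadlag f" "\<And>s. s \<in> {0..T} \<Longrightarrow> norm (f s) \<le> R" for f :: "real \<Rightarrow> real ^ 'd ^ 'd"
  proof (rule set_integrable_left_limits)
    show "((\<lambda>s. drift B (f s)) \<longlongrightarrow> drift B (left_limit f s)) (at_left s)" if "0 < s" for s
      by (rule bounded_linear.tendsto[OF bounded_linear_drift tendsto_left_limit[OF f(1) that]])
    show "norm (drift B (left_limit f s)) \<le> 2 * norm B * R" if "s \<in> {0..t}" for s
      by (rule order_trans[OF norm_drift_le], rule mult_left_mono[OF left_limit_norm_le[OF f(1) f(2)]])
         (use that a in auto)
  qed
  let ?J = "\<lambda>y s. jump_coeff A C (left_limit y s) (jump l s)"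
  have dl: "(\<lambda>s. (norm (jump l s))\<^sup>2) summable_on S" if "S \<subseteq> {0..t}" for S
    using l that by (auto simp: square_summable_jumps_def intro: summable_on_subset_banach)
  have sum: "?J f summable_on {0..t}"
    if f: "\<And>s. 0 \<le> s \<Longrightarrow> psd (left_limit f s)" "\<And>s. s \<in> {0..T} \<Longrightarrow> norm (left_limit f s) \<le> R" for f
  proof (rule abs_summable_summable, rule summable_on_comparison_test)
    let ?k = "(norm A)\<^sup>2 * ((norm C + R) * norm (mat 1 :: real ^ 'd ^ 'd))"
    show "(\<lambda>s. ?k * (norm (jump l s))\<^sup>2) summable_on {0..t}" by (rule summable_on_cmult_right[OF dl]) simp
    show "norm (?J f s) \<le> ?k * (norm (jump l s))\<^sup>2" if s: "s \<in> {0..t}" for s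
      by (rule order_trans[OF jump_coeff_growth[OF c C]])
         (use s a f in \<open>auto intro!: mult_right_mono mult_left_mono\<close>)
  qed simp
  have "y t - y' t = (LBINT s:{0..t}. drift B (?d s)) + infsum (\<lambda>s. ?J y s - ?J y' s) {0..t}"
  proof -
    have "(LBINT s:{0..t}. drift B (?d s)) = (LBINT s:{0..t}. drift B (left_limit y s)) - (LBINT s:{0..t}. drift B (left_limit y' s))"
      unfolding drift_diff by (rule set_integral_diff(2)[OF int[OF cad(1) R(1)] int[OF cad(2) R(2)]])
    moreover have "infsum (\<lambda>s. ?J y s - ?J y' s) {0..t} = infsum (?J y) {0..t} - infsum (?J y') {0..t}"
      by (rule infsum_diff[OF sum[OF lpsd(1) RT(1)] sum[OF lpsd(2) RT(2)]])
    moreover have "y t = y0 + (LBINT s:{0..t}. drift B (left_limit y s)) + infsum (?J y) {0..t}"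
      "y' t = y0 + (LBINT s:{0..t}. drift B (left_limit y' s)) + infsum (?J y') {0..t}"
      by (rule path_solutionD[OF y(1) order_trans[OF a(1,2)]] path_solutionD[OF y(2) order_trans[OF a(1,2)]])+
    ultimately show ?thesis by (simp only: add_diff_add diff_self add_0_left)
  qed
  moreover have "norm (LBINT s:{0..t}. drift B (?d s)) \<le> 2 * norm B * D * (t - a)"
  proof (rule norm_set_integral_le[OF _ a(1,2)])
    show "set_integrable lborel {0..t} (\<lambda>s. drift B (?d s))"
      unfolding drift_diff by (rule set_integral_diff(1)[OF int[OF cad(1) R(1)] int[OF cad(2) R(2)]])
    show "norm (drift B (?d s)) \<le> (if a < s then 2 * norm B * D else 0)" if "s \<in> {0..t}" for s
      using order_trans[OF norm_drift_le mult_left_mono[OF d[OF that]], of "B"] by (auto split: if_splits)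
  qed (use D(1) in simp)
  moreover have "norm (infsum (\<lambda>s. ?J y s - ?J y' s) {0..t}) \<le> K * D * infsum (\<lambda>s. (norm (jump l s))\<^sup>2) {a<..t}"
  proof -
    let ?g = "\<lambda>s. K * D * (norm (jump l s))\<^sup>2"
    have le: "norm (?J y s - ?J y' s) \<le> (if a < s then ?g s else 0)" if s: "s \<in> {0..t}" for s
    proof -
      have "norm (?J y s - ?J y' s) \<le> K * norm (?d s) * (norm (jump l s))\<^sup>2"
        by (rule K(2)) (use s a in \<open>auto intro!: lpsd RT\<close>)
      also have "\<dots> \<le> K * (if a < s then D else 0) * (norm (jump l s))\<^sup>2"
        by (rule mult_right_mono[OF mult_left_mono[OF d[OF s] K(1)]]) simp
      finally show ?thesis by (auto split: if_splits)
    qed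
    have gs: "?g summable_on {a<..t}" by (rule summable_on_cmult_right[OF dl]) (use a in auto)
    have eq: "infsum (\<lambda>s. if a < s then ?g s else 0) {0..t} = infsum ?g {a<..t}"
      by (rule infsum_cong_neutral) (use a in auto)
    have g: "(\<lambda>s. if a < s then ?g s else 0) summable_on {0..t}"
      by (rule summable_on_cong_neutral[THEN iffD1, rotated -1, OF gs]) (use a in auto)
    have n: "(\<lambda>s. ?J y s - ?J y' s) abs_summable_on {0..t}"
      by (rule summable_on_comparison_test[OF g le]) auto
    have "norm (infsum (\<lambda>s. ?J y s - ?J y' s) {0..t}) \<le> infsum (\<lambda>s. norm (?J y s - ?J y' s)) {0..t}"
      by (rule norm_infsum_bound[OF n])
    also have "\<dots> \<le> infsum (\<lambda>s. if a < s then ?g s else 0) {0..t}" by (rule infsum_mono[OF n g le])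
    also have "\<dots> = K * D * infsum (\<lambda>s. (norm (jump l s))\<^sup>2) {a<..t}"
      unfolding eq by (rule infsum_cmult_right[OF dl]) (use a in auto)
    finally show ?thesis .
  qed
  ultimately have "norm (y t - y' t) \<le> 2 * norm B * D * (t - a) + K * D * infsum (\<lambda>s. (norm (jump l s))\<^sup>2) {a<..t}"
    using norm_triangle_ineq[of "LBINT s:{0..t}. drift B (?d s)" "infsum (\<lambda>s. ?J y s - ?J y' s) {0..t}"] by simp
  then show ?thesis by (simp add: algebra_simps)
qed

lemma path_solution_initial:
  assumes "path_solution A B C l y0 y"
  shows "y 0 = y0"
proof -
  note eq = path_solutionD[OF assms order_refl]
  have "(LBINT s:{0..0}. drift B (left_limit y s)) = 0"
  proof -
    have "(LBINT s:{0..0}. drift B (left_limit y s)) = integral\<^sup>L lborel (\<lambda>s. 0 :: real ^ 'd ^ 'd)"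
      unfolding set_lebesgue_integral_def
      by (rule integral_eq_zero_AE[THEN trans]) (auto intro!: eventually_mono[OF AE_lborel_singleton[of 0]])
    then show ?thesis by simp
  qed
  moreover have "infsum (\<lambda>s. jump_coeff A C (left_limit y s) (jump l s)) {0..0} = 0"
    by (simp add: jump_coeff_def outer_def vec_eq_iff)
  ultimately show ?thesis by (subst eq) (simp only: add_0_right)
qed

text \<open>To the right of the last time up to which two solutions agree, drift and jumps put little mass on
  short intervals, so there the difference is at most half of its own supremum.\<close>

lemma path_solution_unique:
  fixes y y' :: "real \<Rightarrow> real ^ 'd ^ 'd"
  assumes y: "path_solution A B C l y0 y" "path_solution A B C l y0 y'" and t: "0 \<le> t"
  shows "y t = y' t"
proof -
  \<comment> \<open>One unit beyond \<open>t\<close>, so that agreement strictly before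
    \<open>T\<close> covers \<open>t\<close> itself.\<close>
  define T where "T = t + 1"
  have cad: "cadlag y" "cadlag y'" using y by (auto simp: path_solution_def)
  obtain R1 where R1: "\<And>s. s \<in> {0..T} \<Longrightarrow> norm (y s) \<le> R1" using cadlag_bounded[OF cad(1)] by metis
  obtain R2 where R2: "\<And>s. s \<in> {0..T} \<Longrightarrow> norm (y' s) \<le> R2" using cadlag_bounded[OF cad(2)] by metis
  define R where "R = max R1 R2"
  have R: "norm (y s) \<le> R" "norm (y' s) \<le> R" if "s \<in> {0..T}" for s
    using R1[OF that] R2[OF that] by (auto simp: R_def)
  obtain K where K: "0 \<le> K" "\<And>Y Y' x. psd Y \<Longrightarrow> psd Y' \<Longrightarrow> norm Y \<le> R \<Longrightarrow> norm Y' \<le> R \<Longrightarrow>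
      norm (jump_coeff A C Y x - jump_coeff A C Y' x) \<le> K * norm (Y - Y') * (norm x)\<^sup>2"
    using jump_coeff_lipschitz[OF c C, of R A] by metis
  note diff = path_solution_difference[where T = T, OF y R K]
  have y00: "y 0 = y' 0" using path_solution_initial y by metis
  define E where "E = {s \<in> {0..T}. \<forall>u\<in>{0..s}. y u = y' u}"
  have E0: "0 \<in> E" using y00 t by (auto simp: E_def T_def)
  have bdd: "bdd_above E" by (auto simp: E_def intro!: bdd_aboveI[of _ T])
  define \<tau> where "\<tau> = Sup E"
  have \<tau>0: "0 \<le> \<tau>" unfolding \<tau>_def by (rule cSup_upper[OF E0 bdd])
  have \<tau>T: "\<tau> \<le> T" unfolding \<tau>_def by (rule cSup_least) (use E0 in \<open>auto simp: E_def\<close>)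
  have before: "y u = y' u" if "0 \<le> u" "u < \<tau>" for u
  proof -
    obtain s where "s \<in> E" "u < s" using less_cSup_iff[of E u] E0 bdd \<open>u < \<tau>\<close> by (auto simp: \<tau>_def)
    then show ?thesis using that by (auto simp: E_def)
  qed
  have at: "y \<tau> = y' \<tau>"
    using diff[where a = \<tau> and t = \<tau> and D = 0] before y00 \<tau>0 \<tau>T by simp
  have upto: "y u = y' u" if "0 \<le> u" "u \<le> \<tau>" for u using before at that by (cases "u = \<tau>") auto
  have "\<tau> = T"
  proof (rule ccontr)
    assume "\<tau> \<noteq> T"
    then have lt: "\<tau> < T" using \<tau>T by simp
    let ?dl = "\<lambda>s. (norm (jump l s))\<^sup>2"
    have dl: "?dl abs_summable_on {0..u}" for u using l by (simp add: square_summable_jumps_def)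
    let ?m = "\<lambda>u. 2 * norm B * (u - \<tau>) + K * (infsum ?dl {0..u} - infsum ?dl {0..\<tau>})"
    have "(?m \<longlongrightarrow> 2 * norm B * (\<tau> - \<tau>) + K * (infsum ?dl {0..\<tau>} - infsum ?dl {0..\<tau>})) (at_right \<tau>)"
      by (intro tendsto_intros tendsto_infsum_at_right dl \<tau>0)
    then have "\<forall>\<^sub>F u in at_right \<tau>. ?m u < 1 / 2"
      by (rule order_tendstoD(2)) simp
    then obtain b where b: "\<tau> < b" "\<And>u. \<tau> < u \<Longrightarrow> u < b \<Longrightarrow> ?m u < 1 / 2"
      by (auto simp: eventually_at_right_field)
    define v where "v = min T ((\<tau> + b) / 2)"
    have v: "\<tau> < v" "v \<le> T" "v < b" using lt b(1) by (simp_all add: v_def min_less_iff_disj)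
    have m: "2 * norm B * (u - \<tau>) + K * infsum ?dl {\<tau><..u} \<le> 1 / 2" if "\<tau> \<le> u" "u \<le> v" for u
    proof (cases "u = \<tau>")
      case False
      then have "?m u < 1 / 2" using that v by (intro b(2)) auto
      then show ?thesis using infsum_atLeastAtMost_diff[OF dl \<tau>0, of u] that by simp
    qed simp
    define D where "D = (SUP u\<in>{\<tau>..v}. norm (y u - y' u))"
    have bddD: "bdd_above ((\<lambda>u. norm (y u - y' u)) ` {\<tau>..v})"
    proof (rule bdd_aboveI2)
      fix u assume "u \<in> {\<tau>..v}"
      then have "u \<in> {0..T}" using \<tau>0 v by auto
      then show "norm (y u - y' u) \<le> R + R"
        using norm_triangle_ineq4[of "y u" "y' u"] R[of u] by simp
    qed
    have leD: "norm (y u - y' u) \<le> D" if "u \<in> {\<tau>..v}" for u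
      unfolding D_def by (rule cSUP_upper[OF that bddD])
    have D0: "0 \<le> D" using order_trans[OF norm_ge_zero leD[of \<tau>]] v by simp
    have "norm (y u - y' u) \<le> D / 2" if u: "u \<in> {\<tau>..v}" for u
    proof -
      have "norm (y u - y' u) \<le> D * (2 * norm B * (u - \<tau>) + K * infsum ?dl {\<tau><..u})"
        by (rule diff) (use u v \<tau>0 D0 before y00 leD in auto)
      also have "\<dots> \<le> D * (1 / 2)" using u by (intro mult_left_mono m D0) auto
      finally show ?thesis by simp
    qed
    then have "(SUP u\<in>{\<tau>..v}. norm (y u - y' u)) \<le> D / 2" using v(1) by (intro cSUP_least) auto
    then have "D = 0" using D0 by (simp add: D_def[symmetric])
    then have "y u = y' u" if "u \<in> {\<tau>..v}" for u using leD[OF that] by simp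
    then have "v \<in> E" using upto v \<tau>0 by (force simp: E_def)
    then have "v \<le> \<tau>" unfolding \<tau>_def by (rule cSup_upper[OF _ bdd])
    then show False using v by simp
  qed
  then show ?thesis using before[of t] t by (simp add: T_def)
qed

end

subsection \<open>Square summability of the jumps of a Levy process\<close>

text \<open>Infinitely many large jumps would accumulate at some \<open>x\<close>. On either side of
  \<open>x\<close> the path stays within \<open>e / 3\<close> of its one-sided limit, so jumps there
  are at most \<open>2 e / 3\<close>.\<close>

lemma finite_large_jumps:
  fixes f :: "real \<Rightarrow> 'b::real_normed_vector"
  assumes f: "cadlag f" and e: "0 < e"
  shows "finite {s\<in>{0..t}. e \<le> norm (jump f s)}" (is "finite ?J")
proof (rule ccontr)
  assume inf: "infinite ?J"
  have "\<exists>x\<in>{0..t}. x islimpt ?J"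
    by (rule Heine_Borel_imp_Bolzano_Weierstrass[OF compact_Icc inf]) auto
  then obtain x where x: "x \<in> {0..t}" "x islimpt ?J" by blast
  obtain r where r: "0 < r"
    "\<And>s. 0 \<le> s \<Longrightarrow> x - r < s \<Longrightarrow> s < x \<Longrightarrow> norm (f s - left_limit f x) < e / 3"
    "\<And>s. x \<le> s \<Longrightarrow> s < x + r \<Longrightarrow> norm (f s - f x) < e / 3"
    using cadlag_near[OF f, of x "e / 3"] x(1) e by auto
  from x(2) obtain s where s: "s \<in> ?J" "s \<in> ball x r" "s \<noteq> x"
    using r(1) unfolding islimpt_approachable by (metis dist_commute mem_ball)
  have s0: "0 < s" using s e by (cases "s = 0") auto
  have small: "norm (jump f s) \<le> e / 3 + e / 3" if p: "\<forall>\<^sub>F u in at_left s. norm (f u - p) < e / 3" and q: "norm (f s - p) < e / 3" for p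
  proof -
    have "norm (left_limit f s - p) \<le> e / 3"
      by (rule tendsto_upperbound[OF tendsto_norm[OF tendsto_diff[OF tendsto_left_limit[OF f s0] tendsto_const]]])
         (use p in \<open>auto elim!: eventually_mono\<close>)
    moreover have "norm (jump f s) = norm ((f s - p) - (left_limit f s - p))" by (simp add: jump_def)
    ultimately show ?thesis using q norm_triangle_ineq4[of "f s - p" "left_limit f s - p"] by linarith
  qed
  have "norm (jump f s) \<le> e / 3 + e / 3"
  proof (cases "s < x")
    case True
    have "max 0 (x - r) < s" using s0 s by (auto simp: dist_real_def)
    from eventually_at_left_real[OF this]
    have "\<forall>\<^sub>F u in at_left s. norm (f u - left_limit f x) < e / 3"
    proof eventually_elim
      case (elim u)
      then show ?case using r(2)[of u] True by auto
    qed
    then show ?thesis by (rule small) (use r(2)[of s] s s0 True in \<open>auto simp: dist_real_def\<close>)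
  next
    case False
    then have "x < s" using s by simp
    from eventually_at_left_real[OF this]
    have "\<forall>\<^sub>F u in at_left s. norm (f u - f x) < e / 3"
    proof eventually_elim
      case (elim u)
      then show ?case using r(3)[of u] s by (auto simp: dist_real_def)
    qed
    then show ?thesis by (rule small) (use r(3)[of s] s \<open>x < s\<close> in \<open>auto simp: dist_real_def\<close>)
  qed
  with s(1) e show False by simp
qed

text \<open>The Taylor remainder is at most \<open>|x|^3 / 6 <= x^2 / 6\<close>, and
  \<open>1/2 - 1/6 = 1/3\<close>.\<close>

lemma one_minus_cos_ge:
  fixes x :: real
  assumes "\<bar>x\<bar> \<le> 1"
  shows "x\<^sup>2 / 3 \<le> 1 - cos x"
proof -
  have "cmod (iexp x - (\<Sum>k\<le>2. (\<i> * x)^k / fact k)) \<le> \<bar>x\<bar>^(Suc 2) / fact (Suc 2)" by (rule iexp_approx1)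
  then have "\<bar>Re (iexp x - (\<Sum>k\<le>2. (\<i> * x)^k / fact k))\<bar> \<le> \<bar>x\<bar> ^ 3 / 6"
    using abs_Re_le_cmod[of "iexp x - (\<Sum>k\<le>2. (\<i> * x)^k / fact k)"] by (simp add: eval_nat_numeral)
  moreover have "Re (iexp x - (\<Sum>k\<le>2. (\<i> * x)^k / fact k)) = cos x - (1 - x\<^sup>2 / 2)"
    by (simp add: eval_nat_numeral Re_exp power2_eq_square)
  moreover have "\<bar>x\<bar> ^ 3 \<le> x\<^sup>2"
    using mult_left_le[OF assms, of "x\<^sup>2"] by (simp add: power3_eq_cube power2_eq_square abs_mult_self_eq)
  ultimately show ?thesis by linarith
qed

text \<open>A continuous \<open>n\<close>-th root of a characteristic function near the origin is the exponential of
  the \<open>n\<close>-th part of its principal logarithm, since it cannot change branch.\<close>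

lemma root_of_char_bound:
  fixes \<phi> \<psi> :: "real \<Rightarrow> complex"
  assumes cont: "continuous_on {0..r} \<phi>" "continuous_on {0..r} \<psi>" and r: "0 \<le> r"
    and re: "\<And>\<theta>. \<theta> \<in> {0..r} \<Longrightarrow> 0 < Re (\<phi> \<theta>)" and one: "\<psi> 0 = 1"
    and pow: "\<And>\<theta>. \<theta> \<in> {0..r} \<Longrightarrow> \<psi> \<theta> ^ n = \<phi> \<theta>" and n: "0 < n"
  shows "real n * (1 - Re (\<psi> r)) \<le> exp (norm (Ln (\<phi> r))) * norm (Ln (\<phi> r))"
proof -
  define g where "g \<theta> = \<psi> \<theta> * exp (- (Ln (\<phi> \<theta>) / of_nat n))" for \<theta>
  have nz: "\<phi> \<theta> \<notin> \<real>\<^sub>\<le>\<^sub>0" if "\<theta> \<in> {0..r}" for \<theta>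
    using re[OF that] by (auto simp: complex_nonpos_Reals_iff)
  have gc: "continuous_on {0..r} g"
    unfolding g_def by (intro continuous_intros cont continuous_on_Ln) (use nz n in auto)
  have gn: "g \<theta> ^ n = 1" if "\<theta> \<in> {0..r}" for \<theta>
  proof -
    have "g \<theta> ^ n = \<phi> \<theta> * exp (of_nat n * (- (Ln (\<phi> \<theta>) / of_nat n)))"
      by (simp only: g_def power_mult_distrib pow[OF that] exp_of_nat_mult)
    also have "of_nat n * (- (Ln (\<phi> \<theta>) / of_nat n)) = - Ln (\<phi> \<theta>)" using n by simp
    also have "\<phi> \<theta> * exp (- Ln (\<phi> \<theta>)) = 1"
    proof -
      have "\<phi> \<theta> \<noteq> 0" using re[OF that] by auto
      then show ?thesis by (simp add: exp_minus)
    qed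
    finally show ?thesis .
  qed
  \<comment> \<open>\<open>g\<close> takes values in the \<open>n\<close>-th roots of unity; being
    continuous on an interval, it is constant.\<close>
  have "finite (g ` {0..r})"
    by (rule finite_subset[OF _ finite_roots_unity[of n]]) (use gn n in auto)
  then have "g constant_on {0..r}"
    using continuous_finite_range_constant[of "{0..r}" g] gc by simp
  then have "g r = g 0" using r unfolding constant_on_def by auto
  also have "g 0 = 1" using pow[of 0] r by (simp add: g_def one power_one[of n] flip: pow)
  finally have \<psi>r: "\<psi> r = exp (Ln (\<phi> r) / of_nat n)"
    by (simp add: g_def exp_minus field_simps)
  \<comment> \<open>The estimate \<open>|exp w - 1| <= exp |Re w| |w|\<close> with
    \<open>w = Ln (\<phi> r) / n\<close> gives, after multiplication by \<open>n\<close>, a bound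
    free of \<open>n\<close>.\<close>
  let ?z = "Ln (\<phi> r)" and ?w = "Ln (\<phi> r) / of_nat n"
  have "1 - Re (\<psi> r) \<le> norm (exp ?w - 1)"
    using abs_Re_le_cmod[of "exp ?w - 1"] by (simp add: \<psi>r)
  also have "\<dots> \<le> exp \<bar>Re ?w\<bar> * norm ?w" using Taylor_exp[of ?w 0] by simp
  also have "\<dots> \<le> exp (norm ?z) * norm ?w"
  proof (intro mult_right_mono norm_ge_zero)
    have "\<bar>Re ?w\<bar> \<le> norm ?w" by (rule abs_Re_le_cmod)
    also have "\<dots> \<le> norm ?z" using n mult_left_mono[of 1 "real n" "norm ?z"] by (simp add: norm_divide divide_le_eq)
    finally show "exp \<bar>Re ?w\<bar> \<le> exp (norm ?z)" by simp
  qed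
  finally have "real n * (1 - Re (\<psi> r)) \<le> real n * (exp (norm ?z) * norm ?w)"
    by (intro mult_left_mono) auto
  also have "\<dots> = exp (norm ?z) * norm ?z" using n by (simp add: norm_divide)
  finally show ?thesis .
qed

lemma (in prob_space) expectation_one_minus_cos:
  assumes [measurable]: "random_variable borel X"
  shows "(\<integral>\<^sup>+\<omega>. ennreal (1 - cos (\<theta> * X \<omega>)) \<partial>M) = ennreal (1 - Re (char (distr M borel X) \<theta>))"
proof -
  have int: "integrable M (\<lambda>\<omega>. cos (\<theta> * X \<omega>))"
    by (rule integrable_const_bound[of _ 1]) auto
  have iint: "integrable M (\<lambda>\<omega>. iexp (\<theta> * X \<omega>))"
    by (rule integrable_const_bound[of _ 1]) auto
  have "char (distr M borel X) \<theta> = (CLINT \<omega>|M. iexp (\<theta> * X \<omega>))"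
    unfolding char_def by (subst integral_distr) auto
  then have "Re (char (distr M borel X) \<theta>) = (LINT \<omega>|M. Re (iexp (\<theta> * X \<omega>)))"
    using iint by simp
  also have "\<dots> = (LINT \<omega>|M. cos (\<theta> * X \<omega>))"
    by (simp add: Re_exp)
  finally have Re: "Re (char (distr M borel X) \<theta>) = (LINT \<omega>|M. cos (\<theta> * X \<omega>))" .
  have "(\<integral>\<^sup>+\<omega>. ennreal (1 - cos (\<theta> * X \<omega>)) \<partial>M) = ennreal (LINT \<omega>|M. 1 - cos (\<theta> * X \<omega>))"
    by (rule nn_integral_eq_integral) (use int in auto)
  then show ?thesis using int by (simp add: Re prob_space)
qed

text \<open>All terms are nonnegative, so the cells that contain a finite set of times already bound
  the sum over this set by the \<open>liminf\<close>. The remaining increments, such as those of a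
  continuous part, are dropped.\<close>

lemma summable_one_minus_cos_jumps:
  fixes x :: "real \<Rightarrow> real"
  assumes x: "cadlag x" and t: "0 < t"
    and fin: "liminf (\<lambda>n. ennreal (\<Sum>i<n. 1 - cos (r * grid_increment x t n i))) < \<infinity>"
  shows "(\<lambda>s. 1 - cos (r * jump x s)) summable_on {0<..t}"
proof -
  let ?f = "\<lambda>s. 1 - cos (r * jump x s)"
  let ?u = "\<lambda>n i. 1 - cos (r * grid_increment x t n i)"
  define k where "k = enn2real (liminf (\<lambda>n. ennreal (\<Sum>i<n. ?u n i)))"
  have k: "liminf (\<lambda>n. ennreal (\<Sum>i<n. ?u n i)) = ennreal k" "0 \<le> k" using fin by (simp_all add: k_def)
  have "sum ?f S \<le> k" if S: "finite S" "S \<subseteq> {0<..t}" for S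
  proof -
    have "(\<lambda>n. \<Sum>i\<in>grid_index t n ` S. ?u n i) \<longlonglongrightarrow> sum ?f S"
      by (rule tendsto_grid_sum[OF S])
         (use S in \<open>auto intro!: tendsto_intros tendsto_grid_increment[OF x]\<close>)
    then have "liminf (\<lambda>n. ennreal (\<Sum>i\<in>grid_index t n ` S. ?u n i)) = ennreal (sum ?f S)"
      by (intro lim_imp_Liminf tendsto_ennrealI) simp_all
    moreover have "liminf (\<lambda>n. ennreal (\<Sum>i\<in>grid_index t n ` S. ?u n i)) \<le> liminf (\<lambda>n. ennreal (\<Sum>i<n. ?u n i))"
    proof (rule Liminf_mono, rule eventually_mono[OF eventually_gt_at_top[of 0]])
      fix n :: nat assume "0 < n"
      then have "grid_index t n ` S \<subseteq> {..<n}" using S grid_index(3)[of _ t n] by auto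
      then show "ennreal (\<Sum>i\<in>grid_index t n ` S. ?u n i) \<le> ennreal (\<Sum>i<n. ?u n i)"
        by (intro ennreal_leI sum_mono2) auto
    qed
    ultimately show ?thesis using k by simp
  qed
  then show ?thesis
    by (intro nonneg_bdd_above_summable_on) (auto intro!: bdd_aboveI[of _ k])
qed

text \<open>Large jumps get no lower bound from \<open>1 - cos\<close>, which vanishes at multiples
  of \<open>2 pi\<close>, but by \<open>finite_large_jumps\<close> there are finitely many. The
  others satisfy \<open>|r x| <= 1\<close>, where \<open>one_minus_cos_ge\<close> gives the factor
  \<open>3 / r^2\<close>.\<close>

lemma square_summable_real_jumps:
  fixes x :: "real \<Rightarrow> real"
  assumes x: "cadlag x" and r: "0 < r" and sum: "(\<lambda>s. 1 - cos (r * jump x s)) summable_on {0<..t}"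
  shows "(\<lambda>s. (jump x s)\<^sup>2) summable_on {0..t}"
proof -
  let ?J = "{s\<in>{0..t}. 1 / r \<le> norm (jump x s)}"
  have fin: "finite ?J" by (rule finite_large_jumps[OF x]) (use r in simp)
  have "(\<lambda>s. 3 / r\<^sup>2 * (1 - cos (r * jump x s))) summable_on ({0<..t} - ?J)"
    by (rule summable_on_cmult_right, rule summable_on_subset_banach[OF sum]) auto
  then have "(\<lambda>s. (jump x s)\<^sup>2) summable_on ({0<..t} - ?J)"
  proof (rule summable_on_comparison_test)
    fix s assume "s \<in> {0<..t} - ?J"
    then have "\<bar>jump x s\<bar> < 1 / r" by auto
    then have "\<bar>r * jump x s\<bar> \<le> 1" using r by (simp add: abs_mult field_simps)
    from one_minus_cos_ge[OF this]
    show "(jump x s)\<^sup>2 \<le> 3 / r\<^sup>2 * (1 - cos (r * jump x s))" using r by (simp add: power_mult_distrib field_simps)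
  qed simp
  then have "(\<lambda>s. (jump x s)\<^sup>2) summable_on ({0<..t} - ?J \<union> (?J \<union> {0}))"
    by (rule summable_on_union) (use fin in simp)
  then show ?thesis by (rule summable_on_subset_banach) auto
qed

lemma borel_measurable_vec_nth:
  fixes f :: "'x \<Rightarrow> real ^ 'd"
  assumes "f \<in> borel_measurable N"
  shows "(\<lambda>x. f x $ j) \<in> borel_measurable N"
  by (rule measurable_compose[OF assms borel_measurable_continuous_onI]) (intro continuous_intros)

context usual_filtered_prob_space
begin

lemma measurable_from_F: "0 \<le> t \<Longrightarrow> f \<in> borel_measurable (F t) \<Longrightarrow> f \<in> borel_measurable M"
  by (rule measurable_from_subalg[OF subalgebra_F])

section \<open>Characteristic functions of the coordinates of a Levy process\<close>

context
  fixes L :: "real \<Rightarrow> 'a \<Rightarrow> real ^ 'd" and j :: 'd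
  assumes L: "levy_process M F L"
begin

abbreviation "coord s \<equiv> \<lambda>\<omega>. L s \<omega> $ j"

lemma levy_adapted: "0 \<le> s \<Longrightarrow> L s \<in> borel_measurable (F s)"
  using L by (auto simp: levy_process_def cadlag_process_def adapted_def)

lemma measurable_coord_F: "0 \<le> s \<Longrightarrow> coord s \<in> borel_measurable (F s)"
  by (intro borel_measurable_vec_nth levy_adapted)

lemma measurable_coord: "0 \<le> s \<Longrightarrow> coord s \<in> borel_measurable M"
  using measurable_from_F measurable_coord_F by blast

lemma distr_coord_increment:
  assumes "0 \<le> s" "0 \<le> h"
  shows "distr M borel (\<lambda>\<omega>. coord (s + h) \<omega> - coord s \<omega>) = distr M borel (coord h)"
proof -
  have m: "L u \<in> borel_measurable M" if "0 \<le> u" for u using levy_adapted[OF that] measurable_from_F that by blast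
  have n: "(\<lambda>v :: real ^ 'd. v $ j) \<in> borel_measurable borel" by (rule borel_measurable_vec_nth) simp
  have d: "distr M borel (\<lambda>\<omega>. L (s + h) \<omega> - L s \<omega>) = distr M borel (L h)"
  proof -
    have "\<forall>s\<ge>0. \<forall>t\<ge>s. distr M borel (\<lambda>\<omega>. L t \<omega> - L s \<omega>) = distr M borel (L (t - s))"
      using L unfolding levy_process_def by (elim conjE)
    from this[rule_format, of s "s + h"] assms show ?thesis by simp
  qed
  have "distr M borel (\<lambda>\<omega>. coord (s + h) \<omega> - coord s \<omega>) = distr (distr M borel (\<lambda>\<omega>. L (s + h) \<omega> - L s \<omega>)) borel (\<lambda>v. v $ j)"
    by (subst distr_distr[OF n]) (use assms m in \<open>auto simp: o_def intro!: borel_measurable_diff\<close>)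
  also have "\<dots> = distr M borel (coord h)"
    unfolding d by (subst distr_distr[OF n]) (use assms m in \<open>auto simp: o_def\<close>)
  finally show ?thesis .
qed

text \<open>Coordinates generate sub-sigma-algebras of those that \<open>levy_process\<close>
  declares independent.\<close>

lemma indep_coord_increment:
  assumes "0 \<le> s" "0 \<le> h"
  shows "indep_var borel (coord s) borel (\<lambda>\<omega>. coord (s + h) \<omega> - coord s \<omega>)"
proof -
  let ?inc = "\<lambda>\<omega>. L (s + h) \<omega> - L s \<omega>" and ?x = "\<lambda>\<omega>. coord (s + h) \<omega> - coord s \<omega>"
  let ?V = "vimage_algebra (space M) ?inc borel"
  have "\<forall>s\<ge>0. \<forall>t\<ge>s. indep_set (sets (F s)) (sets (vimage_algebra (space M) (\<lambda>\<omega>. L t \<omega> - L s \<omega>) borel))"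
    using L unfolding levy_process_def by (elim conjE)
  from this[rule_format, of s "s + h"] assms
  have ind: "indep_sets (case_bool (sets (F s)) (sets ?V)) UNIV" by (simp add: indep_set_def)
  have "indep_set (sigma_sets (space M) {coord s -` A \<inter> space M |A. A \<in> sets borel})
      (sigma_sets (space M) {?x -` A \<inter> space M |A. A \<in> sets borel})"
    unfolding indep_set_def
  proof (rule indep_sets_mono_sets[OF ind])
    have 1: "sigma_sets (space M) {coord s -` A \<inter> space M |A. A \<in> sets borel} \<subseteq> sets (F s)"
    proof -
      have "{coord s -` A \<inter> space M |A. A \<in> sets borel} \<subseteq> sets (F s)"
        using measurable_sets[OF measurable_coord_F[OF assms(1)]] by (auto simp: space_F)
      then show ?thesis using sets.sigma_sets_subset[of _ "F s"] by (simp add: space_F)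
    qed
    have 2: "sigma_sets (space M) {?x -` A \<inter> space M |A. A \<in> sets borel} \<subseteq> sets ?V"
    proof -
      have inc: "?inc \<in> borel_measurable ?V" by (rule measurable_vimage_algebra1) simp
      have "?x \<in> borel_measurable ?V"
        using borel_measurable_vec_nth[OF inc, of j] by simp
      then have "{?x -` A \<inter> space M |A. A \<in> sets borel} \<subseteq> sets ?V"
        using measurable_sets[of ?x ?V borel] by auto
      then show ?thesis using sets.sigma_sets_subset[of _ ?V] by simp
    qed
    fix b :: bool
    show "case_bool (sigma_sets (space M) {coord s -` A \<inter> space M |A. A \<in> sets borel})
        (sigma_sets (space M) {?x -` A \<inter> space M |A. A \<in> sets borel}) b \<subseteq> case_bool (sets (F s)) (sets ?V) b"
      using 1 2 by (cases b) auto
  qed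
  then show ?thesis
    unfolding indep_var_eq using assms measurable_coord by (auto intro!: borel_measurable_diff)
qed

lemma char_coord_add:
  assumes "0 \<le> s" "0 \<le> h"
  shows "char (distr M borel (coord (s + h))) \<theta> = char (distr M borel (coord s)) \<theta> * char (distr M borel (coord h)) \<theta>"
  using char_distr_add[OF indep_coord_increment[OF assms], of \<theta>] unfolding distr_coord_increment[OF assms] by simp

lemma char_coord_0: "char (distr M borel (coord 0)) \<theta> = 1"
proof -
  have "AE \<omega> in M. L 0 \<omega> = 0" using L unfolding levy_process_def by (elim conjE)
  have "char (distr M borel (coord 0)) \<theta> = (CLINT \<omega>|M. iexp (\<theta> * coord 0 \<omega>))"
    unfolding char_def using measurable_coord[of 0] by (subst integral_distr) auto
  also have "\<dots> = (CLINT \<omega>|M. 1)"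
    by (rule integral_cong_AE) (use \<open>AE \<omega> in M. L 0 \<omega> = 0\<close> measurable_coord[of 0] in auto)
  finally show ?thesis by (simp add: prob_space)
qed

lemma char_coord_power:
  assumes "0 \<le> h"
  shows "char (distr M borel (coord (real n * h))) \<theta> = char (distr M borel (coord h)) \<theta> ^ n"
proof (induction n)
  case (Suc n)
  have "real (Suc n) * h = real n * h + h" by (simp add: algebra_simps)
  then show ?case using char_coord_add[of "real n * h" h \<theta>] assms Suc by simp
qed (simp add: char_coord_0)

lemma AE_coord_square_summable:
  assumes t: "0 < t"
  shows "AE \<omega> in M. cadlag (\<lambda>s. coord s \<omega>) \<longrightarrow> (\<lambda>s. (jump (\<lambda>s. coord s \<omega>) s)\<^sup>2) summable_on {0..t}"
proof -
  let ?\<phi> = "\<lambda>h \<theta>. char (distr M borel (coord h)) \<theta>"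
  have real_distr: "real_distribution (distr M borel (coord h))" if "0 \<le> h" for h
    by (rule real_distribution_distr[OF measurable_coord[OF that]])
  have cont: "isCont (?\<phi> h) \<theta>" if "0 \<le> h" for h \<theta> by (rule real_distribution.isCont_char[OF real_distr[OF that]])
  have zero: "?\<phi> h 0 = 1" if "0 \<le> h" for h by (rule real_distribution.char_zero[OF real_distr[OF that]])
  have "\<forall>\<^sub>F \<theta> in at 0. dist (?\<phi> t \<theta>) (?\<phi> t 0) < 1"
    using cont[of t 0] t by (intro tendstoD) (auto simp: isCont_def)
  then obtain d where d: "0 < d" "\<And>\<theta>. \<theta> \<noteq> 0 \<Longrightarrow> dist \<theta> 0 < d \<Longrightarrow> dist (?\<phi> t \<theta>) 1 < 1"
    using zero[of t] t by (auto simp: eventually_at)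
  \<comment> \<open>Half of \<open>d\<close> keeps the closed interval \<open>{0..r}\<close> in the
    range where the characteristic function at time \<open>t\<close> is within \<open>1\<close> of
    its value at \<open>0\<close> and so has positive real part.\<close>
  define r where "r = d / 2"
  have r: "0 < r" using d by (simp add: r_def)
  have re: "0 < Re (?\<phi> t \<theta>)" if "\<theta> \<in> {0..r}" for \<theta>
  proof -
    have "dist (?\<phi> t \<theta>) 1 < 1" using d(2)[of \<theta>] that r zero[of t] t by (cases "\<theta> = 0") (auto simp: r_def)
    then have "\<bar>Re (?\<phi> t \<theta> - 1)\<bar> < 1" using abs_Re_le_cmod[of "?\<phi> t \<theta> - 1"] by (simp add: dist_norm)
    then show ?thesis by simp
  qed
  \<comment> \<open>The bound of \<open>root_of_char_bound\<close>, which depends on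
    \<open>t\<close> and \<open>r\<close> but not on the number of cells.\<close>
  define c where "c = exp (norm (Ln (?\<phi> t r))) * norm (Ln (?\<phi> t r))"
  define S where "S n \<omega> = ennreal (\<Sum>i<n. 1 - cos (r * grid_increment (\<lambda>s. coord s \<omega>) t n i))" for n \<omega>
  have m: "(\<lambda>\<omega>. grid_increment (\<lambda>s. coord s \<omega>) t n i) \<in> borel_measurable M" for n i
    using t by (intro borel_measurable_diff measurable_coord) auto
  have Sm: "S n \<in> borel_measurable M" for n unfolding S_def using m by measurable
  have "(\<integral>\<^sup>+\<omega>. S n \<omega> \<partial>M) \<le> ennreal c" for n
  proof (cases "n = 0")
    case False
    then have n: "0 < n" by simp
    let ?h = "t / real n"
    have "(\<integral>\<^sup>+\<omega>. S n \<omega> \<partial>M) = (\<Sum>i<n. \<integral>\<^sup>+\<omega>. ennreal (1 - cos (r * grid_increment (\<lambda>s. coord s \<omega>) t n i)) \<partial>M)"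
      unfolding S_def using m by (subst nn_integral_sum[symmetric]) (auto simp: sum_ennreal)
    also have "\<dots> = (\<Sum>i<n. ennreal (1 - Re (?\<phi> ?h r)))"
    proof (rule sum.cong[OF refl])
      fix i
      have "distr M borel (\<lambda>\<omega>. grid_increment (\<lambda>s. coord s \<omega>) t n i) = distr M borel (coord ?h)"
        using distr_coord_increment[of "grid_left t n i" ?h] t n by (simp add: grid_left_Suc)
      then show "(\<integral>\<^sup>+\<omega>. ennreal (1 - cos (r * grid_increment (\<lambda>s. coord s \<omega>) t n i)) \<partial>M) = ennreal (1 - Re (?\<phi> ?h r))"
        using expectation_one_minus_cos[OF m, of r n i] by simp
    qed
    also have "\<dots> = ennreal (real n * (1 - Re (?\<phi> ?h r)))"
    proof -
      have "Re (?\<phi> ?h r) \<le> 1"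
        using order_trans[OF complex_Re_le_cmod real_distribution.cmod_char_le_1[OF real_distr[of ?h], of r]] t by simp
      then show ?thesis by (simp add: ennreal_mult ennreal_of_nat_eq_real_of_nat)
    qed
    also have "\<dots> \<le> ennreal c"
      unfolding c_def
    proof (intro ennreal_leI root_of_char_bound)
      show "continuous_on {0..r} (?\<phi> t)" "continuous_on {0..r} (?\<phi> ?h)"
        using cont t by (auto intro!: continuous_at_imp_continuous_on)
      show "?\<phi> ?h \<theta> ^ n = ?\<phi> t \<theta>" for \<theta> using char_coord_power[of ?h n \<theta>] t n by simp
      show "?\<phi> ?h 0 = 1" using zero t by simp
    qed (use r re n in auto)
    finally show ?thesis .
  qed (simp add: S_def c_def)
  then have "liminf (\<lambda>n. \<integral>\<^sup>+\<omega>. S n \<omega> \<partial>M) \<le> ennreal c"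
    by (intro order_trans[OF Liminf_le_Limsup Limsup_bounded]) auto
  with nn_integral_liminf[of S M] Sm have "(\<integral>\<^sup>+\<omega>. liminf (\<lambda>n. S n \<omega>) \<partial>M) \<le> ennreal c"
    by (meson order_trans)
  then have "(\<integral>\<^sup>+\<omega>. liminf (\<lambda>n. S n \<omega>) \<partial>M) \<noteq> \<infinity>" by (auto simp: top_unique)
  then have "AE \<omega> in M. liminf (\<lambda>n. S n \<omega>) \<noteq> \<infinity>"
    using Sm by (intro nn_integral_PInf_AE) auto
  then show ?thesis
  proof eventually_elim
    case (elim \<omega>)
    show ?case
    proof
      assume cad: "cadlag (\<lambda>s. coord s \<omega>)"
      show "(\<lambda>s. (jump (\<lambda>s. coord s \<omega>) s)\<^sup>2) summable_on {0..t}"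
        by (rule square_summable_real_jumps[OF cad r summable_one_minus_cos_jumps[OF cad t]])
           (use elim in \<open>simp add: S_def less_top\<close>)
    qed
  qed
qed

end

text \<open>Finitely many coordinates and countably many horizons leave a single null set;
  \<open>Suc m\<close> makes each horizon positive, as the lemma for one coordinate demands.\<close>

lemma levy_square_summable_jumps:
  fixes L :: "real \<Rightarrow> 'a \<Rightarrow> real ^ 'd"
  assumes L: "levy_process M F L"
  shows "AE \<omega> in M. cadlag (\<lambda>s. L s \<omega>) \<and> square_summable_jumps (\<lambda>s. L s \<omega>)"
proof -
  have cad: "AE \<omega> in M. cadlag (\<lambda>s. L s \<omega>)" using L by (auto simp: levy_process_def cadlag_process_def)
  have "AE \<omega> in M. \<forall>j m. cadlag (\<lambda>s. L s \<omega> $ j) \<longrightarrow> (\<lambda>s. (jump (\<lambda>s. L s \<omega> $ j) s)\<^sup>2) summable_on {0..real (Suc m)}"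
    unfolding AE_all_countable using AE_coord_square_summable[OF L] by simp
  with cad show ?thesis
  proof eventually_elim
    case (elim \<omega>)
    have comp: "cadlag (\<lambda>s. L s \<omega> $ j)" "0 \<le> s \<Longrightarrow> jump (\<lambda>s. L s \<omega> $ j) s = jump (\<lambda>s. L s \<omega>) s $ j" for j s
      using cadlag_continuous_map[OF elim(1) closed_UNIV _ linear_continuous_on[OF bounded_linear_vec_nth[of j]]]
      by (simp_all add: jump_def)
    have "(\<lambda>s. (norm (jump (\<lambda>s. L s \<omega>) s))\<^sup>2) summable_on {0..t}" for t
    proof -
      obtain m where m: "t \<le> real m" using real_arch_simple by blast
      have "(\<lambda>s. \<Sum>j\<in>UNIV. (jump (\<lambda>s. L s \<omega> $ j) s)\<^sup>2) summable_on {0..real (Suc m)}"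
        by (rule infsum_sum_finite(1)) (use elim(2) comp(1) in auto)
      then have "(\<lambda>s. (norm (jump (\<lambda>s. L s \<omega>) s))\<^sup>2) summable_on {0..real (Suc m)}"
      proof (rule summable_on_cong[THEN iffD1, rotated])
        fix s assume "s \<in> {0..real (Suc m)}"
        moreover have "(norm v)\<^sup>2 = (\<Sum>j\<in>UNIV. (v $ j)\<^sup>2)" for v :: "real ^ 'd"
          by (simp add: power2_norm_eq_inner inner_vec_def) (simp add: power2_eq_square)
        ultimately show "(\<Sum>j\<in>UNIV. (jump (\<lambda>s. L s \<omega> $ j) s)\<^sup>2) = (norm (jump (\<lambda>s. L s \<omega>) s))\<^sup>2"
          by (simp add: comp(2))
      qed
      then show ?thesis by (rule summable_on_subset_banach) (use m in auto)
    qed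
    with elim(1) show ?case by (simp add: square_summable_jumps_def)
  qed
qed

end

subsection \<open>Existence and uniqueness\<close>

context usual_filtered_prob_space
begin

text \<open>\<open>T n\<close> is the first passage of the norm above \<open>n\<close>, capped at
  \<open>n\<close>. An unbounded initial value does no harm, since the bound is required only before
  \<open>T n\<close>, and \<open>T n\<close> may be \<open>0\<close>.\<close>

lemma cadlag_locally_bounded:
  fixes Y :: "real \<Rightarrow> 'a \<Rightarrow> 'b::{real_normed_vector, second_countable_topology}"
  assumes Y: "adapted F Y" and cad: "\<And>\<omega>. \<omega> \<in> space M \<Longrightarrow> cadlag (\<lambda>t. Y t \<omega>)"
  shows "locally_bounded M F Y"
proof -
  \<comment> \<open>Rational times make the passage event a countable union, and by right continuity
    of the paths they miss no excess. The element \<open>n\<close> keeps the set nonempty and the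
    infimum at most \<open>n\<close>.\<close>
  define E where "E n \<omega> = insert (real n) {q \<in> \<rat>. 0 \<le> q \<and> real n < norm (Y q \<omega>)}" for n \<omega>
  define T where "T n \<omega> = Inf (E n \<omega>)" for n \<omega>
  have bdd: "bdd_below (E n \<omega>)" for n \<omega> by (rule bdd_belowI[of _ 0]) (auto simp: E_def)
  have ne: "E n \<omega> \<noteq> {}" for n \<omega> by (simp add: E_def)
  have T0: "0 \<le> T n \<omega>" for n \<omega>
    unfolding T_def by (rule cInf_greatest[OF ne]) (auto simp: E_def)
  have T_less: "T n \<omega> < t \<longleftrightarrow> real n < t \<or> (\<exists>q\<in>\<rat> \<inter> {0..<t}. real n < norm (Y q \<omega>))" for n \<omega> t
    unfolding T_def cInf_less_iff[OF ne bdd] by (auto simp: E_def)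
  have Yn: "(\<lambda>\<omega>. norm (Y q \<omega>)) \<in> borel_measurable (F t)" if "0 \<le> q" "q \<le> t" for q t
    using Y that by (intro borel_measurable_norm measurable_F_mono[of _ q t]) (auto simp: adapted_def)
  have less: "{\<omega> \<in> space M. T n \<omega> < t} \<in> sets (F u)" if tu: "t \<le> u" for n t u
  proof -
    have "{\<omega> \<in> space M. T n \<omega> < t} = {\<omega> \<in> space (F u). real n < t} \<union>
        (\<Union>q\<in>\<rat> \<inter> {0..<t}. {\<omega> \<in> space (F u). real n < norm (Y q \<omega>)})"
      unfolding T_less by (auto simp: space_F)
    also have "\<dots> \<in> sets (F u)"
    proof (rule sets.Un)
      show "{\<omega> \<in> space (F u). real n < t} \<in> sets (F u)" by (cases "real n < t") auto
      show "(\<Union>q\<in>\<rat> \<inter> {0..<t}. {\<omega> \<in> space (F u). real n < norm (Y q \<omega>)}) \<in> sets (F u)"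
      proof (rule sets.countable_UN'')
        show "countable (\<rat> \<inter> {0..<t} :: real set)" using countable_rat by blast
        fix q assume "q \<in> \<rat> \<inter> {0..<t}"
        then have "(\<lambda>\<omega>. norm (Y q \<omega>)) \<in> borel_measurable (F u)" using tu by (intro Yn) auto
        then show "{\<omega> \<in> space (F u). real n < norm (Y q \<omega>)} \<in> sets (F u)" by measurable
      qed
    qed
    finally show ?thesis .
  qed
  have stop: "stopping_time F (T n)" for n
  proof (rule stopping_timeI)
    fix t :: real
    have "{\<omega> \<in> space (F t). T n \<omega> \<le> t} \<in> sets (F t)"
    proof (cases "0 \<le> t")
      case False
      then have "{\<omega> \<in> space (F t). T n \<omega> \<le> t} = {}" using T0 by (auto intro: order_trans)
      then show ?thesis by (metis sets.empty_sets)
    next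
      case True
      \<comment> \<open>The past of a time decides only the strict inequality there. Letting that
        time decrease to \<open>t\<close> places the event in \<open>F u\<close> for every
        \<open>u > t\<close>, and right continuity of the filtration puts it into
        \<open>F t\<close>.\<close>
      have "{\<omega> \<in> space (F t). T n \<omega> \<le> t} \<in> sets (F u)" if u: "t < u" for u
      proof -
        have "T n \<omega> \<le> t \<longleftrightarrow> (\<forall>k. T n \<omega> < t + (u - t) / real (Suc k))" for \<omega>
        proof
          assume "T n \<omega> \<le> t"
          moreover have "0 < (u - t) / real (Suc k)" for k using u by simp
          ultimately show "\<forall>k. T n \<omega> < t + (u - t) / real (Suc k)" by (meson le_less_trans less_add_same_cancel1)
        next
          assume *: "\<forall>k. T n \<omega> < t + (u - t) / real (Suc k)"
          have "(\<lambda>k. t + (u - t) / real (Suc k)) \<longlonglongrightarrow> t + 0"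
            by (intro tendsto_add tendsto_const LIMSEQ_Suc[OF lim_const_over_n])
          then have "T n \<omega> \<le> t + 0" by (rule LIMSEQ_le_const) (use * in \<open>auto intro: less_imp_le\<close>)
          then show "T n \<omega> \<le> t" by simp
        qed
        then have "{\<omega> \<in> space (F t). T n \<omega> \<le> t} = (\<Inter>k. {\<omega> \<in> space M. T n \<omega> < t + (u - t) / real (Suc k)})"
          by (auto simp: space_F)
        also have "\<dots> \<in> sets (F u)"
        proof (rule sets.countable_INT')
          show "(\<lambda>k. {\<omega> \<in> space M. T n \<omega> < t + (u - t) / real (Suc k)}) ` UNIV \<subseteq> sets (F u)"
          proof (rule image_subsetI, rule less)
            fix k :: nat
            have "(u - t) / real (Suc k) \<le> (u - t) / 1" using u by (intro divide_left_mono) auto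
            then show "t + (u - t) / real (Suc k) \<le> u" by simp
          qed
        qed auto
        finally show ?thesis .
      qed
      then show ?thesis using right_continuous_F[OF True] by auto
    qed
    then show "Measurable.pred (F t) (\<lambda>\<omega>. T n \<omega> \<le> t)" by (simp add: pred_def)
  qed
  have inc: "incseq (\<lambda>n. T n \<omega>)" for \<omega>
  proof (rule incseq_SucI)
    fix n
    show "T n \<omega> \<le> T (Suc n) \<omega>"
      unfolding T_def
    proof (rule cInf_mono[OF ne bdd])
      fix b assume "b \<in> E (Suc n) \<omega>"
      then show "\<exists>a\<in>E n \<omega>. a \<le> b" by (cases "b = real (Suc n)") (auto simp: E_def)
    qed
  qed
  have lim: "filterlim (\<lambda>n. T n \<omega>) at_top sequentially" if \<omega>: "\<omega> \<in> space M" for \<omega>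
    unfolding filterlim_at_top
  proof
    fix Z :: real
    obtain K where K: "\<And>s. s \<in> {0..Z} \<Longrightarrow> norm (Y s \<omega>) \<le> K" using cadlag_bounded[OF cad[OF \<omega>]] by metis
    obtain N :: nat where N: "max K Z \<le> real N" using real_arch_simple by blast
    have "Z \<le> T n \<omega>" if n: "N \<le> n" for n
    proof (rule ccontr)
      assume "\<not> Z \<le> T n \<omega>"
      then have "T n \<omega> < Z" by simp
      moreover have "real N \<le> real n" using n by simp
      ultimately obtain q where "q \<in> {0..<Z}" "real n < norm (Y q \<omega>)" unfolding T_less using N by auto
      then show False using K[of q] N \<open>real N \<le> real n\<close> by auto
    qed
    then show "\<forall>\<^sub>F n in sequentially. Z \<le> T n \<omega>" by (auto simp: eventually_sequentially)
  qed
  have bound: "norm (Y t \<omega>) \<le> real n" if \<omega>: "\<omega> \<in> space M" and t: "0 \<le> t" "t < T n \<omega>" for t n \<omega>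
  proof (rule ccontr)
    assume "\<not> norm (Y t \<omega>) \<le> real n"
    then have "\<forall>\<^sub>F s in at_right t. real n < norm (Y s \<omega>)"
      by (intro order_tendstoD(1)[OF tendsto_norm[OF tendsto_right_cadlag[OF cad[OF \<omega>] t(1)]]]) simp
    then obtain b where b: "t < b" "\<And>s. t < s \<Longrightarrow> s < b \<Longrightarrow> real n < norm (Y s \<omega>)"
      by (auto simp: eventually_at_right_field)
    \<comment> \<open>The excess at \<open>t\<close> persists on a right neighbourhood, which
      contains a rational time before \<open>T n\<close>.\<close>
    obtain q where q: "q \<in> \<rat>" "t < q" "q < min b (T n \<omega>)"
      using Rats_dense_in_real[of t "min b (T n \<omega>)"] b(1) t by auto
    then have "q \<in> E n \<omega>" using b(2)[of q] t by (simp add: E_def)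
    then have "T n \<omega> \<le> q" unfolding T_def by (rule cInf_lower[OF _ bdd])
    then show False using q by simp
  qed
  show ?thesis
    unfolding locally_bounded_def
    by (rule exI[of _ T], rule exI[of _ real]) (use stop T0 inc lim bound in auto)
qed

end

text \<open>On almost every path the two forms of the equation are equivalent, so everything but
  adaptedness can be argued path by path.\<close>

lemma psd_solution_iff_path_solution:
  fixes A B C :: "real ^ 'd ^ 'd"
  assumes c: "0 < c" and C: "coercive c C" and L: "AE \<omega> in M. square_summable_jumps (\<lambda>s. L s \<omega>)"
  shows "psd_solution M F A B C L Y0 Y \<longleftrightarrow>
    adapted F Y \<and> (AE \<omega> in M. path_solution A B C (\<lambda>s. L s \<omega>) (Y0 \<omega>) (\<lambda>t. Y t \<omega>))"
proof -
  let ?eq = "\<lambda>\<omega>. \<forall>t\<ge>0. let Y_left = left_limit (\<lambda>s. Y s \<omega>) in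
    Y t \<omega> = Y0 \<omega> + (LBINT s:{0..t}. B ** Y_left s + Y_left s ** transpose B)
      + matrix_stieltjes_integral (\<lambda>s. A ** psd_sqrt (C + Y_left s)) (disc_quad_var (\<lambda>s. L s \<omega>))
          (\<lambda>s. psd_sqrt (C + Y_left s) ** transpose A) t"
  have "AE \<omega> in M. (cadlag (\<lambda>t. Y t \<omega>) \<and> (\<forall>t\<ge>0. psd (Y t \<omega>)) \<and> ?eq \<omega>) \<longleftrightarrow>
      path_solution A B C (\<lambda>s. L s \<omega>) (Y0 \<omega>) (\<lambda>t. Y t \<omega>)"
    using L
  proof eventually_elim
    case (elim \<omega>)
    show ?case
    proof (cases "cadlag (\<lambda>t. Y t \<omega>) \<and> (\<forall>t\<ge>0. psd (Y t \<omega>))")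
      case True
      then show ?thesis
        by (simp only: path_solution_def drift_def Let_def matrix_stieltjes_integral_disc_quad_var[OF c C elim] simp_thms)
    qed (auto simp: path_solution_def)
  qed
  from eventually_subst[OF this] show ?thesis
    unfolding psd_solution_def cadlag_process_def eventually_conj_iff by (simp only: conj_assoc)
qed

theorem theorem3p2:
  fixes M :: "'a measure" and F :: "real \<Rightarrow> 'a measure"
    and A B C :: "real ^ 'd ^ 'd"
    and L :: "real \<Rightarrow> 'a \<Rightarrow> real ^ 'd"
    and Y0 :: "'a \<Rightarrow> real ^ 'd ^ 'd"
  assumes "usual_filtered_prob_space M F"
    and "pos_def C"
    and "levy_process M F L"
    and "Y0 \<in> borel_measurable (F 0)"
    and "\<forall>\<omega>\<in>space M. psd (Y0 \<omega>)"
  shows "\<exists>Y. psd_solution M F A B C L Y0 Y \<and>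
     (\<forall>Y'. psd_solution M F A B C L Y0 Y' \<longrightarrow> indistinguishable M Y' Y) \<and>
     locally_bounded M F Y \<and>
     finite_variation M Y \<and>
     (AE \<omega> in M. \<forall>t\<ge>0. loewner_le
        (matrix_exp (t *\<^sub>R B) ** Y0 \<omega> ** matrix_exp (t *\<^sub>R transpose B)) (Y t \<omega>))"
proof -
  interpret usual_filtered_prob_space M F by fact
  obtain c where c: "0 < c" "coercive c C" by (rule pos_def_coercive[OF assms(2)])
  interpret J: jump_equation "{X. psd X}" "flow_coeff A B C" by (rule jump_equation_flow_coeff[OF c])
  obtain N where N': "\<And>\<omega>. \<omega> \<in> space M - N \<Longrightarrow> cadlag (\<lambda>s. L s \<omega>) \<and> square_summable_jumps (\<lambda>s. L s \<omega>)"
    "N \<in> null_sets M"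
    by (rule AE_E3[OF levy_square_summable_jumps[OF assms(3)]]) blast
  have N: "N \<in> null_sets M"
    "\<And>\<omega>. \<omega> \<in> space M \<Longrightarrow> \<omega> \<notin> N \<Longrightarrow> cadlag (\<lambda>s. L s \<omega>) \<and> square_summable_jumps (\<lambda>s. L s \<omega>)"
    using N' by simp_all
  \<comment> \<open>\<open>J.measurable_solution\<close> speaks of processes all of whose paths are
    good. On the exceptional null set the path is replaced by zero, which has no jumps.\<close>
  define L' where "L' s \<omega> = (if \<omega> \<in> N then 0 else L s \<omega>)" for s \<omega>
  have jump0: "jump (\<lambda>s. 0 :: real ^ 'd) s = 0" for s
    by (simp add: jump_def left_limit_def tendsto_Lim)
  have L'_eq: "(\<lambda>s. L' s \<omega>) = (if \<omega> \<in> N then (\<lambda>s. 0) else (\<lambda>s. L s \<omega>))" for \<omega> by (auto simp: L'_def)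
  have L': "cadlag (\<lambda>s. L' s \<omega>)" "square_summable_jumps (\<lambda>s. L' s \<omega>)" if "\<omega> \<in> space M" for \<omega>
    using N(2)[OF that] by (auto simp: L'_eq square_summable_jumps_def jump0 cadlag_def)
  have L'_meas: "L' s \<in> borel_measurable (F s)" if s: "0 \<le> s" for s
  proof -
    \<comment> \<open>By the usual conditions null sets lie in \<open>F 0\<close>, so the
      modification stays adapted.\<close>
    have "N \<in> sets (F s)" using N(1) null_sets_F sets_F_mono[OF s] by blast
    then have "Measurable.pred (F s) (\<lambda>\<omega>. \<omega> \<in> N)" by simp
    then show ?thesis unfolding L'_def using levy_adapted[OF assms(3) s]
      by (intro measurable_If) auto
  qed
  define Y where "Y t \<omega> = flow_solution A B C (\<lambda>s. L' s \<omega>) (Y0 \<omega>) t" for t \<omega>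
  have psd0: "psd (Y0 \<omega>)" if "\<omega> \<in> space M" for \<omega> using assms(5) that by blast
  note sol = flow_solution[OF c L'(2) psd0, folded Y_def]
  have cad: "cadlag (\<lambda>t. Y t \<omega>)" if "\<omega> \<in> space M" for \<omega>
    using sol(1)[OF that that, of A B] by (simp add: path_solution_def Y_def)
  have adap: "adapted F Y"
    unfolding adapted_def
  proof (intro allI impI)
    fix t :: real assume t: "0 \<le> t"
    have "(\<lambda>\<omega>. J.solution (\<lambda>s. L' s \<omega>) (Y0 \<omega>) t) \<in> borel_measurable (F t)"
      by (rule J.measurable_solution[OF filtration_axioms L'_meas L' assms(4)]) (use psd0 t in auto)
    moreover have "flow B t \<in> borel_measurable borel"
      by (rule borel_measurable_continuous_onI) (intro continuous_on_flow continuous_intros)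
    ultimately have "(\<lambda>\<omega>. flow B t (J.solution (\<lambda>s. L' s \<omega>) (Y0 \<omega>) t)) \<in> borel_measurable (F t)"
      by (rule measurable_compose)
    then show "Y t \<in> borel_measurable (F t)"
      by (rule measurable_cong[THEN iffD1, rotated])
         (simp add: Y_def flow_solution_def space_F)
  qed
  have path: "path_solution A B C (\<lambda>s. L s \<omega>) (Y0 \<omega>) (\<lambda>t. Y t \<omega>)" if "\<omega> \<in> space M" "\<omega> \<notin> N" for \<omega>
    using sol(1)[OF that(1) that(1), of A B] that(2) by (simp add: L'_eq Y_def)
  have sq: "AE \<omega> in M. square_summable_jumps (\<lambda>s. L s \<omega>)"
    using levy_square_summable_jumps[OF assms(3)] by (rule eventually_mono) (rule conjunct2)
  note iff = psd_solution_iff_path_solution[OF c sq]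
  have AE_path: "AE \<omega> in M. path_solution A B C (\<lambda>s. L s \<omega>) (Y0 \<omega>) (\<lambda>t. Y t \<omega>)"
    using AE_not_in[OF N(1)] AE_space by eventually_elim (rule path)
  then have "psd_solution M F A B C L Y0 Y" unfolding iff using adap by (rule conjI[rotated])
  moreover have "indistinguishable M Y' Y" if Y': "psd_solution M F A B C L Y0 Y'" for Y'
    using conjunct2[OF Y'[unfolded iff]] AE_path sq
    unfolding indistinguishable_def
  proof eventually_elim
    case (elim \<omega>)
    show ?case using path_solution_unique[OF c elim(3,1,2)] by blast
  qed
  moreover have "locally_bounded M F Y" by (rule cadlag_locally_bounded[OF adap cad])
  moreover have "finite_variation M Y"
    unfolding finite_variation_def
    by (rule AE_I2) (use sol(3) in \<open>simp add: Y_def\<close>)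
  \<comment> \<open>The bound holds on every constructed path; it is the flow applied to the initial
    value, rewritten by \<open>transpose_matrix_exp\<close>.\<close>
  moreover have "AE \<omega> in M. \<forall>t\<ge>0. loewner_le
        (matrix_exp (t *\<^sub>R B) ** Y0 \<omega> ** matrix_exp (t *\<^sub>R transpose B)) (Y t \<omega>)"
    by (rule AE_I2) (use sol(2) in \<open>simp add: Y_def loewner_le_def flow_def transpose_matrix_exp\<close>)
  ultimately show ?thesis by blast
qed

end
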